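(* Let $p,p'\ge 1$, $n=p+p'$, $0\le r\le p$, $0\le r'\le p'$, $1\le k:=r+r'\le n-1$. For the $SU(p,p')$-flag domain $D=D_{r,r'}$ in the Grassmannian $Gr_k(\mathbb{C}^n)$, and for $Y=\mu(\nu^{-1}(B))$ where $B$ is any relatively compact domain with smooth boundary in $\mathcal{M}_D$ containing $[C_0]$, it follows that $$c(Y)\ \ge\ \min\{r+p'-r',\ p-r+r'\}.$$
   Context: $G_0=SU(p,p')$ is the real form of $G=SL_n(\mathbb{C})$ preserving the Hermitian form $h(z,w)=z^tE_{p,p'}\bar w$ with $E_{p,p'}=\mathrm{Diag}(Id_p,-Id_{p'})$. $Z=Gr_k(\mathbb{C}^n)$ is the Grassmannian of $k$-dimensional subspaces, and $D_{r,r'}=\{V\in Z: \mathrm{sign}(h|_V)=(r,r')\}$, an open $G_0$-orbit in $Z$. Cycle space: let $K_0$ be a maximal compact subgroup of $G_0$ and $K\subset G$ its complexification. $K_0$ has a unique orbit $C_0$ in $D$ which is a complex submanifold (the base cycle). With $q=\dim_{\mathbb{C}}C_0$, let $\mathcal{M}_Z:=G.[C_0]$ be the orbit of $C_0$ in the space $\mathcal{C}_q(Z)$ of $q$-dimensional compact cycles in $Z$, and let $\mathcal{M}_D$ be the connected component containing $[C_0]$ of the (open) set of $[C]\in\mathcal{M}_Z$ with $C\subset D$. Let $\mathfrak{X}_D=\{(p,[C])\in D\times\mathcal{M}_D: p\in C\}$ with projections $\mu:\mathfrak{X}_D\to D$ (open) and $\nu:\mathfrak{X}_D\to\mathcal{M}_D$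 (proper). Supporting cycles and $c(Y)$: $Y=\mu(\nu^{-1}(B))$ is a relatively compact open subset of $D$. For $p_0\in\partial Y$ a supporting cycle at $p_0$ is a cycle $C$ with $[C]\in\partial B$ and $p_0\in C$ (such cycles exist for every $p_0\in\partial Y$ and lie in the closure of $Y$). Let $c(C,p_0)$ be the maximal $d\ge 0$ for which there is a $d$-dimensional polydisk contained in $C$, centered at $p_0$, which except for $p_0$ lies in $Y$; that is, a holomorphic map $F:\Delta_d(\rho)=\{z\in\mathbb{C}^d:|z_i|\le \rho\ \forall i\}\to C$ with $F(0)=p_0$, with $dF$ of rank $d$ everywhere, and $F(\Delta_d(\rho)\setminus\{0\})\subset Y$. Let $c(p_0)$ be the maximum of $c(C,p_0)$ over all supporting cycles $C$ at $p_0$, and let $c(Y)$ be the minimum of $c(p_0)$ over $p_0\in\partial Y$. *)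

theory Defs
  imports "HOL-Analysis.Analysis"
begin

section \<open>The Grassmannian as a complex manifold\<close>

definition Gr :: "nat \<Rightarrow> (complex ^ 'n::finite) set set" where
  "Gr k = {V. vec.subspace V \<and> vec.dim V = k}"

text \<open>
  Affine charts: for a set \<open>I\<close> of \<open>k\<close> coordinates and a coefficient matrix \<open>A\<close>, the graph of the
  linear map from \<open>\<complex>\<^sup>I\<close> to \<open>\<complex>\<^sup>J\<close>, \<open>J\<close> the complement of \<open>I\<close>, given by \<open>A\<close>.  Matrices are flattened
  to vectors indexed by pairs (row, column), and only the entries in \<open>J \<times> I\<close> matter.
\<close>

definition gr_graph :: "'n set \<Rightarrow> complex ^ ('n \<times> 'n) \<Rightarrow> (complex ^ 'n::finite) set" where
  "gr_graph I A = {x. \<forall>j. j \<notin> I \<longrightarrow> x $ j = (\<Sum>i\<in>I. A $ (j, i) * x $ i)}"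

definition gr_chart_dom :: "'n set \<Rightarrow> (complex ^ 'n::finite) set set" where
  "gr_chart_dom I = range (gr_graph I)"

definition gr_coord :: "'n set \<Rightarrow> (complex ^ 'n::finite) set \<Rightarrow> complex ^ ('n \<times> 'n)" where
  "gr_coord I V = (THE A. (\<forall>j i. j \<in> I \<or> i \<notin> I \<longrightarrow> A $ (j, i) = 0) \<and> gr_graph I A = V)"

text \<open>The manifold topology of the atlas of affine charts.\<close>

definition gr_topology :: "nat \<Rightarrow> (complex ^ 'n::finite) set topology" where
  "gr_topology k =
    topology (\<lambda>U. U \<subseteq> Gr k \<and> (\<forall>I. card I = k \<longrightarrow> open {A. gr_graph I A \<in> U}))"

lemma openin_gr_topology:
  fixes U :: "(complex ^ 'n::finite) set set"
  shows "openin (gr_topology k) U \<longleftrightarrow>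
    U \<subseteq> Gr k \<and> (\<forall>I. card I = k \<longrightarrow> open {A. gr_graph I A \<in> U})"
proof -
  let ?P = "\<lambda>U::(complex ^ 'n) set set.
    U \<subseteq> Gr k \<and> (\<forall>I. card I = k \<longrightarrow> open {A. gr_graph I A \<in> U})"
  have "istopology ?P"
    unfolding istopology_def
  proof (intro conjI allI impI)
    fix S T :: "(complex ^ 'n) set set" and I :: "'n set"
    assume "?P S" "?P T" "card I = k"
    then have "open ({A. gr_graph I A \<in> S} \<inter> {A. gr_graph I A \<in> T})"
      by (intro open_Int) auto
    also have "{A. gr_graph I A \<in> S} \<inter> {A. gr_graph I A \<in> T} = {A. gr_graph I A \<in> S \<inter> T}"
      by auto
    finally show "open {A. gr_graph I A \<in> S \<inter> T}" .
  next
    fix \<K> :: "(complex ^ 'n) set set set" and I :: "'n set"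
    assume "\<forall>K\<in>\<K>. ?P K" "card I = k"
    then have "open (\<Union>K\<in>\<K>. {A. gr_graph I A \<in> K})"
      by (intro open_UN) auto
    also have "(\<Union>K\<in>\<K>. {A. gr_graph I A \<in> K}) = {A. gr_graph I A \<in> \<Union>\<K>}"
      by auto
    finally show "open {A. gr_graph I A \<in> \<Union>\<K>}" .
  qed auto
  then show ?thesis
    unfolding gr_topology_def by (simp add: topology_inverse')
qed


section \<open>Holomorphic maps from polydisks\<close>

text \<open>
  The dimension \<open>d\<close> of a polydisk is a quantified natural number, so \<open>\<complex>\<^sup>d\<close> is realised as the
  space of sequences vanishing from index \<open>d\<close> on.
\<close>

definition cspace :: "nat \<Rightarrow> (nat \<Rightarrow> complex) set" where
  "cspace d = {z. \<forall>i\<ge>d. z i = 0}"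

definition closed_polydisk :: "nat \<Rightarrow> real \<Rightarrow> (nat \<Rightarrow> complex) set" where
  "closed_polydisk d \<rho> = {z \<in> cspace d. \<forall>i<d. cmod (z i) \<le> \<rho>}"

definition open_polydisk :: "nat \<Rightarrow> real \<Rightarrow> (nat \<Rightarrow> complex) set" where
  "open_polydisk d \<rho> = {z \<in> cspace d. \<forall>i<d. cmod (z i) < \<rho>}"

text \<open>
  Complex differentiability at \<open>z\<close> of a vector-valued function of \<open>d\<close> complex variables; the
  differential is the complex-linear map with partial derivatives \<open>D 0, \<dots>, D (d - 1)\<close>.
\<close>

definition has_complex_derivative ::
  "nat \<Rightarrow> ((nat \<Rightarrow> complex) \<Rightarrow> complex ^ 'm::finite) \<Rightarrow> (nat \<Rightarrow> complex ^ 'm) \<Rightarrow>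
    (nat \<Rightarrow> complex) \<Rightarrow> bool" where
  "has_complex_derivative d f D z \<longleftrightarrow>
    (\<forall>\<epsilon>>0. \<exists>\<delta>>0. \<forall>h\<in>cspace d. (\<Sum>i<d. cmod (h i)) < \<delta> \<longrightarrow>
      norm (f (\<lambda>i. z i + h i) - f z - (\<Sum>i<d. h i *s D i)) \<le> \<epsilon> * (\<Sum>i<d. cmod (h i)))"

text \<open>
  As usual for sets that need not be open, holomorphic on \<open>S\<close> means holomorphic on a neighbourhood
  of \<open>S\<close> in \<open>\<complex>\<^sup>d\<close>.
\<close>

definition gr_holomorphic_on ::
  "nat \<Rightarrow> nat \<Rightarrow> ((nat \<Rightarrow> complex) \<Rightarrow> (complex ^ 'n::finite) set) \<Rightarrow> (nat \<Rightarrow> complex) set \<Rightarrow> bool" where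
  "gr_holomorphic_on k d F S \<longleftrightarrow>
    (\<forall>z\<in>S. \<exists>I e. card I = k \<and> e > 0 \<and>
      (\<forall>w\<in>cspace d. (\<forall>i<d. cmod (w i - z i) < e) \<longrightarrow>
        F w \<in> gr_chart_dom I \<and> (\<exists>D. has_complex_derivative d (gr_coord I \<circ> F) D w)))"

text \<open>For a map holomorphic near \<open>z\<close>, the choice of the chart is immaterial.\<close>

definition gr_differential_rank ::
  "nat \<Rightarrow> nat \<Rightarrow> ((nat \<Rightarrow> complex) \<Rightarrow> (complex ^ 'n::finite) set) \<Rightarrow> (nat \<Rightarrow> complex) \<Rightarrow> nat \<Rightarrow> bool"
  where
  "gr_differential_rank k d F z m \<longleftrightarrow>
    (\<exists>I D. card I = k \<and> F z \<in> gr_chart_dom I \<and>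
      has_complex_derivative d (gr_coord I \<circ> F) D z \<and> vec.dim (D ` {..<d}) = m)"

definition gr_complex_submanifold :: "nat \<Rightarrow> (complex ^ 'n::finite) set set \<Rightarrow> bool" where
  "gr_complex_submanifold k C \<longleftrightarrow>
    C \<subseteq> Gr k \<and>
    (\<exists>q. \<forall>V\<in>C. \<exists>U F \<rho>. openin (gr_topology k) U \<and> \<rho> > 0 \<and> F (\<lambda>_. 0) = V \<and>
      gr_holomorphic_on k q F (open_polydisk q \<rho>) \<and>
      (\<forall>z\<in>open_polydisk q \<rho>. gr_differential_rank k q F z q) \<and>
      homeomorphic_map (top_of_set (open_polydisk q \<rho>)) (subtopology (gr_topology k) (C \<inter> U)) F)"


section \<open>Group actions and flag domains\<close>

definition SL :: "(complex ^ 'n ^ 'n::finite) set" where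
  "SL = {g. det g = 1}"

definition act :: "complex ^ 'n ^ 'n \<Rightarrow> (complex ^ 'n::finite) set \<Rightarrow> (complex ^ 'n) set" where
  "act g V = (\<lambda>v. g *v v) ` V"

definition act_cycle ::
  "complex ^ 'n ^ 'n \<Rightarrow> (complex ^ 'n::finite) set set \<Rightarrow> (complex ^ 'n) set set" where
  "act_cycle g C = act g ` C"

text \<open>
  The index type \<open>'p + 'q\<close> of \<open>\<complex>\<^sup>n\<close> splits the coordinates into the positive ones, indexed by \<open>'p\<close>,
  and the negative ones, indexed by \<open>'q\<close>; thus \<open>p = CARD('p) \<ge> 1\<close>, \<open>p' = CARD('q) \<ge> 1\<close>.
\<close>

definition E_mat :: "complex ^ ('p::finite + 'q::finite) ^ ('p + 'q)" where
  "E_mat = (\<chi> i j. if i = j then (case i of Inl _ \<Rightarrow> 1 | Inr _ \<Rightarrow> - 1) else 0)"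

definition herm :: "complex ^ ('p::finite + 'q::finite) \<Rightarrow> complex ^ ('p + 'q) \<Rightarrow> complex" where
  "herm z w = (\<Sum>i\<in>UNIV. z $ i * (E_mat *v (\<chi> j. cnj (w $ j))) $ i)"

text \<open>Indices of inertia of the restricted form; \<open>herm w w\<close> is always real.\<close>

definition herm_sign :: "(complex ^ ('p::finite + 'q::finite)) set \<Rightarrow> nat \<times> nat" where
  "herm_sign V =
    (Max {vec.dim W | W. vec.subspace W \<and> W \<subseteq> V \<and> (\<forall>w\<in>W. w \<noteq> 0 \<longrightarrow> Re (herm w w) > 0)},
     Max {vec.dim W | W. vec.subspace W \<and> W \<subseteq> V \<and> (\<forall>w\<in>W. w \<noteq> 0 \<longrightarrow> Re (herm w w) < 0)})"

definition flag_domain :: "nat \<Rightarrow> nat \<Rightarrow> (complex ^ ('p::finite + 'q::finite)) set set" where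
  "flag_domain r r' = {V \<in> Gr (r + r'). herm_sign V = (r, r')}"

definition SU :: "(complex ^ ('p + 'q) ^ ('p::finite + 'q::finite)) set" where
  "SU = {g \<in> SL. \<forall>z w. herm (g *v z) (g *v w) = herm z w}"

definition compact_subgroup ::
  "(complex ^ 'n ^ 'n::finite) set \<Rightarrow> (complex ^ 'n ^ 'n) set \<Rightarrow> bool" where
  "compact_subgroup K G \<longleftrightarrow>
    K \<subseteq> G \<and> compact K \<and> mat 1 \<in> K \<and>
    (\<forall>g\<in>K. \<forall>h\<in>K. g ** h \<in> K) \<and> (\<forall>g\<in>K. matrix_inv g \<in> K)"

definition maximal_compact_subgroup ::
  "(complex ^ 'n ^ 'n::finite) set \<Rightarrow> (complex ^ 'n ^ 'n) set \<Rightarrow> bool" where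
  "maximal_compact_subgroup K G \<longleftrightarrow>
    compact_subgroup K G \<and> (\<forall>K'. compact_subgroup K' G \<and> K \<subseteq> K' \<longrightarrow> K' = K)"

definition base_cycle ::
  "(complex ^ ('p + 'q) ^ ('p::finite + 'q::finite)) set \<Rightarrow> nat \<Rightarrow> nat \<Rightarrow>
    (complex ^ ('p + 'q)) set set \<Rightarrow> bool" where
  "base_cycle K0 r r' C0 \<longleftrightarrow>
    (\<exists>V\<in>flag_domain r r'. C0 = {act g V | g. g \<in> K0}) \<and> gr_complex_submanifold (r + r') C0"


section \<open>Cycle spaces\<close>

text \<open>
  All cycles in the orbit of \<open>C\<^sub>0\<close> are submanifolds with multiplicity one and are identified with
  their supports.  The orbit carries its structure of a homogeneous manifold under \<open>SL\<close>:
  a set of cycles is open iff its preimage under the orbit map is open in \<open>SL\<close>, and a function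
  is smooth iff its pullback to the submanifold \<open>SL\<close> of the matrix space is smooth.
\<close>

definition M_Z :: "(complex ^ 'n::finite) set set \<Rightarrow> (complex ^ 'n) set set set" where
  "M_Z C0 = {act_cycle g C0 | g. g \<in> SL}"

definition cycle_topology :: "(complex ^ 'n::finite) set set \<Rightarrow> (complex ^ 'n) set set topology" where
  "cycle_topology C0 =
    topology (\<lambda>\<U>. \<U> \<subseteq> M_Z C0 \<and> openin (top_of_set SL) {g \<in> SL. act_cycle g C0 \<in> \<U>})"

lemma openin_cycle_topology:
  fixes C0 :: "(complex ^ 'n::finite) set set"
  shows "openin (cycle_topology C0) \<U> \<longleftrightarrow>
    \<U> \<subseteq> M_Z C0 \<and> openin (top_of_set SL) {g \<in> SL. act_cycle g C0 \<in> \<U>}"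
proof -
  let ?P = "\<lambda>\<U>::(complex ^ 'n) set set set. \<U> \<subseteq> M_Z C0 \<and> openin (top_of_set SL) {g \<in> SL. act_cycle g C0 \<in> \<U>}"
  have "istopology ?P"
    unfolding istopology_def
  proof (intro conjI allI impI)
    fix S T assume "?P S" "?P T"
    then have "openin (top_of_set SL)
        ({g \<in> SL. act_cycle g C0 \<in> S} \<inter> {g \<in> SL. act_cycle g C0 \<in> T})"
      by (intro openin_Int) auto
    also have "{g \<in> SL. act_cycle g C0 \<in> S} \<inter> {g \<in> SL. act_cycle g C0 \<in> T} =
        {g \<in> SL. act_cycle g C0 \<in> S \<inter> T}"
      by auto
    finally show "openin (top_of_set SL) {g \<in> SL. act_cycle g C0 \<in> S \<inter> T}" .
  next
    fix \<K> assume "\<forall>K\<in>\<K>. ?P K"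
    then have "openin (top_of_set SL) (\<Union>K\<in>\<K>. {g \<in> SL. act_cycle g C0 \<in> K})"
      by (intro openin_Union) auto
    also have "(\<Union>K\<in>\<K>. {g \<in> SL. act_cycle g C0 \<in> K}) = {g \<in> SL. act_cycle g C0 \<in> \<Union>\<K>}"
      by auto
    finally show "openin (top_of_set SL) {g \<in> SL. act_cycle g C0 \<in> \<Union>\<K>}" .
  qed auto
  then show ?thesis
    unfolding cycle_topology_def by (simp add: topology_inverse')
qed

definition M_D ::
  "(complex ^ 'n::finite) set set \<Rightarrow> (complex ^ 'n) set set \<Rightarrow> (complex ^ 'n) set set set" where
  "M_D D C0 =
    connected_component_of_set (subtopology (cycle_topology C0) {C \<in> M_Z C0. C \<subseteq> D}) C0"

definition M_D_topology ::
  "(complex ^ 'n::finite) set set \<Rightarrow> (complex ^ 'n) set set \<Rightarrow> (complex ^ 'n) set set topology" where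
  "M_D_topology D C0 = subtopology (cycle_topology C0) (M_D D C0)"

fun Ck_on :: "nat \<Rightarrow> 'a::real_normed_vector set \<Rightarrow> ('a \<Rightarrow> real) \<Rightarrow> bool" where
  "Ck_on 0 W f = continuous_on W f"
| "Ck_on (Suc k) W f =
    ((\<forall>x\<in>W. f differentiable (at x)) \<and> (\<forall>v. Ck_on k W (\<lambda>x. frechet_derivative f (at x) v)))"

definition smooth_on_cycles ::
  "(complex ^ 'n::finite) set set \<Rightarrow> (complex ^ 'n) set set set \<Rightarrow>
    ((complex ^ 'n) set set \<Rightarrow> real) \<Rightarrow> bool" where
  "smooth_on_cycles C0 \<U> \<rho> \<longleftrightarrow>
    (\<forall>g\<in>SL. act_cycle g C0 \<in> \<U> \<longrightarrow>
      (\<exists>W f. open W \<and> g \<in> W \<and> (\<forall>k. Ck_on k W f) \<and>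
        (\<forall>h\<in>W \<inter> SL. f h = \<rho> (act_cycle h C0))))"

text \<open>
  \<open>d\<rho>\<close> does not vanish at the cycle \<open>C\<close>.  Since the orbit map is a submersion, tangent vectors
  at \<open>C\<close> are represented by curves in \<open>SL\<close>.
\<close>

definition nonzero_differential ::
  "(complex ^ 'n::finite) set set \<Rightarrow> ((complex ^ 'n) set set \<Rightarrow> real) \<Rightarrow> (complex ^ 'n) set set \<Rightarrow> bool"
  where
  "nonzero_differential C0 \<rho> C \<longleftrightarrow>
    (\<exists>\<gamma> l. (\<forall>t::real. \<gamma> t \<in> SL) \<and> \<gamma> differentiable (at 0) \<and> act_cycle (\<gamma> 0) C0 = C \<and>
      ((\<lambda>t. \<rho> (act_cycle (\<gamma> t) C0)) has_real_derivative l) (at 0) \<and> l \<noteq> 0)"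

definition smooth_boundary ::
  "(complex ^ 'n::finite) set set \<Rightarrow> (complex ^ 'n) set set \<Rightarrow> (complex ^ 'n) set set set \<Rightarrow> bool" where
  "smooth_boundary D C0 B \<longleftrightarrow>
    (\<forall>C\<in>M_D_topology D C0 frontier_of B. \<exists>\<U> \<rho>.
      openin (M_D_topology D C0) \<U> \<and> C \<in> \<U> \<and> smooth_on_cycles C0 \<U> \<rho> \<and>
      nonzero_differential C0 \<rho> C \<and> B \<inter> \<U> = {C' \<in> \<U>. \<rho> C' < 0})"

definition relatively_compact_smooth_domain ::
  "(complex ^ 'n::finite) set set \<Rightarrow> (complex ^ 'n) set set \<Rightarrow> (complex ^ 'n) set set set \<Rightarrow> bool" where
  "relatively_compact_smooth_domain D C0 B \<longleftrightarrow>
    openin (M_D_topology D C0) B \<and> connectedin (M_D_topology D C0) B \<and>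
    compactin (M_D_topology D C0) (M_D_topology D C0 closure_of B) \<and> smooth_boundary D C0 B"

definition X_D ::
  "(complex ^ 'n::finite) set set \<Rightarrow> (complex ^ 'n) set set \<Rightarrow>
    ((complex ^ 'n) set \<times> (complex ^ 'n) set set) set" where
  "X_D D C0 = {(V, C). V \<in> D \<and> C \<in> M_D D C0 \<and> V \<in> C}"

text \<open>\<open>\<mu>(\<nu>\<inverse>(B))\<close> for the two projections of \<open>X_D\<close>.\<close>

definition swept_domain ::
  "(complex ^ 'n::finite) set set \<Rightarrow> (complex ^ 'n) set set \<Rightarrow> (complex ^ 'n) set set set \<Rightarrow>
    (complex ^ 'n) set set" where
  "swept_domain D C0 B = fst ` {x \<in> X_D D C0. snd x \<in> B}"


section \<open>The invariant c(Y)\<close>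

definition supporting_cycles ::
  "(complex ^ 'n::finite) set set \<Rightarrow> (complex ^ 'n) set set \<Rightarrow> (complex ^ 'n) set set set \<Rightarrow>
    (complex ^ 'n) set \<Rightarrow> (complex ^ 'n) set set set" where
  "supporting_cycles D C0 B p0 = {C \<in> M_D_topology D C0 frontier_of B. p0 \<in> C}"

text \<open>The sets below are nonempty and finite, since \<open>d\<close> is bounded by the dimension of \<open>Gr k\<close>.\<close>

definition c_cycle ::
  "nat \<Rightarrow> (complex ^ 'n::finite) set set \<Rightarrow> (complex ^ 'n) set set \<Rightarrow> (complex ^ 'n) set \<Rightarrow> nat" where
  "c_cycle k Y C p0 =
    Max {d. \<exists>\<rho>>0. \<exists>F. gr_holomorphic_on k d F (closed_polydisk d \<rho>) \<and>
      F ` closed_polydisk d \<rho> \<subseteq> C \<and> F (\<lambda>_. 0) = p0 \<and>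
      (\<forall>z\<in>closed_polydisk d \<rho>. gr_differential_rank k d F z d) \<and>
      F ` (closed_polydisk d \<rho> - {\<lambda>_. 0}) \<subseteq> Y}"

definition c_point ::
  "nat \<Rightarrow> (complex ^ 'n::finite) set set \<Rightarrow> (complex ^ 'n) set set \<Rightarrow> (complex ^ 'n) set set set \<Rightarrow>
    (complex ^ 'n) set \<Rightarrow> nat" where
  "c_point k D C0 B p0 =
    Max ((\<lambda>C. c_cycle k (swept_domain D C0 B) C p0) ` supporting_cycles D C0 B p0)"

definition c_inv ::
  "nat \<Rightarrow> (complex ^ 'n::finite) set set \<Rightarrow> (complex ^ 'n) set set \<Rightarrow> (complex ^ 'n) set set set \<Rightarrow> nat" where
  "c_inv k D C0 B =
    Min (c_point k D C0 B ` (subtopology (gr_topology k) D frontier_of swept_domain D C0 B))"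

end

theory Submission
  imports Defs
begin

text \<open>
  A maximal compact subgroup of \<open>SU(p,p')\<close> is conjugate to the group of block diagonal unitary
  matrices, and an orbit of that group is a complex submanifold only if its points are split, i.e.
  direct sums of a positive and a negative coordinate part: otherwise the flow \<open>1 + t prp\<close>, whose
  direction would be tangent to the orbit by complex linearity, increases the trace of \<open>prp\<close>
  compressed to the moving subspace, although that trace is constant on the orbit.  Hence every cycle
  is a translate of the orbit of a coordinate subspace \<open>E0\<close>, and both \<open>M_Z\<close> and the Grassmannian
  are described by small matrices \<open>y\<close> near the identity acting on cycles and subspaces.

  At a supporting cycle \<open>C = T Cstd\<close> of \<open>p0 = T E0\<close> let \<open>L\<close> be the differential of the boundary
  defining function along \<open>1 + t T X T\<inverse>\<close>.  It vanishes on block diagonal \<open>X\<close>, which fix \<open>C\<close>, and on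
  \<open>X\<close> preserving \<open>E0\<close>, since \<open>p0\<close> is not swept out; so \<open>L\<close> is nonzero on some elementary matrix \<open>X0\<close>
  in position \<open>(j0, i0)\<close> with \<open>i0 \<in> I0\<close>, \<open>j0 \<notin> I0\<close> in opposite blocks.  Block
  diagonal perturbations \<open>N z\<close> of \<open>E0\<close> in the column \<open>i0\<close> and the row \<open>j0\<close> form a polydisk in \<open>C\<close>, whose
  dimension is one of the two numbers in the theorem.  For \<open>z \<noteq> 0\<close> a matrix \<open>X\<close> with \<open>L X = L X0 \<noteq> 0\<close>
  preserves \<open>(1 + N z) E0\<close>, so this point also lies on cycles in \<open>B\<close>.
\<close>

section \<open>Matrices near the identity\<close>

text \<open>Scalar matrices fix every subspace, so rescaling \<open>y\<close> to determinant one
  changes neither its action on subspaces nor that on cycles. Tangent vectors can therefore be taken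
  in the full matrix algebra, and every local statement becomes one about matrices near the
  identity.

  A nonzero \<open>L X\<close> of either sign suffices: the boundary cycle enters \<open>B\<close>
  along one of the two half-lines of \<open>t X\<close>. The matrix \<open>X\<close> of the last
  step differs from \<open>X0\<close> by an elementary matrix preserving \<open>E0\<close>, on which
  \<open>L\<close> vanishes. Its coefficient has a factor \<open>1 / z k\<close>, which is why the
  centre of the polydisk is excluded.

  If \<open>i0\<close> is a positive index, the column contributes \<open>p - r\<close> and the row
  \<open>r'\<close> free entries; if it is negative, \<open>q - r'\<close> and \<open>r\<close>,
  where \<open>p\<close> and \<open>q\<close> are the block sizes. The boundary decides which case
  occurs, hence the minimum.

  As the invariant is a minimum of maxima over sets of naturals, finiteness and nonemptiness have to
  be proved too. For the frontier of the swept domain this takes a path from \<open>C0\<close> that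
  leaves \<open>D\<close>, together with compactness of the closure of \<open>B\<close>.\<close>

lemma bounded_bilinear_matrix_mult:
  "bounded_bilinear ((**) :: complex^'n::finite^'m::finite \<Rightarrow> complex^'k::finite^'n \<Rightarrow> complex^'k^'m)"
proof -
  have "bilinear ((**) :: complex^'n^'m \<Rightarrow> complex^'k^'n \<Rightarrow> complex^'k^'m)"
    unfolding bilinear_def
    by (intro conjI allI linearI; simp add: matrix_matrix_mult_def vec_eq_iff algebra_simps
      sum.distrib scaleR_sum_right)
  then show ?thesis by (simp add: bilinear_conv_bounded_bilinear)
qed

lemma bounded_bilinear_matrix_vector_mult:
  "bounded_bilinear ((*v) :: complex^'n::finite^'m::finite \<Rightarrow> complex^'n \<Rightarrow> complex^'m)"
proof -
  have "bilinear ((*v) :: complex^'n^'m \<Rightarrow> complex^'n \<Rightarrow> complex^'m)"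
    unfolding bilinear_def
    by (intro conjI allI linearI; simp add: matrix_vector_mult_def vec_eq_iff algebra_simps
      sum.distrib scaleR_sum_right)
  then show ?thesis by (simp add: bilinear_conv_bounded_bilinear)
qed

lemmas tendsto_matrix_mult [tendsto_intros] =
  bounded_bilinear.tendsto[OF bounded_bilinear_matrix_mult]
lemmas tendsto_matrix_vector_mult [tendsto_intros] =
  bounded_bilinear.tendsto[OF bounded_bilinear_matrix_vector_mult]
lemmas continuous_on_matrix_mult [continuous_intros] =
  bounded_bilinear.continuous_on[OF bounded_bilinear_matrix_mult]
lemmas continuous_on_matrix_vector_mult [continuous_intros] =
  bounded_bilinear.continuous_on[OF bounded_bilinear_matrix_vector_mult]

lemmas matrix_mult_scaleR =
  bounded_bilinear.scaleR_left[OF bounded_bilinear_matrix_mult]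
  bounded_bilinear.scaleR_right[OF bounded_bilinear_matrix_mult]

lemma matrix_mult_norm_bound:
  obtains K where "K > 0"
    "\<And>(A::complex^'n::finite^'m::finite) (B::complex^'k::finite^'n). norm (A ** B) \<le> norm A * norm B * K"
  using bounded_bilinear.pos_bounded[OF bounded_bilinear_matrix_mult] by blast

lemma matrix_vector_mult_norm_bound:
  obtains K where "K > 0"
    "\<And>(A::complex^'n::finite^'m::finite) x. norm (A *v x) \<le> norm A * norm x * K"
  using bounded_bilinear.pos_bounded[OF bounded_bilinear_matrix_vector_mult] by blast

lemma differentiable_prod:
  fixes f :: "'i \<Rightarrow> 'a::real_normed_vector \<Rightarrow> complex"
  assumes "\<And>i. i \<in> I \<Longrightarrow> f i differentiable (at a within S)"
  shows "(\<lambda>x. \<Prod>i\<in>I. f i x) differentiable (at a within S)"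
proof (cases "finite I")
  case True
  then show ?thesis using assms
    by (induction I) (auto intro!: differentiable_mult)
qed simp

lemma differentiable_entry:
  "(\<lambda>A::complex^'n::finite^'m::finite. A $ i $ j) differentiable F"
  by (intro bounded_linear_imp_differentiable bounded_linear_compose[OF bounded_linear_vec_nth]
      bounded_linear_vec_nth)

lemma differentiable_det: "(det :: complex^'n::finite^'n \<Rightarrow> complex) differentiable (at B within S)"
proof -
  have "(\<lambda>A::complex^'n^'n. \<Sum>p\<in>{p. p permutes UNIV}. of_int (sign p) * (\<Prod>i\<in>UNIV. A $ i $ p i))
      differentiable (at B within S)"
    by (intro differentiable_sum differentiable_mult differentiable_prod differentiable_entry
       differentiable_const ballI finite_permutations finite)
  then show ?thesis unfolding det_def[abs_def] .
qed

lemma isCont_det: "isCont (det :: complex^'n::finite^'n \<Rightarrow> complex) A"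
  by (rule differentiable_imp_continuous_within[OF differentiable_det])

lemma tendsto_det [tendsto_intros]:
  "(f \<longlongrightarrow> A) F \<Longrightarrow> ((\<lambda>x. det (f x :: complex^'n::finite^'n)) \<longlongrightarrow> det A) F"
  by (rule isCont_tendsto_compose[OF isCont_det])

lemma continuous_on_det [continuous_intros]:
  "continuous_on S (det :: complex^'n::finite^'n \<Rightarrow> complex)"
  by (simp add: continuous_at_imp_continuous_on isCont_det)

lemma matrix_inv_left: "invertible A \<Longrightarrow> matrix_inv A ** A = mat 1"
  and matrix_inv_right: "invertible A \<Longrightarrow> A ** matrix_inv A = mat 1"
  for A :: "complex^'n::finite^'n"
  unfolding invertible_def matrix_inv_def by (metis (mono_tags, lifting) someI_ex)+

lemma invertible_matrix_inv: "invertible A \<Longrightarrow> invertible (matrix_inv A)"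
  for A :: "complex^'n::finite^'n"
  using matrix_inv_left matrix_inv_right invertible_def by blast

lemma matrix_inv_unique: "A ** B = mat 1 \<Longrightarrow> matrix_inv A = B"
  for A :: "complex^'n::finite^'n"
  by (metis invertible_right_inverse matrix_inv_left matrix_mul_assoc matrix_mul_lid matrix_mul_rid)

lemma invertibleI: "A ** B = mat 1 \<Longrightarrow> invertible A"
  for A :: "complex^'n::finite^'n"
  using invertible_right_inverse by blast

lemma matrix_inv_cancel [simp]:
  fixes A :: "complex^'n::finite^'n"
  assumes "invertible A"
  shows "matrix_inv A *v (A *v x) = x" "A *v (matrix_inv A *v x) = x"
    "matrix_inv A ** (A ** (X::complex^'k::finite^'n)) = X" "A ** (matrix_inv A ** X) = X"
  using assms by (simp_all add: matrix_vector_mul_assoc matrix_mul_assoc matrix_inv_left matrix_inv_right)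

lemma invertible_mat_1 [simp]: "invertible (mat 1 :: complex^'n::finite^'n)"
  by (rule invertibleI[of _ "mat 1"]) simp

lemma eventually_invertible_nhds:
  assumes "invertible (A::complex^'n::finite^'n)"
  shows "\<forall>\<^sub>F y in nhds A. invertible y"
proof -
  have "(det \<longlongrightarrow> det A) (nhds A)" by (intro tendsto_det filterlim_ident)
  moreover have "det A \<noteq> 0" using assms invertible_det_nz by blast
  ultimately have "\<forall>\<^sub>F y in nhds A. det y \<noteq> 0" using tendsto_imp_eventually_ne by blast
  then show ?thesis by eventually_elim (simp add: invertible_det_nz)
qed

lemma matrix_diff_ldistrib: "A ** (B - C) = A ** B - A ** (C::complex^'k::finite^'n::finite)"
  and matrix_diff_rdistrib: "(A' - B') ** C = A' ** C - B' ** C"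
  for A :: "complex^'n^'m::finite"
  by (simp_all add: matrix_matrix_mult_def vec_eq_iff algebra_simps sum_subtractf)

lemma matrix_add_rdistrib: "(A + B) ** C = A ** C + B ** (C::complex^'k::finite^'n::finite)"
  by (simp add: matrix_matrix_mult_def vec_eq_iff algebra_simps sum.distrib)

text \<open>With \<open>H = y - 1\<close> one has
  \<open>matrix_inv y - 1 = - (H ** matrix_inv y)\<close>. This first bounds
  \<open>matrix_inv y\<close>; substituting the resulting linear estimate once more gives the
  quadratic one, which yields the derivative of inversion.\<close>

lemma matrix_inv_near_1:
  obtains C where "C > 0" "\<forall>\<^sub>F y in nhds (mat 1 :: complex^'n::finite^'n). invertible y \<and>
    norm (matrix_inv y - mat 1) \<le> C * norm (y - mat 1) \<and>
    norm (matrix_inv y - mat 1 + (y - mat 1)) \<le> C * norm (y - mat 1) * norm (y - mat 1)"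
proof -
  obtain K where K: "K > 0" "\<And>(A::complex^'n^'n) (B::complex^'n^'n). norm (A ** B) \<le> norm A * norm B * K"
    using matrix_mult_norm_bound by blast
  let ?o = "norm (mat 1 :: complex^'n^'n)"
  have o: "?o > 0" by (simp add: vec_eq_iff mat_def)
  define C where "C = max (2 * K * ?o) (2 * K * K * ?o)"
  \<comment> \<open>This radius makes \<open>norm H * K\<close> at most one half, so that the term
    with \<open>norm (matrix_inv y)\<close> on the right can be absorbed on the left.\<close>
  have ev: "\<forall>\<^sub>F y in nhds (mat 1 :: complex^'n^'n). norm (y - mat 1) < 1 / (2 * K)"
    unfolding eventually_nhds_metric using K by (auto simp: dist_norm intro!: exI[of _ "1 / (2*K)"])
  have "\<forall>\<^sub>F y in nhds (mat 1 :: complex^'n^'n). invertible y \<and>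
    norm (matrix_inv y - mat 1) \<le> C * norm (y - mat 1) \<and>
    norm (matrix_inv y - mat 1 + (y - mat 1)) \<le> C * norm (y - mat 1) * norm (y - mat 1)"
    using ev eventually_invertible_nhds[of "mat 1 :: complex^'n^'n", OF invertible_mat_1]
  proof eventually_elim
    case (elim y)
    let ?H = "y - mat 1"
    have e1: "matrix_inv y - mat 1 = - (?H ** matrix_inv y)"
      using elim by (simp add: matrix_diff_rdistrib matrix_inv_right)
    have b: "norm (?H ** matrix_inv y) \<le> norm ?H * K * norm (matrix_inv y)"
      using K(2)[of ?H "matrix_inv y"] by (simp add: algebra_simps)
    have "norm (matrix_inv y) \<le> ?o + norm (?H ** matrix_inv y)"
      by (metis e1 norm_minus_cancel norm_triangle_sub)
    also have "\<dots> \<le> ?o + 1/2 * norm (matrix_inv y)"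
    proof -
      have "norm ?H * K \<le> 1/2" using elim K by (simp add: field_simps)
      then show ?thesis using b mult_right_mono[of "norm ?H * K" "1/2" "norm (matrix_inv y)"] by auto
    qed
    finally have bd: "norm (matrix_inv y) \<le> 2 * ?o" by simp
    have n1: "norm (matrix_inv y - mat 1) \<le> (2 * K * ?o) * norm ?H"
    proof -
      have "norm (matrix_inv y - mat 1) \<le> norm ?H * K * norm (matrix_inv y)"
        unfolding e1 norm_minus_cancel by (rule b)
      also have "\<dots> \<le> norm ?H * K * (2 * ?o)" using bd K by (intro mult_left_mono) auto
      finally show ?thesis by (simp add: algebra_simps)
    qed
    have e2: "matrix_inv y - mat 1 + ?H = - (?H ** (matrix_inv y - mat 1))"
      unfolding matrix_diff_ldistrib matrix_mul_rid by (subst e1) simp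
    have "norm (matrix_inv y - mat 1 + ?H) \<le> norm ?H * ((2 * K * ?o) * norm ?H) * K"
      unfolding e2 norm_minus_cancel using K n1
      by (intro order_trans[OF K(2)] mult_right_mono mult_left_mono) auto
    also have "\<dots> = (2 * K * K * ?o) * norm ?H * norm ?H" by (simp add: algebra_simps)
    also have "\<dots> \<le> C * norm ?H * norm ?H" unfolding C_def by (intro mult_right_mono) auto
    finally have n2: "norm (matrix_inv y - mat 1 + ?H) \<le> C * norm ?H * norm ?H" .
    have "norm (matrix_inv y - mat 1) \<le> C * norm ?H"
      using n1 unfolding C_def by (rule order_trans) (intro mult_right_mono, auto)
    with n2 elim show ?case by blast
  qed
  moreover have "C > 0" unfolding C_def using K o by (auto simp: less_max_iff_disj)
  ultimately show ?thesis using that by blast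
qed

lemma has_derivative_matrix_inv_1:
  "((matrix_inv :: complex^'n::finite^'n \<Rightarrow> _) has_derivative (\<lambda>H. - H)) (at (mat 1))"
proof -
  have i1: "matrix_inv (mat 1 :: complex^'n^'n) = mat 1" by (rule matrix_inv_unique) simp
  obtain C where C: "C > 0" "\<forall>\<^sub>F y in nhds (mat 1 :: complex^'n^'n). invertible y \<and>
    norm (matrix_inv y - mat 1) \<le> C * norm (y - mat 1) \<and>
    norm (matrix_inv y - mat 1 + (y - mat 1)) \<le> C * norm (y - mat 1) * norm (y - mat 1)"
    using matrix_inv_near_1 by blast
  then obtain d where d: "d > 0" "\<And>y::complex^'n^'n. dist y (mat 1) < d \<Longrightarrow>
    norm (matrix_inv y - mat 1 + (y - mat 1)) \<le> C * norm (y - mat 1) * norm (y - mat 1)"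
    unfolding eventually_nhds_metric by blast
  show ?thesis
    unfolding has_derivative_at_alt
  proof (intro conjI allI impI)
    show "bounded_linear (\<lambda>H::complex^'n^'n. - H)" by (intro bounded_linear_minus bounded_linear_ident)
    fix e :: real assume "e > 0"
    show "\<exists>d>0. \<forall>y::complex^'n^'n. norm (y - mat 1) < d \<longrightarrow>
      norm (matrix_inv y - matrix_inv (mat 1) - - (y - mat 1)) \<le> e * norm (y - mat 1)"
    proof (intro exI[of _ "min d (e / C)"] conjI allI impI)
      show "0 < min d (e / C)" using d C \<open>e > 0\<close> by simp
      fix y :: "complex^'n^'n" assume y: "norm (y - mat 1) < min d (e / C)"
      then have "C * norm (y - mat 1) \<le> e" using C by (simp add: field_simps)
      then have "C * norm (y - mat 1) * norm (y - mat 1) \<le> e * norm (y - mat 1)"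
        by (intro mult_right_mono) auto
      moreover have "dist y (mat 1) < d" using y by (simp add: dist_norm)
      ultimately show "norm (matrix_inv y - matrix_inv (mat 1) - - (y - mat 1)) \<le> e * norm (y - mat 1)"
        using d(2)[of y] by (simp add: i1)
    qed
  qed
qed

text \<open>Multiplication by \<open>matrix_inv A\<close> moves the limit to the identity, where
  continuity follows from the derivative.\<close>

lemma tendsto_matrix_inv [tendsto_intros]:
  fixes A :: "complex^'n::finite^'n"
  assumes f: "(f \<longlongrightarrow> A) F" and A: "invertible A"
  shows "((\<lambda>x. matrix_inv (f x)) \<longlongrightarrow> matrix_inv A) F"
proof -
  have "isCont (matrix_inv :: complex^'n^'n \<Rightarrow> _) (mat 1)"
    using has_derivative_matrix_inv_1 has_derivative_continuous by blast
  moreover have "((\<lambda>x. f x ** matrix_inv A) \<longlongrightarrow> mat 1) F"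
    using tendsto_matrix_mult[OF f tendsto_const[of "matrix_inv A"]] A by (simp add: matrix_inv_right)
  ultimately have "((\<lambda>x. matrix_inv (f x ** matrix_inv A)) \<longlongrightarrow> matrix_inv (mat 1 :: complex^'n^'n)) F"
    by (rule isCont_tendsto_compose)
  from tendsto_matrix_mult[OF tendsto_const[of "matrix_inv A"] this]
  have "((\<lambda>x. matrix_inv A ** matrix_inv (f x ** matrix_inv A)) \<longlongrightarrow> matrix_inv A) F"
    by (simp add: matrix_inv_unique[of "mat 1" "mat 1"])
  moreover have "\<forall>\<^sub>F x in F. matrix_inv A ** matrix_inv (f x ** matrix_inv A) = matrix_inv (f x)"
  proof -
    have "\<forall>\<^sub>F x in F. invertible (f x)"
      using eventually_invertible_nhds[OF A] f by (simp add: filterlim_iff)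
    then show ?thesis
    proof eventually_elim
      case (elim x)
      have "f x ** (matrix_inv A ** matrix_inv (f x ** matrix_inv A)) = mat 1"
        using matrix_inv_right[of "f x ** matrix_inv A"] A elim
        by (simp add: matrix_mul_assoc invertible_mult invertible_matrix_inv)
      then show ?case by (metis matrix_inv_unique)
    qed
  qed
  ultimately show ?thesis by (rule Lim_transform_eventually)
qed

section \<open>The action on subspaces\<close>

lemma act_mult: "act (A ** B) V = act A (act B V)"
  by (simp add: act_def image_image matrix_vector_mul_assoc)

lemma act_1 [simp]: "act (mat 1) V = V"
  by (simp add: act_def)

lemma act_inv [simp]:
  assumes "invertible A"
  shows "act (matrix_inv A) (act A V) = V" "act A (act (matrix_inv A) V) = V"
  by (simp_all add: act_mult[symmetric] matrix_inv_left matrix_inv_right assms)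

lemma subspace_act: "vec.subspace V \<Longrightarrow> vec.subspace (act A V)"
  unfolding act_def by (rule vec.subspace_image)

lemma inj_matrix_vector_mult: "invertible (A::complex^'n::finite^'n) \<Longrightarrow> inj ((*v) A)"
  by (metis injI matrix_inv_cancel(1))

lemma dim_act:
  assumes "invertible (A::complex^'n::finite^'n)"
  shows "vec.dim (act A V) = vec.dim V"
  unfolding act_def
proof (rule vec.dim_image_eq)
  show "Vector_Spaces.linear (*s) (*s) ((*v) A)" by simp
  show "inj_on ((*v) A) (vec.span V)" using inj_matrix_vector_mult[OF assms] inj_on_subset by blast
qed

lemma act_Gr: "invertible A \<Longrightarrow> V \<in> Gr k \<Longrightarrow> act A V \<in> Gr k"
  by (simp add: Gr_def subspace_act dim_act)

text \<open>Determinants can thus be normalised without changing the action on the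
  Grassmannian.\<close>

lemma act_mat:
  assumes "vec.subspace V" "c \<noteq> 0" shows "act (mat c) V = V"
proof -
  have mv: "mat c *v x = c *s x" for x :: "complex^'n"
    by (simp add: vec_eq_iff matrix_vector_mult_def mat_def if_distrib if_distribR sum.delta cong: if_cong)
  have "x \<in> (\<lambda>v. c *s v) ` V" if "x \<in> V" for x
    using that assms by (intro image_eqI[of _ _ "inverse c *s x"])
      (auto simp: vector_smult_assoc vec.subspace_scale)
  then show ?thesis using assms unfolding act_def by (auto simp: mv vec.subspace_scale)
qed

lemma act_mono_eq:
  assumes "invertible A" "vec.subspace V" "vec.subspace W" "act A V \<subseteq> W" "vec.dim W \<le> vec.dim V"
  shows "act A V = W"
  using assms by (intro vec.subspace_dim_equal) (auto simp: subspace_act dim_act)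

lemma act_cycle_mult: "act_cycle (A ** B) C = act_cycle A (act_cycle B C)"
  by (simp add: act_cycle_def image_image act_mult)

lemma act_cycle_1 [simp]: "act_cycle (mat 1) C = C"
  by (simp add: act_cycle_def)

lemma act_cycle_inv [simp]:
  assumes "invertible A"
  shows "act_cycle (matrix_inv A) (act_cycle A V) = V" "act_cycle A (act_cycle (matrix_inv A) V) = V"
  by (simp_all add: act_cycle_mult[symmetric] matrix_inv_left matrix_inv_right assms)

text \<open>The scalar is a root of \<open>1 / det A\<close> of order n, taken with the principal
  logarithm. It is differentiable at the identity, because the determinant 1 lies off the branch
  cut.\<close>

definition sl_norm :: "complex^'n^'n \<Rightarrow> complex^'n::finite^'n" where
  "sl_norm A = mat (exp (- Ln (det A) / of_nat CARD('n))) ** A"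

lemma det_mat: "det (mat c :: complex^'n::finite^'n) = c ^ CARD('n)"
  by (subst det_diagonal) (simp_all add: mat_def)

lemma sl_norm_SL: assumes "invertible A" shows "sl_norm A \<in> SL"
proof -
  have d: "det A \<noteq> 0" using assms by (simp add: invertible_det_nz)
  have "exp (- Ln (det A) / of_nat CARD('a)) ^ CARD('a) = exp (- Ln (det A))"
    by (subst exp_of_nat_mult[symmetric]) simp
  then show ?thesis using d by (simp add: SL_def sl_norm_def det_mul det_mat exp_minus)
qed

lemma sl_norm_1 [simp]: "sl_norm (mat 1) = mat 1"
  by (simp add: sl_norm_def)

lemma act_sl_norm: "vec.subspace V \<Longrightarrow> act (sl_norm A) V = act A V"
  by (simp add: sl_norm_def act_mult act_mat subspace_act)

lemma act_cycle_sl_norm: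
  assumes "\<forall>V\<in>C. vec.subspace V"
  shows "act_cycle (sl_norm A) C = act_cycle A C"
  using assms by (simp add: act_cycle_def act_sl_norm)

lemma SL_invertible: "A \<in> SL \<Longrightarrow> invertible A"
  by (simp add: SL_def invertible_det_nz)

lemma differentiable_sl_norm_1: "sl_norm differentiable (at (mat 1 :: complex^'n::finite^'n))"
proof -
  have lin: "bounded_linear (mat :: complex \<Rightarrow> complex^'n^'n)"
    by (intro linear_conv_bounded_linear[THEN iffD1] linearI)
       (auto simp: mat_def vec_eq_iff)
  have "(\<lambda>A::complex^'n^'n. exp (- Ln (det A) / of_nat CARD('n))) differentiable (at (mat 1))"
  proof -
    obtain D where D: "(det has_derivative D) (at (mat 1 :: complex^'n^'n))"
      using differentiable_det differentiable_def by blast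
    have "((\<lambda>d. exp (- Ln d / of_nat CARD('n))) has_field_derivative
        (exp (- Ln 1 / of_nat CARD('n)) * (- 1 / of_nat CARD('n)))) (at (det (mat 1 :: complex^'n^'n)))"
      by (auto intro!: derivative_eq_intros)
    from has_derivative_compose[OF D this[unfolded has_field_derivative_def]]
    show ?thesis unfolding differentiable_def by blast
  qed
  then obtain D where D: "((\<lambda>A::complex^'n^'n. exp (- Ln (det A) / of_nat CARD('n))) has_derivative D) (at (mat 1))"
    unfolding differentiable_def by blast
  from bounded_bilinear.FDERIV[OF bounded_bilinear_matrix_mult
      has_derivative_compose[OF this bounded_linear_imp_has_derivative[OF lin]] has_derivative_ident]
  show ?thesis unfolding sl_norm_def[abs_def] differentiable_def by blast
qed

lemma tendsto_sl_norm: "(sl_norm \<longlongrightarrow> mat 1) (nhds (mat 1 :: complex^'n::finite^'n))"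
proof -
  have "isCont sl_norm (mat 1 :: complex^'n::finite^'n)"
    by (rule differentiable_imp_continuous_within[OF differentiable_sl_norm_1])
  then show ?thesis unfolding isCont_def tendsto_at_iff_tendsto_nhds by simp
qed

section \<open>Affine charts\<close>

definition coord_space :: "'n set \<Rightarrow> (complex^'n::finite) set" where
  "coord_space I = {x. \<forall>i. i \<notin> I \<longrightarrow> x $ i = 0}"

lemma subspace_coord_space [simp]: "vec.subspace (coord_space I)"
  by (auto simp: coord_space_def vec.subspace_def)

lemma dim_coord_space [simp]: "vec.dim (coord_space I) = card I"
  unfolding coord_space_def by (rule dim_substandard_cart)

lemma axis_coord_space [simp]: "axis i c \<in> coord_space I \<longleftrightarrow> i \<in> I \<or> c = 0"
  by (auto simp: coord_space_def axis_def)

text \<open>A unipotent matrix that carries \<open>coord_space I\<close> to the graph with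
  coefficients \<open>A\<close>. Products add the coefficients, so moving around inside a chart is
  an action of group elements.\<close>

definition graph_mat :: "'n set \<Rightarrow> complex^('n \<times> 'n) \<Rightarrow> complex^'n^'n::finite" where
  "graph_mat I A = (\<chi> a b. (if a = b then 1 else 0) + (if a \<notin> I \<and> b \<in> I then A $ (a, b) else 0))"

lemma graph_mat_mv:
  "(graph_mat I A *v x) $ a = x $ a + (if a \<notin> I then (\<Sum>b\<in>I. A $ (a, b) * x $ b) else 0)"
proof -
  have "(graph_mat I A *v x) $ a = (\<Sum>b\<in>UNIV. (if a = b then x $ b else 0)) +
      (\<Sum>b\<in>UNIV. if b \<in> I then (if a \<notin> I then A $ (a, b) * x $ b else 0) else 0)"
    unfolding sum.distrib[symmetric] matrix_vector_mult_def graph_mat_def vec_lambda_beta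
    by (rule sum.cong) (auto simp: algebra_simps)
  also have "\<dots> = x $ a + (\<Sum>b\<in>I. (if a \<notin> I then A $ (a, b) * x $ b else 0))"
    by (simp add: sum.inter_restrict[symmetric])
  finally show ?thesis by auto
qed

lemma graph_mat_mult: "graph_mat I A ** graph_mat I B = graph_mat I (A + B)"
proof -
  have "graph_mat I A *v (graph_mat I B *v x) = graph_mat I (A + B) *v x" for x
    unfolding vec_eq_iff by (simp add: graph_mat_mv algebra_simps sum.distrib)
  then show ?thesis by (metis matrix_eq matrix_vector_mul_assoc)
qed

lemma graph_mat_0 [simp]: "graph_mat I 0 = mat 1"
  by (simp add: graph_mat_def mat_def vec_eq_iff)

lemma invertible_graph_mat [simp]: "invertible (graph_mat I A)"
  by (rule invertibleI[of _ "graph_mat I (- A)"]) (simp add: graph_mat_mult)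

lemma gr_graph_eq_act: "gr_graph I A = act (graph_mat I A) (coord_space I)"
proof (intro set_eqI iffI)
  fix x assume x: "x \<in> gr_graph I A"
  let ?w = "\<chi> i. if i \<in> I then x $ i else 0"
  have "x = graph_mat I A *v ?w"
    using x by (auto simp: vec_eq_iff graph_mat_mv gr_graph_def)
  then show "x \<in> act (graph_mat I A) (coord_space I)"
    unfolding act_def coord_space_def by (intro image_eqI[of _ _ ?w]) auto
next
  fix x assume "x \<in> act (graph_mat I A) (coord_space I)"
  then show "x \<in> gr_graph I A"
    by (auto simp: act_def coord_space_def gr_graph_def graph_mat_mv)
qed

lemma gr_graph_Gr: "gr_graph I A \<in> Gr (card I)"
  unfolding gr_graph_eq_act by (intro act_Gr) (auto simp: Gr_def)

lemma gr_graph_translate: "gr_graph I A = act (graph_mat I (A - B)) (gr_graph I B)"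
  by (simp add: gr_graph_eq_act act_mult[symmetric] graph_mat_mult)

lemma gr_coord_graph:
  "gr_coord I (gr_graph I A) = (\<chi> p. if fst p \<notin> I \<and> snd p \<in> I then A $ p else 0)"
  (is "_ = ?N")
  unfolding gr_coord_def
proof (rule the_equality)
  have "gr_graph I ?N = gr_graph I A"
    unfolding gr_graph_def by (intro Collect_cong all_cong sum.cong refl arg_cong2[where f="(=)"]) auto
  then show "(\<forall>j i. j \<in> I \<or> i \<notin> I \<longrightarrow> ?N $ (j, i) = 0) \<and> gr_graph I ?N = gr_graph I A" by auto
next
  fix B assume B: "(\<forall>j i. j \<in> I \<or> i \<notin> I \<longrightarrow> B $ (j, i) = 0) \<and> gr_graph I B = gr_graph I A"
  have "B $ (j, i) = A $ (j, i)" if "j \<notin> I" "i \<in> I" for j i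
  proof -
    let ?x = "graph_mat I B *v axis i 1"
    have "?x \<in> gr_graph I B" using that by (auto simp: gr_graph_eq_act act_def)
    then have "?x \<in> gr_graph I A" using B by simp
    then have "?x $ j = (\<Sum>b\<in>I. A $ (j, b) * ?x $ b)" using that by (auto simp: gr_graph_def)
    moreover have "(\<Sum>b\<in>I. A $ (j, b) * ?x $ b) = (\<Sum>b\<in>I. if b = i then A $ (j, b) else 0)"
      by (rule sum.cong) (auto simp: graph_mat_mv axis_def)
    moreover have "?x $ j = (\<Sum>b\<in>I. if b = i then B $ (j, b) else 0)"
      using that by (auto simp: graph_mat_mv axis_def if_distrib cong: if_cong)
    ultimately show ?thesis using that by simp
  qed
  then show "B = ?N" using B by (auto simp: vec_eq_iff)
qed

text \<open>Take \<open>J\<close> maximal such that \<open>V\<close> meets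
  \<open>coord_space J\<close> only in 0. By maximality, for each \<open>i\<close> outside
  \<open>J\<close> some vector of \<open>V\<close> equals the \<open>i\<close>-th basis vector
  modulo \<open>coord_space J\<close>. These vectors span \<open>V\<close>, and their entries are
  the coefficients of the graph.\<close>

lemma Gr_chart_cover:
  fixes V :: "(complex^'n::finite) set"
  assumes V: "V \<in> Gr k"
  obtains I A where "card I = k" "V = gr_graph I A" 
proof -
  have sub: "vec.subspace V" and dV: "vec.dim V = k" using V by (auto simp: Gr_def)
  let ?P = "\<lambda>J. V \<inter> coord_space J = {0}"
  have "?P {}" using sub vec.subspace_0 by (auto simp: coord_space_def vec_eq_iff)
  then have "\<exists>J. ?P J \<and> (\<forall>J'. ?P J' \<longrightarrow> card J' \<le> card J)"
  proof (rule ex_has_greatest_nat[where f = card and P = ?P and b = "Suc CARD('n)"])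
    show "\<forall>J. ?P J \<longrightarrow> card J < Suc CARD('n)" by (simp add: card_mono less_Suc_eq_le)
  qed
  then obtain J where J: "?P J" and Jmax: "\<And>J'. ?P J' \<Longrightarrow> card J' \<le> card J" by blast
  define I where "I = - J"
  have "\<exists>v\<in>V. v - axis i 1 \<in> coord_space J" if "i \<in> I" for i
  proof -
    have "\<not> ?P (insert i J)" using Jmax[of "insert i J"] that by (auto simp: I_def)
    then obtain v where v: "v \<in> V" "v \<in> coord_space (insert i J)" "v \<noteq> 0"
      using sub vec.subspace_0 by (auto simp: coord_space_def)
    have "v $ i \<noteq> 0"
    proof
      assume "v $ i = 0"
      then have "v \<in> coord_space J" using v(2) by (auto simp: coord_space_def)
      then show False using J v by auto
    qed
    then show ?thesis using v sub
      by (intro bexI[of _ "inverse (v $ i) *s v"])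
         (auto simp: coord_space_def axis_def vec.subspace_scale)
  qed
  then obtain v where v: "\<And>i. i \<in> I \<Longrightarrow> v i \<in> V" "\<And>i. i \<in> I \<Longrightarrow> v i - axis i 1 \<in> coord_space J" by metis
  define A where "A = (\<chi> p. v (snd p) $ fst p)"
  have vi: "v i $ b = (if b = i then 1 else 0)" if "i \<in> I" "b \<in> I" for i b
    using v(2)[OF that(1)] that(2) by (auto simp: coord_space_def I_def axis_def)
  have s: "(\<Sum>i\<in>I. x $ i *s v i) $ b = (if b \<in> I then x $ b else (\<Sum>i\<in>I. A $ (b, i) * x $ i))" for x b
  proof (cases "b \<in> I")
    case True
    then show ?thesis by (simp add: vi mult_delta_right)
  next
    case False then show ?thesis by (simp add: A_def mult.commute)
  qed
  have sV: "(\<Sum>i\<in>I. x $ i *s v i) \<in> V" for x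
    by (intro vec.subspace_sum sub vec.subspace_scale v)
  have VA: "V = gr_graph I A"
  proof (intro set_eqI iffI)
    fix x assume x: "x \<in> V"
    have "x - (\<Sum>i\<in>I. x $ i *s v i) \<in> V" using x sV sub vec.subspace_diff by blast
    moreover have "x - (\<Sum>i\<in>I. x $ i *s v i) \<in> coord_space J"
      using s[of x] by (auto simp: coord_space_def I_def)
    ultimately have "x - (\<Sum>i\<in>I. x $ i *s v i) = 0" using J by blast
    then have xe: "x = (\<Sum>i\<in>I. x $ i *s v i)" by simp
    have "x $ j = (\<Sum>i\<in>I. A $ (j, i) * x $ i)" if "j \<notin> I" for j
      using arg_cong[OF xe, of "\<lambda>y. y $ j"] s[of x j] that by (simp only: if_False)
    then show "x \<in> gr_graph I A" by (auto simp: gr_graph_def)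
  next
    fix x assume x: "x \<in> gr_graph I A"
    have "x = (\<Sum>i\<in>I. x $ i *s v i)"
      unfolding vec_eq_iff s using x by (auto simp: gr_graph_def)
    then show "x \<in> V" using sV by metis
  qed
  moreover have "card I = k" using gr_graph_Gr[of I A] V VA by (auto simp: Gr_def)
  ultimately show ?thesis using that by blast
qed

definition corner :: "'n set \<Rightarrow> complex^'n^'n \<Rightarrow> complex^'n^'n::finite" where
  "corner I M = (\<chi> a b. if a \<in> I \<and> b \<in> I then M $ a $ b else 0)"

text \<open>The block of \<open>M\<close> with rows and columns in \<open>I\<close>, padded by the
  identity: a matrix of full size that is invertible exactly when the block is, so that
  \<open>matrix_inv\<close> applies to it.\<close>

definition corner1 :: "'n set \<Rightarrow> complex^'n^'n \<Rightarrow> complex^'n^'n::finite" where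
  "corner1 I M = corner I M + (\<chi> a b. if a = b \<and> a \<notin> I then 1 else 0)"

lemma linear_corner: "linear (corner I :: complex^'n^'n \<Rightarrow> complex^'n^'n::finite)"
  by (intro linearI) (auto simp: corner_def vec_eq_iff)

lemma corner1_mv:
  assumes "v \<in> coord_space I"
  shows "(corner1 I M *v v) $ a = (if a \<in> I then (M *v v) $ a else 0)"
proof (cases "a \<in> I")
  case True
  then show ?thesis using assms
    unfolding matrix_vector_mult_def corner1_def corner_def coord_space_def
    by (auto intro!: sum.cong)
next
  case False
  then show ?thesis using assms
    by (simp add: matrix_vector_mult_def corner1_def corner_def mult_delta_left coord_space_def)
qed

lemma corner1_mv_notin: "a \<notin> I \<Longrightarrow> (corner1 I M *v v) $ a = v $ a"
  by (simp add: matrix_vector_mult_def corner1_def corner_def mult_delta_left)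

text \<open>Only the columns of \<open>M\<close> in \<open>I\<close> matter. Multiplying on the
  right by the inverse of their corner block turns this block into the identity, and the remaining
  rows are then the coefficients of the graph.\<close>

lemma act_coord_space_graph:
  assumes Q: "invertible (corner1 I M)"
  shows "act M (coord_space I) = gr_graph I (\<chi> p. (M ** matrix_inv (corner1 I M)) $ fst p $ snd p)"
proof -
  let ?Q = "corner1 I M" let ?R = "M ** matrix_inv ?Q"
  have key: "(M *v v) $ j = (\<Sum>b\<in>I. ?R $ j $ b * (M *v v) $ b)" if v: "v \<in> coord_space I" for v j
  proof -
    have "M *v v = ?R *v (?Q *v v)" using Q by (simp add: matrix_vector_mul_assoc[symmetric])
    then have "(M *v v) $ j = (\<Sum>b\<in>UNIV. ?R $ j $ b * (?Q *v v) $ b)"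
      by (simp add: matrix_vector_mult_def)
    also have "\<dots> = (\<Sum>b\<in>UNIV. if b \<in> I then ?R $ j $ b * (M *v v) $ b else 0)"
      by (intro sum.cong) (auto simp: corner1_mv[OF v])
    finally show ?thesis by (simp add: sum.inter_restrict[symmetric])
  qed
  show ?thesis
  proof (intro set_eqI iffI)
    fix x assume "x \<in> act M (coord_space I)"
    then show "x \<in> gr_graph I (\<chi> p. ?R $ fst p $ snd p)"
      using key by (auto simp: act_def gr_graph_def)
  next
    fix x assume x: "x \<in> gr_graph I (\<chi> p. ?R $ fst p $ snd p)"
    define w where "w = (\<chi> i. if i \<in> I then x $ i else 0)"
    define v where "v = matrix_inv ?Q *v w"
    have Qv: "?Q *v v = w" using Q by (simp add: v_def)
    have v: "v \<in> coord_space I"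
      using Qv corner1_mv_notin[of _ I M v] by (auto simp: coord_space_def w_def)
    have i: "(M *v v) $ a = x $ a" if "a \<in> I" for a
      using corner1_mv[OF v, of M a] Qv that by (simp add: w_def)
    have "(M *v v) $ a = x $ a" for a
    proof (cases "a \<in> I")
      case False
      have "(M *v v) $ a = (\<Sum>b\<in>I. ?R $ a $ b * x $ b)" using key[OF v, of a] i by simp
      then show ?thesis using x False by (simp add: gr_graph_def)
    qed (rule i)
    then have "x = M *v v" by (simp add: vec_eq_iff)
    then show "x \<in> act M (coord_space I)" using v by (auto simp: act_def)
  qed
qed

lemma corner1_graph_mat [simp]: "corner1 I (graph_mat I A) = mat 1"
  by (auto simp: corner1_def corner_def graph_mat_def mat_def vec_eq_iff)

definition chart_proj :: "'n set \<Rightarrow> complex^'n^'n \<Rightarrow> complex^('n \<times> 'n::finite)" where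
  "chart_proj I M = (\<chi> p. if fst p \<notin> I \<and> snd p \<in> I then M $ fst p $ snd p else 0)"

lemma linear_chart_proj: "linear (chart_proj I :: complex^'n^'n \<Rightarrow> complex^('n \<times> 'n::finite))"
  by (intro linearI) (auto simp: chart_proj_def vec_eq_iff)

text \<open>Product rule for \<open>M ** matrix_inv (corner1 I M)\<close> with
  \<open>M = y ** graph_mat I A\<close> at \<open>y = 1\<close>, where the corner is the
  identity.\<close>

definition chart_deriv :: "'n set \<Rightarrow> complex^('n \<times> 'n) \<Rightarrow> complex^'n^'n \<Rightarrow> complex^('n \<times> 'n::finite)" where
  "chart_deriv I A H =
    chart_proj I (H ** graph_mat I A - graph_mat I A ** corner I (H ** graph_mat I A))"

lemma eventually_corner1_invertible:
  "\<forall>\<^sub>F y in nhds (mat 1). invertible (corner1 I (y ** graph_mat I (A::complex^('n \<times> 'n::finite))))"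
proof -
  have "((\<lambda>y. corner1 I (y ** graph_mat I A)) \<longlongrightarrow> corner1 I (mat 1 ** graph_mat I A)) (nhds (mat 1 :: complex^'n^'n))"
    unfolding corner1_def
    by (intro tendsto_intros bounded_linear.tendsto[OF linear_conv_bounded_linear[THEN iffD1, OF linear_corner]] filterlim_ident)
  then show ?thesis
    using eventually_compose_filterlim[OF eventually_invertible_nhds[OF invertible_mat_1]] by simp
qed

lemma act_gr_graph:
  assumes "invertible (corner1 I (y ** graph_mat I A))"
  shows "act y (gr_graph I A) =
      gr_graph I (\<chi> p. ((y ** graph_mat I A) ** matrix_inv (corner1 I (y ** graph_mat I A))) $ fst p $ snd p)"
    and "gr_coord I (act y (gr_graph I A)) =
      chart_proj I ((y ** graph_mat I A) ** matrix_inv (corner1 I (y ** graph_mat I A)))"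
proof -
  show "act y (gr_graph I A) =
      gr_graph I (\<chi> p. ((y ** graph_mat I A) ** matrix_inv (corner1 I (y ** graph_mat I A))) $ fst p $ snd p)"
    by (simp only: gr_graph_eq_act[of I A] act_mult[symmetric] act_coord_space_graph[OF assms])
  then show "gr_coord I (act y (gr_graph I A)) =
      chart_proj I ((y ** graph_mat I A) ** matrix_inv (corner1 I (y ** graph_mat I A)))"
    by (simp only: gr_coord_graph chart_proj_def vec_lambda_beta)
qed

lemma eventually_act_chart:
  "\<forall>\<^sub>F y in nhds (mat 1). act y (gr_graph I A) \<in> gr_chart_dom I"
  using eventually_corner1_invertible[of I A]
  by eventually_elim (simp add: act_gr_graph(1) gr_chart_dom_def)

lemma has_derivative_gr_coord_act:
  "((\<lambda>y. gr_coord I (act y (gr_graph I A))) has_derivative chart_deriv I A)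
    (at (mat 1 :: complex^'n::finite^'n))"
proof -
  let ?M = "graph_mat I A"
  have D1: "((\<lambda>y::complex^'n^'n. y ** ?M) has_derivative (\<lambda>H. H ** ?M)) (at (mat 1))"
    by (intro bounded_linear_imp_has_derivative bounded_bilinear.bounded_linear_left[OF bounded_bilinear_matrix_mult])
  have lc: "bounded_linear (corner I :: complex^'n^'n \<Rightarrow> _)"
    using linear_corner linear_conv_bounded_linear by blast
  have lp: "bounded_linear (chart_proj I :: complex^'n^'n \<Rightarrow> _)"
    using linear_chart_proj linear_conv_bounded_linear by blast
  have D2: "((\<lambda>y. corner1 I (y ** ?M)) has_derivative (\<lambda>H. corner I (H ** ?M))) (at (mat 1))"
    unfolding corner1_def using has_derivative_add_const[OF bounded_linear.has_derivative[OF lc D1]] .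
  have "(matrix_inv has_derivative (\<lambda>H. - H)) (at (corner1 I (mat 1 ** ?M)))"
    using has_derivative_matrix_inv_1 by simp
  note D3 = has_derivative_compose[OF D2 this]
  note D4 = bounded_bilinear.FDERIV[OF bounded_bilinear_matrix_mult D1 D3]
  have D5: "((\<lambda>y. chart_proj I ((y ** ?M) ** matrix_inv (corner1 I (y ** ?M)))) has_derivative
      chart_deriv I A) (at (mat 1))"
  proof -
    have i1: "matrix_inv (mat 1 :: complex^'n^'n) = mat 1" by (rule matrix_inv_unique) simp
    have mneg: "X ** (- Y) = - (X ** Y)" for X Y :: "complex^'n^'n"
      by (simp add: matrix_matrix_mult_def vec_eq_iff sum_negf)
    show ?thesis
      using bounded_linear.has_derivative[OF lp D4]
      by (simp add: i1 mneg chart_deriv_def[abs_def])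
  qed
  obtain d where d: "d > 0" "\<And>y. dist y (mat 1) < d \<Longrightarrow> invertible (corner1 I (y ** ?M))"
    using eventually_corner1_invertible[of I A] unfolding eventually_nhds_metric by blast
  show ?thesis
    by (rule has_derivative_transform_within[OF D5 d(1)]) (auto simp: act_gr_graph(2) d(2) dist_commute)
qed

lemma mat_mult_entry [simp]: "(mat c ** H) $ i $ j = c * H $ i $ j"
  by (simp add: matrix_matrix_mult_def mat_def mult_delta_left)

lemma mult_mat_commute: "A ** mat c = mat c ** (A :: complex^'n::finite^'n)"
  by (simp add: vec_eq_iff matrix_matrix_mult_def mat_def mult_delta_left mult_delta_right mult.commute)

text \<open>A Frechet derivative is a priori only real linear; homogeneity under complex scalars
  makes the families below holomorphic in the sense of
  \<open>has_complex_derivative\<close>.\<close>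

lemma chart_deriv_scale:
  fixes H :: "complex^'n::finite^'n"
  shows "chart_deriv I A (mat c ** H) = c *s chart_deriv I A H"
proof -
  let ?M = "graph_mat I A"
  have "corner I (mat c ** X) = mat c ** corner I X" for X :: "complex^'n^'n"
    by (simp add: corner_def vec_eq_iff)
  then have "(mat c ** H) ** ?M - ?M ** corner I ((mat c ** H) ** ?M) =
     mat c ** (H ** ?M - ?M ** corner I (H ** ?M))"
    by (metis (no_types, lifting) matrix_diff_ldistrib matrix_mul_assoc mult_mat_commute)
  moreover have "chart_proj I (mat c ** X) = c *s chart_proj I X" for X :: "complex^'n^'n"
    by (simp add: chart_proj_def vec_eq_iff)
  ultimately show ?thesis by (simp add: chart_deriv_def)
qed

lemma chart_deriv_sum: "chart_deriv I A (\<Sum>i\<in>S. f i) = (\<Sum>i\<in>S. chart_deriv I A (f i))"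
  by (rule linear_sum[OF has_derivative_linear[OF has_derivative_gr_coord_act]])

text \<open>The kernel of the infinitesimal action at a subspace contains only matrices preserving
  that subspace. This reduces the rank of a differential to a stabiliser computation.\<close>

lemma chart_deriv_eq_0:
  assumes "chart_deriv I A H = 0"
  shows "act H (gr_graph I A) \<subseteq> gr_graph I A"
proof
  let ?M = "graph_mat I A" let ?X = "H ** ?M"
  fix u assume "u \<in> act H (gr_graph I A)"
  then obtain w where w: "w \<in> coord_space I" "u = ?X *v w"
    by (auto simp: gr_graph_eq_act act_def matrix_vector_mul_assoc)
  have "u $ j = (\<Sum>b\<in>I. A $ (j, b) * u $ b)" if j: "j \<notin> I" for j
  proof -
    have e: "?X $ j $ i = (?M ** corner I ?X) $ j $ i" if "i \<in> I" for i
      using arg_cong[OF assms, of "\<lambda>v. v $ (j, i)"] j that by (simp add: chart_deriv_def chart_proj_def)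
    have "u $ j = (\<Sum>i\<in>UNIV. ?X $ j $ i * w $ i)" by (simp add: w(2) matrix_vector_mult_def)
    also have "\<dots> = (\<Sum>i\<in>UNIV. (?M ** corner I ?X) $ j $ i * w $ i)"
    proof (rule sum.cong[OF refl])
      fix i show "?X $ j $ i * w $ i = (?M ** corner I ?X) $ j $ i * w $ i"
        using e[of i] w(1) by (cases "i \<in> I") (auto simp: coord_space_def)
    qed
    also have "\<dots> = (?M *v (corner I ?X *v w)) $ j"
      by (simp add: matrix_vector_mul_assoc) (simp add: matrix_vector_mult_def)
    also have "\<dots> = (corner I ?X *v w) $ j + (\<Sum>b\<in>I. A $ (j, b) * (corner I ?X *v w) $ b)"
      using j by (simp add: graph_mat_mv)
    also have "(corner I ?X *v w) $ j = 0"
      using j by (simp add: corner_def matrix_vector_mult_def)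
    also have "(\<Sum>b\<in>I. A $ (j, b) * (corner I ?X *v w) $ b) = (\<Sum>b\<in>I. A $ (j, b) * u $ b)"
    proof (rule sum.cong[OF refl])
      fix b assume "b \<in> I"
      then have "(corner I ?X *v w) $ b = (?X *v w) $ b"
        unfolding corner_def matrix_vector_mult_def vec_lambda_beta
        using w(1) by (intro sum.cong) (auto simp: coord_space_def)
      then show "A $ (j, b) * (corner I ?X *v w) $ b = A $ (j, b) * u $ b" using w by simp
    qed
    finally show ?thesis by simp
  qed
  then show "u \<in> gr_graph I A" by (simp add: gr_graph_def)
qed

section \<open>The topologies in terms of the group action\<close>

lemma eventually_act_openin_gr:
  fixes V :: "(complex^'n::finite) set"
  assumes U: "openin (gr_topology k) U" and V: "V \<in> U"
  shows "\<forall>\<^sub>F y in nhds (mat 1). act y V \<in> U"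
proof -
  have "V \<in> Gr k" using assms by (auto simp: openin_gr_topology)
  then obtain I A where I: "card I = k" "V = gr_graph I A" by (rule Gr_chart_cover)
  define c where "c y = gr_coord I (act y V)" for y
  have "isCont c (mat 1)"
    using has_derivative_continuous[OF has_derivative_gr_coord_act[of I A]] by (simp add: c_def[abs_def] I)
  \<comment> \<open>\<open>gr_coord\<close> sets the entries outside the relevant block to zero and
    \<open>gr_graph\<close> ignores them, so a subspace in the chart is recovered from its
    normalised coordinates.\<close>
  moreover have n: "gr_graph I (gr_coord I (gr_graph I B)) = gr_graph I B" for B
    unfolding gr_coord_graph unfolding gr_graph_def
    by (intro Collect_cong all_cong sum.cong refl arg_cong2[where f="(=)"]) auto
  have "open {A. gr_graph I A \<in> U}" using U I(1) by (simp add: openin_gr_topology)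
  moreover have "c (mat 1) \<in> {A. gr_graph I A \<in> U}" using V by (simp add: c_def I n)
  ultimately have "\<forall>\<^sub>F y in nhds (mat 1). c y \<in> {A. gr_graph I A \<in> U}"
    unfolding isCont_def tendsto_at_iff_tendsto_nhds by (rule topological_tendstoD)
  then show ?thesis using eventually_act_chart[of I A]
  proof eventually_elim
    case (elim y)
    then obtain B where "act y V = gr_graph I B" by (auto simp: gr_chart_dom_def I)
    then show ?case using elim by (simp add: c_def n)
  qed
qed

lemma tendsto_graph_mat_diff:
  "((\<lambda>A. graph_mat I (A - B)) \<longlongrightarrow> mat 1) (nhds (B :: complex^('n \<times> 'n::finite)))"
proof (rule vec_tendstoI, rule vec_tendstoI)
  fix a b
  have "((\<lambda>A. A $ (a, b) - B $ (a, b)) \<longlongrightarrow> B $ (a, b) - B $ (a, b)) (nhds B)"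
    by (intro tendsto_intros filterlim_ident)
  then have "((\<lambda>A. (mat 1 :: complex^'n^'n) $ a $ b + (if a \<notin> I \<and> b \<in> I then A $ (a, b) - B $ (a, b) else 0)) \<longlongrightarrow>
    mat 1 $ a $ b + 0) (nhds B)"
    by (intro tendsto_add tendsto_const) (cases "a \<notin> I \<and> b \<in> I"; simp only: if_True if_False; simp)
  then show "((\<lambda>A. graph_mat I (A - B) $ a $ b) \<longlongrightarrow> mat 1 $ a $ b) (nhds B)"
    by (simp only: graph_mat_def mat_def vec_lambda_beta vector_minus_component add_0_right)
qed

text \<open>One direction is continuity of the orbit map in a chart. For the other, changing the
  coefficients from \<open>B\<close> to \<open>A\<close> is the action of
  \<open>graph_mat I (A - B)\<close>, which tends to the identity as \<open>A\<close> tends to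
  \<open>B\<close>.\<close>

lemma openin_gr_topology_act:
  fixes U :: "(complex^'n::finite) set set"
  shows "openin (gr_topology k) U \<longleftrightarrow> U \<subseteq> Gr k \<and> (\<forall>V\<in>U. \<forall>\<^sub>F y in nhds (mat 1). act y V \<in> U)"
proof (intro iffI conjI ballI)
  assume U: "U \<subseteq> Gr k \<and> (\<forall>V\<in>U. \<forall>\<^sub>F y in nhds (mat 1). act y V \<in> U)"
  have "open {A. gr_graph I A \<in> U}" for I
  proof (subst open_subopen, safe)
    fix B assume "gr_graph I B \<in> U"
    then have "\<forall>\<^sub>F y in nhds (mat 1). act y (gr_graph I B) \<in> U" using U by blast
    then have "\<forall>\<^sub>F A in nhds B. act (graph_mat I (A - B)) (gr_graph I B) \<in> U"
      by (rule eventually_compose_filterlim[OF _ tendsto_graph_mat_diff])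
    then have "\<forall>\<^sub>F A in nhds B. gr_graph I A \<in> U" by (simp add: gr_graph_translate[symmetric])
    then show "\<exists>T. open T \<and> B \<in> T \<and> T \<subseteq> {A. gr_graph I A \<in> U}"
      unfolding eventually_nhds by auto
  qed
  then show "openin (gr_topology k) U" using U by (simp add: openin_gr_topology)
next
  assume U: "openin (gr_topology k) U"
  then show "U \<subseteq> Gr k" by (simp add: openin_gr_topology)
  fix V assume "V \<in> U"
  with U show "\<forall>\<^sub>F y in nhds (mat 1). act y V \<in> U" by (rule eventually_act_openin_gr)
qed

lemma topspace_gr_topology: "topspace (gr_topology k) = (Gr k :: (complex^'n::finite) set set)"
proof
  show "topspace (gr_topology k) \<subseteq> (Gr k :: (complex^'n) set set)"
    using openin_topspace[of "gr_topology k"] unfolding openin_gr_topology by blast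
  have "openin (gr_topology k) (Gr k :: (complex^'n) set set)"
    unfolding openin_gr_topology_act
    using eventually_invertible_nhds[OF invertible_mat_1] by (auto elim!: eventually_mono intro: act_Gr)
  then show "(Gr k :: (complex^'n) set set) \<subseteq> topspace (gr_topology k)" by (rule openin_subset)
qed

section \<open>The topology of the cycle space\<close>

lemma M_Z_invertible:
  assumes "\<forall>V\<in>C0. vec.subspace V"
  shows "M_Z C0 = {act_cycle y C0 | y. invertible y}"
proof
  show "M_Z C0 \<subseteq> {act_cycle y C0 | y. invertible y}"
    unfolding M_Z_def using SL_invertible by auto
  show "{act_cycle y C0 | y. invertible y} \<subseteq> M_Z C0"
  proof
    fix C assume "C \<in> {act_cycle y C0 | y. invertible y}"
    then obtain y where y: "invertible y" "C = act_cycle y C0" by auto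
    have "C = act_cycle (sl_norm y) C0" using act_cycle_sl_norm[OF assms, of y] y(2) by simp
    then show "C \<in> M_Z C0" unfolding M_Z_def using sl_norm_SL[OF y(1)] by auto
  qed
qed

lemma M_Z_act:
  fixes C0 :: "(complex^'n::finite) set set"
  assumes sub: "\<forall>V\<in>C0. vec.subspace V" and C: "C \<in> M_Z C0" and y: "invertible y"
  shows "act_cycle y C \<in> M_Z C0"
proof -
  obtain z where z: "invertible z" "C = act_cycle z C0"
    using C unfolding M_Z_invertible[OF sub] mem_Collect_eq by auto
  have "act_cycle (y ** z) C0 \<in> M_Z C0"
    unfolding M_Z_invertible[OF sub] mem_Collect_eq using invertible_mult[OF y z(1)] by blast
  then show ?thesis by (simp add: z(2) act_cycle_mult)
qed

text \<open>A matrix \<open>y\<close> near the identity acts on cycles as \<open>sl_norm y\<close>,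
  which lies in \<open>SL\<close>; conversely a neighbour \<open>h\<close> of \<open>g\<close> in
  \<open>SL\<close> gives \<open>h ** matrix_inv g\<close> near the identity. So neighbourhoods in
  \<open>SL\<close> and among all matrices induce the same open sets of cycles.\<close>

lemma openin_cycle_topology_act:
  fixes C0 :: "(complex^'n::finite) set set"
  assumes sub: "\<forall>V\<in>C0. vec.subspace V"
  shows "openin (cycle_topology C0) U \<longleftrightarrow>
    U \<subseteq> M_Z C0 \<and> (\<forall>C\<in>U. \<forall>\<^sub>F y in nhds (mat 1). act_cycle y C \<in> U)"
proof (intro iffI conjI ballI)
  assume U: "openin (cycle_topology C0) U"
  then show UM: "U \<subseteq> M_Z C0" by (simp add: openin_cycle_topology)
  fix C assume C: "C \<in> U"
  then obtain g where g: "g \<in> SL" "C = act_cycle g C0" using UM by (auto simp: M_Z_def)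
  from U obtain T where T: "open T" "{g \<in> SL. act_cycle g C0 \<in> U} = T \<inter> SL"
    unfolding openin_cycle_topology openin_open by auto
  have "g \<in> T" using T g C by auto
  have "((\<lambda>y. sl_norm y ** g) \<longlongrightarrow> mat 1 ** g) (nhds (mat 1))"
    by (intro tendsto_intros tendsto_sl_norm)
  then have "\<forall>\<^sub>F y in nhds (mat 1). sl_norm y ** g \<in> T"
    using T(1) \<open>g \<in> T\<close> topological_tendstoD by fastforce
  then show "\<forall>\<^sub>F y in nhds (mat 1). act_cycle y C \<in> U"
    using eventually_invertible_nhds[OF invertible_mat_1]
  proof eventually_elim
    case (elim y)
    have s: "\<forall>V\<in>C. vec.subspace V" using sub by (auto simp: g act_cycle_def subspace_act)
    have "sl_norm y ** g \<in> SL" using sl_norm_SL[OF elim(2)] g(1) by (simp add: SL_def det_mul)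
    then have "act_cycle (sl_norm y ** g) C0 \<in> U" using elim T by blast
    then show ?case by (simp add: act_cycle_mult g(2)[symmetric] act_cycle_sl_norm s)
  qed
next
  assume U: "U \<subseteq> M_Z C0 \<and> (\<forall>C\<in>U. \<forall>\<^sub>F y in nhds (mat 1). act_cycle y C \<in> U)"
  have "\<exists>T. open T \<and> g \<in> T \<and> T \<inter> SL \<subseteq> {g \<in> SL. act_cycle g C0 \<in> U}"
    if g: "g \<in> SL" "act_cycle g C0 \<in> U" for g
  proof -
    have ig: "invertible g" using g SL_invertible by blast
    have "((\<lambda>h. h ** matrix_inv g) \<longlongrightarrow> g ** matrix_inv g) (nhds g)"
      by (intro tendsto_intros filterlim_ident)
    then have lim: "((\<lambda>h. h ** matrix_inv g) \<longlongrightarrow> mat 1) (nhds g)"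
      by (simp add: matrix_inv_right ig)
    have "\<forall>\<^sub>F y in nhds (mat 1). act_cycle y (act_cycle g C0) \<in> U" using U g(2) by blast
    from eventually_compose_filterlim[OF this lim]
    have "\<forall>\<^sub>F h in nhds g. act_cycle (h ** matrix_inv g) (act_cycle g C0) \<in> U" .
    then have "\<forall>\<^sub>F h in nhds g. act_cycle h C0 \<in> U"
      using ig by (simp add: act_cycle_mult[symmetric] matrix_mul_assoc[symmetric] matrix_inv_left)
    then show ?thesis unfolding eventually_nhds by blast
  qed
  then have "\<forall>g\<in>{g \<in> SL. act_cycle g C0 \<in> U}. \<exists>T. openin (top_of_set SL) T \<and> g \<in> T \<and>
      T \<subseteq> {g \<in> SL. act_cycle g C0 \<in> U}"
    by (intro ballI) (metis (no_types, lifting) IntI inf_commute mem_Collect_eq openin_open)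
  then have "openin (top_of_set SL) {g \<in> SL. act_cycle g C0 \<in> U}"
    by (subst openin_subopen) blast
  then show "openin (cycle_topology C0) U" using U by (simp add: openin_cycle_topology)
qed

lemma topspace_cycle_topology:
  fixes C0 :: "(complex^'n::finite) set set"
  assumes sub: "\<forall>V\<in>C0. vec.subspace V"
  shows "topspace (cycle_topology C0) = M_Z C0"
proof
  have "openin (cycle_topology C0) (topspace (cycle_topology C0))" by simp
  then show "topspace (cycle_topology C0) \<subseteq> M_Z C0"
    by (simp only: openin_cycle_topology)
  have "openin (cycle_topology C0) (M_Z C0)"
  proof (rule openin_cycle_topology_act[THEN iffD2])
    show "\<forall>V\<in>C0. vec.subspace V" by (rule sub)
    show "M_Z C0 \<subseteq> M_Z C0 \<and> (\<forall>C\<in>M_Z C0. \<forall>\<^sub>F y in nhds (mat 1). act_cycle y C \<in> M_Z C0)"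
    proof (intro conjI subset_refl ballI)
      fix C assume C: "C \<in> M_Z C0"
      show "\<forall>\<^sub>F y in nhds (mat 1). act_cycle y C \<in> M_Z C0"
        by (rule eventually_mono[OF eventually_invertible_nhds[OF invertible_mat_1]])
          (use M_Z_act[of C0 C] sub C in blast)
    qed
  qed
  then show "M_Z C0 \<subseteq> topspace (cycle_topology C0)" by (rule openin_subset)
qed

section \<open>Holomorphic families of subspaces\<close>

lemma norm_mat_mult: "norm (mat c ** (H::complex^'n::finite^'n)) = cmod c * norm H"
  by (simp add: norm_vec_def L2_set_def power_mult_distrib norm_mult sum_distrib_left[symmetric] real_sqrt_mult)

text \<open>Since \<open>G\<close> is affine, \<open>G (z + h) = (1 + H) ** G z\<close> with
  \<open>H\<close> linear in \<open>h\<close>. The derivative at any \<open>z\<close> is therefore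
  the chart derivative at the identity, taken at the translated subspace.\<close>

lemma has_complex_derivative_act:
  fixes N :: "nat \<Rightarrow> complex^'n::finite^'n"
  assumes V: "act (G z) V = gr_graph I A" and inv: "invertible (G z)"
    and G: "\<And>w. G w = G0 + (\<Sum>i<d. mat (w i) ** N i)"
  shows "has_complex_derivative d (gr_coord I \<circ> (\<lambda>w. act (G w) V))
      (\<lambda>i. chart_deriv I A (N i ** matrix_inv (G z))) z"
  unfolding has_complex_derivative_def
proof (intro allI impI)
  fix e :: real assume e: "e > 0"
  define N' where "N' i = N i ** matrix_inv (G z)" for i
  define f where "f y = gr_coord I (act y (gr_graph I A))" for y
  define K where "K = 1 + (\<Sum>i<d. norm (N' i))"
  have K: "K > 0" unfolding K_def by (intro add_pos_nonneg sum_nonneg) auto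
  have "(f has_derivative chart_deriv I A) (at (mat 1))"
    unfolding f_def[abs_def] by (rule has_derivative_gr_coord_act)
  then obtain \<delta> where \<delta>: "\<delta> > 0"
    "\<And>y. norm (y - mat 1) < \<delta> \<Longrightarrow> norm (f y - f (mat 1) - chart_deriv I A (y - mat 1)) \<le> e / K * norm (y - mat 1)"
    using e K unfolding has_derivative_at_alt by (meson divide_pos_pos)
  show "\<exists>\<delta>>0. \<forall>h\<in>cspace d. (\<Sum>i<d. cmod (h i)) < \<delta> \<longrightarrow>
      norm ((gr_coord I \<circ> (\<lambda>w. act (G w) V)) (\<lambda>i. z i + h i) - (gr_coord I \<circ> (\<lambda>w. act (G w) V)) z -
        (\<Sum>i<d. h i *s chart_deriv I A (N i ** matrix_inv (G z)))) \<le> e * (\<Sum>i<d. cmod (h i))"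
  proof (intro exI[of _ "\<delta> / K"] conjI ballI impI)
    show "\<delta> / K > 0" using \<delta> K by simp
    fix h :: "nat \<Rightarrow> complex" assume h: "(\<Sum>i<d. cmod (h i)) < \<delta> / K"
    define H where "H = (\<Sum>i<d. mat (h i) ** N' i)"
    have nH: "norm H \<le> K * (\<Sum>i<d. cmod (h i))"
    proof -
      have "norm H \<le> (\<Sum>i<d. cmod (h i) * norm (N' i))"
        unfolding H_def by (rule order_trans[OF norm_sum]) (simp add: norm_mat_mult)
      also have "\<dots> \<le> (\<Sum>i<d. cmod (h i) * K)"
      proof (intro sum_mono mult_left_mono)
        fix i assume i: "i \<in> {..<d}"
        have "norm (N' i) \<le> (\<Sum>i<d. norm (N' i))" using i by (intro member_le_sum) auto
        then show "norm (N' i) \<le> K" by (simp add: K_def)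
      qed auto
      finally show ?thesis by (simp add: sum_distrib_left mult.commute)
    qed
    then have "norm H < \<delta>" using h K by (simp add: field_simps)
    have "G (\<lambda>i. z i + h i) = G z + (\<Sum>i<d. mat (h i) ** N i)"
    proof -
      have "mat (z i + h i) ** N i = mat (z i) ** N i + mat (h i) ** N i" for i
        by (simp add: vec_eq_iff algebra_simps)
      then show ?thesis by (simp add: G sum.distrib)
    qed
    also have "\<dots> = (mat 1 + H) ** G z"
    proof -
      have "H ** G z = (\<Sum>i<d. (mat (h i) ** N' i) ** G z)"
        unfolding H_def by (rule bounded_bilinear.sum_left[OF bounded_bilinear_matrix_mult])
      also have "\<dots> = (\<Sum>i<d. mat (h i) ** N i)"
        by (intro sum.cong refl) (simp add: N'_def matrix_mul_assoc[symmetric] matrix_inv_left[OF inv])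
      finally show ?thesis by (simp add: matrix_add_rdistrib)
    qed
    finally have "(gr_coord I \<circ> (\<lambda>w. act (G w) V)) (\<lambda>i. z i + h i) = f (mat 1 + H)"
      by (simp add: f_def act_mult V)
    moreover have "(gr_coord I \<circ> (\<lambda>w. act (G w) V)) z = f (mat 1)" by (simp add: f_def V)
    moreover have "(\<Sum>i<d. h i *s chart_deriv I A (N i ** matrix_inv (G z))) = chart_deriv I A H"
      by (simp add: H_def chart_deriv_sum chart_deriv_scale N'_def)
    ultimately have "norm ((gr_coord I \<circ> (\<lambda>w. act (G w) V)) (\<lambda>i. z i + h i) - (gr_coord I \<circ> (\<lambda>w. act (G w) V)) z -
        (\<Sum>i<d. h i *s chart_deriv I A (N i ** matrix_inv (G z)))) \<le> e / K * norm H"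
      using \<delta>(2)[of "mat 1 + H"] \<open>norm H < \<delta>\<close> by simp
    also have "\<dots> \<le> e / K * (K * (\<Sum>i<d. cmod (h i)))"
      using nH e K by (intro mult_left_mono) auto
    finally show "norm ((gr_coord I \<circ> (\<lambda>w. act (G w) V)) (\<lambda>i. z i + h i) - (gr_coord I \<circ> (\<lambda>w. act (G w) V)) z -
        (\<Sum>i<d. h i *s chart_deriv I A (N i ** matrix_inv (G z)))) \<le> e * (\<Sum>i<d. cmod (h i))"
      using K by simp
  qed
qed

lemma gr_holomorphic_on_act:
  fixes N :: "nat \<Rightarrow> complex^'n::finite^'n"
  assumes V: "V \<in> Gr k" and inv: "\<And>w. w \<in> cspace d \<Longrightarrow> invertible (G w)"
    and G: "\<And>w. G w = G0 + (\<Sum>i<d. mat (w i) ** N i)" and S: "S \<subseteq> cspace d"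
  shows "gr_holomorphic_on k d (\<lambda>w. act (G w) V) S"
  unfolding gr_holomorphic_on_def
proof
  fix z assume "z \<in> S"
  then have z: "z \<in> cspace d" using S by blast
  obtain I A where I: "card I = k" "act (G z) V = gr_graph I A"
    using Gr_chart_cover[OF act_Gr[OF inv[OF z] V]] by blast
  obtain \<delta> where \<delta>: "\<delta> > 0" "\<And>y. dist y (mat 1) < \<delta> \<Longrightarrow> act y (gr_graph I A) \<in> gr_chart_dom I"
    using eventually_act_chart[of I A] unfolding eventually_nhds_metric by blast
  define N' where "N' i = N i ** matrix_inv (G z)" for i
  \<comment> \<open>The summand 1 keeps \<open>K\<close> positive when all \<open>N' i\<close>
    vanish and makes the bound \<open>\<delta> / K * (K - 1)\<close> for \<open>norm H\<close>
    strictly smaller than \<open>\<delta>\<close>.\<close>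
  define K where "K = 1 + (\<Sum>i<d. norm (N' i))"
  have K: "K > 0" unfolding K_def by (intro add_pos_nonneg sum_nonneg) auto
  show "\<exists>I e. card I = k \<and> e > 0 \<and>
      (\<forall>w\<in>cspace d. (\<forall>i<d. cmod (w i - z i) < e) \<longrightarrow>
        act (G w) V \<in> gr_chart_dom I \<and>
        (\<exists>D. has_complex_derivative d (gr_coord I \<circ> (\<lambda>w. act (G w) V)) D w))"
  proof (intro exI[of _ I] exI[of _ "\<delta> / K"] conjI ballI impI I)
    show "\<delta> / K > 0" using \<delta> K by simp
    fix w assume w: "w \<in> cspace d" and close: "\<forall>i<d. cmod (w i - z i) < \<delta> / K"
    define H where "H = (\<Sum>i<d. mat (w i - z i) ** N' i)"
    have "norm H \<le> (\<Sum>i<d. cmod (w i - z i) * norm (N' i))"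
      unfolding H_def by (rule order_trans[OF norm_sum]) (simp add: norm_mat_mult)
    also have "\<dots> \<le> (\<Sum>i<d. \<delta> / K * norm (N' i))"
      using close by (intro sum_mono mult_right_mono) (auto intro: less_imp_le)
    also have "\<dots> = \<delta> / K * (K - 1)" by (simp add: K_def sum_distrib_left)
    also have "\<dots> < \<delta>" using \<delta> K by (simp add: field_simps)
    finally have H: "norm H < \<delta>" .
    have "G w = (mat 1 + H) ** G z"
    proof -
      have "H ** G z = (\<Sum>i<d. (mat (w i - z i) ** N' i) ** G z)"
        unfolding H_def by (rule bounded_bilinear.sum_left[OF bounded_bilinear_matrix_mult])
      also have "\<dots> = (\<Sum>i<d. mat (w i - z i) ** N i)"
        by (intro sum.cong refl) (simp add: N'_def matrix_mul_assoc[symmetric] matrix_inv_left[OF inv[OF z]])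
      also have "\<dots> = (\<Sum>i<d. mat (w i) ** N i) - (\<Sum>i<d. mat (z i) ** N i)"
        unfolding sum_subtractf[symmetric] by (intro sum.cong refl) (simp add: vec_eq_iff algebra_simps)
      finally show ?thesis by (simp add: matrix_add_rdistrib G)
    qed
    then have "act (G w) V = act (mat 1 + H) (gr_graph I A)" by (simp add: act_mult I)
    then show dom: "act (G w) V \<in> gr_chart_dom I" using \<delta>(2)[of "mat 1 + H"] H by (simp add: dist_norm)
    then obtain B where "act (G w) V = gr_graph I B" by (auto simp: gr_chart_dom_def)
    from has_complex_derivative_act[OF this inv[OF w] G]
    show "\<exists>D. has_complex_derivative d (gr_coord I \<circ> (\<lambda>w. act (G w) V)) D w" by blast
  qed
qed

section \<open>Hermitian forms\<close>

definition cip :: "complex^'n::finite \<Rightarrow> complex^'n \<Rightarrow> complex" where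
  "cip x y = (\<Sum>i\<in>UNIV. x $ i * cnj (y $ i))"

definition cadj :: "complex^'n::finite^'n \<Rightarrow> complex^'n^'n" where
  "cadj A = (\<chi> i j. cnj (A $ j $ i))"

lemma cip_add_left: "cip (x + y) z = cip x z + cip y z"
  and cip_add_right: "cip z (x + y) = cip z x + cip z y"
  and cip_diff_left: "cip (x - y) z = cip x z - cip y z"
  and cip_diff_right: "cip z (x - y) = cip z x - cip z y"
  and cip_scale_left: "cip (c *s x) z = c * cip x z"
  and cip_scale_right: "cip z (c *s x) = cnj c * cip z x"
  by (simp_all add: cip_def algebra_simps sum.distrib sum_subtractf sum_distrib_left)

lemma cip_0 [simp]: "cip 0 x = 0" "cip x 0 = 0"
  by (simp_all add: cip_def)

lemma cip_sum_left: "cip (\<Sum>i\<in>S. f i) x = (\<Sum>i\<in>S. cip (f i) x)"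
  by (induction S rule: infinite_finite_induct) (simp_all add: cip_add_left)

lemma cip_sum_right: "cip x (\<Sum>i\<in>S. f i) = (\<Sum>i\<in>S. cip x (f i))"
  by (induction S rule: infinite_finite_induct) (simp_all add: cip_add_right)

lemma cip_commute: "cip y x = cnj (cip x y)"
  by (simp add: cip_def mult.commute)

lemma cip_self: "cip x x = of_real ((norm x)\<^sup>2)"
proof -
  have "(norm x)\<^sup>2 = (\<Sum>i\<in>UNIV. (norm (x $ i))\<^sup>2)"
    by (simp add: norm_vec_def L2_set_def sum_nonneg)
  then show ?thesis by (simp add: cip_def complex_norm_square[symmetric])
qed

lemma cip_adj: "cip (A *v x) y = cip x (cadj A *v y)"
proof -
  have "cip (A *v x) y = (\<Sum>i\<in>UNIV. \<Sum>j\<in>UNIV. A $ i $ j * x $ j * cnj (y $ i))"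
    by (simp add: cip_def matrix_vector_mult_def sum_distrib_right)
  also have "\<dots> = (\<Sum>j\<in>UNIV. \<Sum>i\<in>UNIV. A $ i $ j * x $ j * cnj (y $ i))" by (rule sum.swap)
  also have "\<dots> = cip x (cadj A *v y)"
    by (simp add: cip_def matrix_vector_mult_def cadj_def sum_distrib_left algebra_simps)
  finally show ?thesis .
qed

lemma cadj_cadj [simp]: "cadj (cadj A) = A"
  by (simp add: cadj_def vec_eq_iff)

lemma cadj_mult: "cadj (A ** B) = cadj B ** cadj A"
  by (simp add: cadj_def vec_eq_iff matrix_matrix_mult_def mult.commute)

lemma cadj_mat_1 [simp]: "cadj (mat 1) = mat 1"
  by (simp add: cadj_def vec_eq_iff mat_def)

lemma linear_cadj: "linear cadj"
  by (intro linearI) (simp_all add: cadj_def vec_eq_iff)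

lemma bounded_linear_cadj: "bounded_linear (cadj :: complex^'n::finite^'n \<Rightarrow> _)"
  using linear_cadj linear_conv_bounded_linear by blast

lemmas continuous_on_cadj [continuous_intros] = bounded_linear.continuous_on[OF bounded_linear_cadj]

lemma cip_axis: "cip x (axis i 1) = x $ i"
proof -
  have "cip x (axis i 1) = (\<Sum>j\<in>UNIV. if i = j then x $ j else 0)"
    unfolding cip_def by (rule sum.cong) (auto simp: axis_def)
  then show ?thesis by simp
qed

lemma cip_ext: "(\<And>y. cip x y = cip x' y) \<Longrightarrow> x = x'"
  by (metis cip_axis vec_eq_iff)

lemma matrix_eqI_cip: "(\<And>x y. cip (A *v x) y = cip (B *v x) y) \<Longrightarrow> A = B"
  by (metis cip_ext matrix_eq)

lemma cip_form_commute:
  assumes "cadj A = A" shows "cip (A *v y) x = cnj (cip (A *v x) y)"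
  by (metis assms cip_adj cip_commute)

lemma cip_form_real:
  assumes "cadj A = A" shows "Im (cip (A *v x) x) = 0"
  using cip_form_commute[OF assms, of x x] by (simp add: complex_eq_iff)

lemma continuous_on_cip [continuous_intros]:
  "continuous_on S f \<Longrightarrow> continuous_on S g \<Longrightarrow> continuous_on S (\<lambda>x. cip (f x) (g x))"
  unfolding cip_def by (intro continuous_intros)

section \<open>Complex subspaces, semidefinite forms and simultaneous diagonalisation\<close>

lemma scaleR_eq_scale: "c *\<^sub>R x = complex_of_real c *s (x :: complex^'n::finite)"
  by (simp add: vec_eq_iff scaleR_conv_of_real[where 'a = complex])

lemma vec_subspace_imp_subspace: "vec.subspace S \<Longrightarrow> subspace (S :: (complex^'n::finite) set)"
  unfolding vec.subspace_def subspace_def scaleR_eq_scale by auto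

lemma closed_vec_subspace: "vec.subspace (S :: (complex^'n::finite) set) \<Longrightarrow> closed S"
  by (intro closed_subspace vec_subspace_imp_subspace)

text \<open>A null vector minimises a semidefinite form, so the first variation at it vanishes in
  every direction of \<open>S\<close>.\<close>

lemma semidefinite_null:
  assumes S: "vec.subspace S" and C: "cadj C = C"
    and pos: "\<And>y. y \<in> S \<Longrightarrow> Re (cip (C *v y) y) \<ge> 0"
    and u: "u \<in> S" "cip (C *v u) u = 0" and y: "y \<in> S"
  shows "cip (C *v u) y = 0"
proof (rule ccontr)
  define s where "s = cip (C *v u) y"
  define q where "q = Re (cip (C *v y) y)"
  assume "cip (C *v u) y \<noteq> 0"
  then have s: "s \<noteq> 0" by (simp add: s_def)
  \<comment> \<open>Along \<open>u + t s y\<close> the form takes the value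
    \<open>(cmod s)\<^sup>2 * t * (2 + t * q)\<close>. This \<open>t\<close> is negative but keeps
    the last factor positive, so the value is negative.\<close>
  define t where "t = - 1 / (1 + q)"
  have q: "q \<ge> 0" using pos[OF y] by (simp add: q_def)
  let ?c = "complex_of_real t * s"
  have "0 \<le> Re (cip (C *v (u + ?c *s y)) (u + ?c *s y))"
    using S u y by (intro pos vec.subspace_add vec.subspace_scale)
  also have "cip (C *v (u + ?c *s y)) (u + ?c *s y) =
      cnj ?c * s + ?c * cnj s + ?c * cnj ?c * cip (C *v y) y"
    using u(2) cip_form_commute[OF C, of y u]
    by (simp add: s_def matrix_vector_right_distrib vec.scale cip_add_left cip_add_right
        cip_scale_left cip_scale_right algebra_simps)
  also have "Re \<dots> = 2 * t * (cmod s)\<^sup>2 + t\<^sup>2 * (cmod s)\<^sup>2 * q"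
  proof -
    have "cnj ?c * s + ?c * cnj s + ?c * cnj ?c * cip (C *v y) y =
       of_real (2 * t) * (s * cnj s) + of_real (t\<^sup>2) * (s * cnj s) * cip (C *v y) y"
      by (simp add: algebra_simps power2_eq_square)
    also have "\<dots> = of_real (2 * t * (cmod s)\<^sup>2) + of_real (t\<^sup>2 * (cmod s)\<^sup>2) * cip (C *v y) y"
      by (simp add: complex_norm_square[symmetric])
    finally show ?thesis by (simp add: q_def)
  qed
  also have "\<dots> = (cmod s)\<^sup>2 * t * (2 + t * q)" by (simp add: algebra_simps power2_eq_square)
  finally have "0 \<le> (cmod s)\<^sup>2 * t * (2 + t * q)" .
  moreover have "t < 0" using q by (simp add: t_def)
  moreover have "2 + t * q > 0" using q by (simp add: t_def field_simps)
  ultimately show False using s by (simp add: mult_less_0_iff zero_le_mult_iff not_le)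
qed

text \<open>With \<open>B = 0\<close> this is Gram-Schmidt orthonormalisation.\<close>

lemma simultaneous_diagonalisation:
  fixes A B :: "complex^'n::finite^'n"
  assumes A: "cadj A = A" and B: "cadj B = B"
    and "vec.subspace S" and "\<And>x. x \<in> S \<Longrightarrow> x \<noteq> 0 \<Longrightarrow> Re (cip (A *v x) x) > 0"
    and "finite K" and "card K = vec.dim S"
  shows "\<exists>e. (\<forall>i\<in>K. e i \<in> S) \<and>
    (\<forall>i\<in>K. \<forall>j\<in>K. cip (A *v e i) (e j) = (if i = j then 1 else 0)) \<and>
    (\<forall>i\<in>K. \<forall>j\<in>K. i \<noteq> j \<longrightarrow> cip (B *v e i) (e j) = 0) \<and>
    (\<forall>x\<in>S. x = (\<Sum>i\<in>K. cip (A *v x) (e i) *s e i))"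
  using assms(5,3,4,6)
proof (induction K arbitrary: S rule: finite_induct)
  case empty
  then have "S \<subseteq> {0}" by simp
  then show ?case by auto
next
  case (insert k K)
  note S = insert.prems(1) and pos = insert.prems(2)
  \<comment> \<open>Rayleigh quotient of \<open>B\<close> against \<open>A\<close>. A maximiser on
    the unit sphere of \<open>S\<close>, rescaled, becomes the new basis vector, and the induction
    continues in its \<open>A\<close>-orthogonal complement.\<close>
  define r where "r x = Re (cip (B *v x) x) / Re (cip (A *v x) x)" for x
  have "vec.dim S \<noteq> 0" using insert.prems(3) insert.hyps by (metis card_insert_disjoint nat.distinct(1))
  then have "\<not> S \<subseteq> {0}" by simp
  then obtain x0 where x0: "x0 \<in> S" "x0 \<noteq> 0" by auto
  let ?X = "S \<inter> sphere 0 1"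
  have "compact ?X" using closed_vec_subspace[OF S] by (intro closed_Int_compact) auto
  moreover have "?X \<noteq> {}"
  proof -
    have "(1 / norm x0) *\<^sub>R x0 \<in> ?X"
      using x0 subspace_scale[OF vec_subspace_imp_subspace[OF S]] by simp
    then show ?thesis by blast
  qed
  moreover have "continuous_on ?X r"
    unfolding r_def using pos by (intro continuous_intros) (force simp: )
  ultimately obtain v where v: "v \<in> ?X" "\<And>x. x \<in> ?X \<Longrightarrow> r x \<le> r v"
    using continuous_attains_sup[of ?X r] by blast
  have v0: "v \<in> S" "v \<noteq> 0" using v(1) by auto
  define l where "l = r v"
  have ineq: "Re (cip (B *v x) x) \<le> l * Re (cip (A *v x) x)" if "x \<in> S" for x
  proof (cases "x = 0")
    case False
    let ?y = "(1 / norm x) *\<^sub>R x"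
    have "?y \<in> ?X" using False that subspace_scale[OF vec_subspace_imp_subspace[OF S]] by simp
    then have "r ?y \<le> l" using v(2) by (simp add: l_def)
    moreover have "r ?y = r x"
      using False by (simp add: r_def scaleR_eq_scale vec.scale cip_scale_left cip_scale_right
          flip: of_real_mult)
    moreover have "Re (cip (A *v x) x) > 0" using pos that False by blast
    ultimately have "r x \<le> l" "Re (cip (A *v x) x) > 0" by simp_all
    then show ?thesis by (simp add: r_def field_simps)
  qed simp
  \<comment> \<open>By maximality of \<open>l\<close> this form is positive semidefinite on
    \<open>S\<close>, and it vanishes at \<open>v\<close>. Hence \<open>C *v v\<close> is orthogonal
    to \<open>S\<close>, that is, \<open>v\<close> is an eigenvector of \<open>B\<close> relative to
    \<open>A\<close> on \<open>S\<close>.\<close>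
  define C where "C = mat (of_real l) ** A - B"
  have Cmv: "C *v x = of_real l *s (A *v x) - B *v x" for x
  proof -
    have "mat (of_real l) *v y = of_real l *s y" for y :: "complex^'n"
      by (simp add: vec_eq_iff matrix_vector_mult_def mat_def mult_delta_left)
    then show ?thesis by (simp add: C_def matrix_vector_mult_diff_rdistrib matrix_vector_mul_assoc[symmetric])
  qed
  have C: "cadj C = C"
    using A B unfolding C_def by (simp add: cadj_def vec_eq_iff)
  have Cv: "cip (C *v v) v = 0"
  proof -
    have "Re (cip (A *v v) v) > 0" using pos v0 by blast
    then have "Re (cip (C *v v) v) = 0" by (simp add: Cmv cip_diff_left cip_scale_left l_def r_def)
    then show ?thesis using cip_form_real[OF C, of v] by (simp add: complex_eq_iff)
  qed
  have null: "cip (C *v v) y = 0" if "y \<in> S" for y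
  proof (rule semidefinite_null[OF S C _ v0(1) Cv that])
    fix y assume "y \<in> S"
    then show "Re (cip (C *v y) y) \<ge> 0" using ineq by (simp add: Cmv cip_diff_left cip_scale_left)
  qed
  define a where "a = sqrt (Re (cip (A *v v) v))"
  have a: "a > 0" using pos v0 by (simp add: a_def)
  have Av: "cip (A *v v) v = of_real (a\<^sup>2)"
    using pos[OF v0] cip_form_real[OF A, of v] by (simp add: a_def complex_eq_iff)
  define u where "u = of_real (1 / a) *s v"
  have u: "u \<in> S" using v0 S by (simp add: u_def vec.subspace_scale)
  have Au: "cip (A *v u) u = 1"
    using a Av by (simp add: u_def vec.scale cip_scale_left cip_scale_right power2_eq_square)
  have Bu: "cip (B *v u) y = of_real l * cip (A *v u) y" if "y \<in> S" for y
    using null[OF that] by (simp add: u_def vec.scale cip_scale_left Cmv cip_diff_left)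
  define S' where "S' = {y \<in> S. cip (A *v y) u = 0}"
  have S': "vec.subspace S'"
    using S by (auto simp: S'_def vec.subspace_def matrix_vector_right_distrib vec.scale cip_add_left cip_scale_left)
  have proj: "x - cip (A *v x) u *s u \<in> S'" if "x \<in> S" for x
    using that u S Au by (simp add: S'_def vec.subspace_diff vec.subspace_scale matrix_vector_mult_diff_distrib
        vec.scale cip_diff_left cip_scale_left)
  have "u \<notin> S'" using Au by (simp add: S'_def)
  moreover have "vec.span (insert u S') = S"
  proof
    show "vec.span (insert u S') \<subseteq> S" using u S by (intro vec.span_minimal) (auto simp: S'_def)
    show "S \<subseteq> vec.span (insert u S')"
    proof
      fix x assume "x \<in> S"
      have "(x - cip (A *v x) u *s u) + cip (A *v x) u *s u \<in> vec.span (insert u S')"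
        using proj[OF \<open>x \<in> S\<close>] by (intro vec.span_add vec.span_scale) (auto intro: vec.span_base)
      then show "x \<in> vec.span (insert u S')" by simp
    qed
  qed
  ultimately have "vec.dim S = vec.dim S' + 1"
    using vec.dim_insert[of u S'] S' by (metis vec.dim_span vec.span_eq_iff)
  then have "card K = vec.dim S'" using insert by simp
  moreover have "Re (cip (A *v x) x) > 0" if "x \<in> S'" "x \<noteq> 0" for x
    using pos that by (simp add: S'_def)
  ultimately have "\<exists>e. (\<forall>i\<in>K. e i \<in> S') \<and>
    (\<forall>i\<in>K. \<forall>j\<in>K. cip (A *v e i) (e j) = (if i = j then 1 else 0)) \<and>
    (\<forall>i\<in>K. \<forall>j\<in>K. i \<noteq> j \<longrightarrow> cip (B *v e i) (e j) = 0) \<and>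
    (\<forall>x\<in>S'. x = (\<Sum>i\<in>K. cip (A *v x) (e i) *s e i))"
    by (intro insert.IH[OF S'])
  then obtain e where e: "\<forall>i\<in>K. e i \<in> S'"
    "\<forall>i\<in>K. \<forall>j\<in>K. cip (A *v e i) (e j) = (if i = j then 1 else 0)"
    "\<forall>i\<in>K. \<forall>j\<in>K. i \<noteq> j \<longrightarrow> cip (B *v e i) (e j) = 0"
    "\<forall>x\<in>S'. x = (\<Sum>i\<in>K. cip (A *v x) (e i) *s e i)"
    by (elim exE conjE)
  have eS: "e i \<in> S" "cip (A *v e i) u = 0" if "i \<in> K" for i using bspec[OF e(1) that] by (auto simp: S'_def)
  have ue: "cip (A *v u) (e i) = 0" if "i \<in> K" for i
    using eS(2)[OF that] cip_form_commute[OF A, of u "e i"] by simp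
  have ub: "cip (B *v u) (e i) = 0" "cip (B *v e i) u = 0" if "i \<in> K" for i
    using Bu[OF eS(1)[OF that]] ue[OF that] cip_form_commute[OF B, of "e i" u] by simp_all
  define e' where "e' i = (if i = k then u else e i)" for i
  have e'K: "e' i = e i" if "i \<in> K" for i using that insert.hyps by (auto simp: e'_def)
  have exp: "x = (\<Sum>i\<in>insert k K. cip (A *v x) (e' i) *s e' i)" if x: "x \<in> S" for x
  proof -
    let ?x' = "x - cip (A *v x) u *s u"
    have "?x' = (\<Sum>i\<in>K. cip (A *v ?x') (e i) *s e i)" by (rule bspec[OF e(4) proj[OF x]])
    also have "\<dots> = (\<Sum>i\<in>K. cip (A *v x) (e' i) *s e' i)"
      by (intro sum.cong refl)
        (simp add: e'K matrix_vector_mult_diff_distrib vec.scale cip_diff_left cip_scale_left ue)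
    finally have "x = cip (A *v x) u *s u + (\<Sum>i\<in>K. cip (A *v x) (e' i) *s e' i)"
      by (simp add: algebra_simps)
    then show ?thesis using insert.hyps by (simp add: e'_def)
  qed
  show ?case
  proof (intro exI[of _ e'] conjI ballI impI exp)
    fix i assume i: "i \<in> insert k K"
    show "e' i \<in> S" using i u eS by (auto simp: e'_def)
    fix j assume j: "j \<in> insert k K"
    show "cip (A *v e' i) (e' j) = (if i = j then 1 else 0)"
      using i j insert.hyps e(2) eS ue Au by (auto simp: e'_def)
    assume "i \<noteq> j"
    then show "cip (B *v e' i) (e' j) = 0"
      using i j insert.hyps e(3) ub by (auto simp: e'_def)
  qed
qed

section \<open>Compact subgroups fix a positive definite form\<close>

text \<open>A substitute for averaging over the group. The supremum of the norms along an orbit does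
  not increase under \<open>G\<close>, and strict convexity makes its minimiser on \<open>X\<close>
  unique, hence fixed.\<close>

lemma fixed_point_compact_linear_group:
  fixes X :: "'a::euclidean_space set" and \<alpha> :: "'g::topological_space \<Rightarrow> 'a \<Rightarrow> 'a"
  assumes G: "compact G" "G \<noteq> {}"
    and lin: "\<And>g. g \<in> G \<Longrightarrow> linear (\<alpha> g)" and inj: "\<And>g. g \<in> G \<Longrightarrow> inj (\<alpha> g)"
    and cont: "\<And>x. continuous_on G (\<lambda>g. \<alpha> g x)"
    and bound: "\<And>g x. g \<in> G \<Longrightarrow> norm (\<alpha> g x) \<le> L * norm x"
    and trans: "\<And>g h. g \<in> G \<Longrightarrow> h \<in> G \<Longrightarrow> \<exists>k\<in>G. \<forall>x. \<alpha> g (\<alpha> h x) = \<alpha> k x"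
    and X: "compact X" "convex X" "X \<noteq> {}" "\<And>g. g \<in> G \<Longrightarrow> \<alpha> g ` X \<subseteq> X"
  shows "\<exists>x\<in>X. \<forall>g\<in>G. \<alpha> g x = x"
proof -
  define f where "f x = (SUP g\<in>G. norm (\<alpha> g x))" for x
  have bdd: "bdd_above ((\<lambda>g. norm (\<alpha> g x)) ` G)" for x
    using bound[of _ x] by (auto intro!: bdd_aboveI[of _ "L * norm x"])
  have up: "norm (\<alpha> g x) \<le> f x" if "g \<in> G" for g x
    unfolding f_def by (rule cSUP_upper[OF that bdd])
  have least: "f x \<le> c" if "\<And>g. g \<in> G \<Longrightarrow> norm (\<alpha> g x) \<le> c" for x c
    unfolding f_def by (rule cSUP_least[OF G(2) that])
  have L: "L \<ge> 0"
  proof -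
    obtain b :: 'a where "norm b = 1" using vector_choose_size[of 1] by auto
    moreover obtain g where "g \<in> G" using G by blast
    ultimately show ?thesis using bound[of g b] order_trans[OF norm_ge_zero[of "\<alpha> g b"]] by simp
  qed
  have lip: "f x \<le> f y + L * norm (x - y)" for x y
  proof (rule least)
    fix g assume g: "g \<in> G"
    have "\<alpha> g x = \<alpha> g y + \<alpha> g (x - y)" using lin[OF g] by (simp add: linear_diff)
    then have "norm (\<alpha> g x) \<le> norm (\<alpha> g y) + norm (\<alpha> g (x - y))" by (metis norm_triangle_ineq)
    then show "norm (\<alpha> g x) \<le> f y + L * norm (x - y)" using up[OF g, of y] bound[OF g, of "x - y"] by linarith
  qed
  have "continuous_on X f"
  proof (rule continuous_onI)
    fix x and e :: real assume "e > 0"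
    show "\<exists>d>0. \<forall>x'\<in>X. dist x' x < d \<longrightarrow> dist (f x') (f x) \<le> e"
    proof (intro exI[of _ "e / (L + 1)"] conjI ballI impI)
      show "0 < e / (L + 1)" using \<open>e > 0\<close> L by simp
      fix x' assume "dist x' x < e / (L + 1)"
      then have "(L + 1) * norm (x' - x) < e" using L by (simp add: dist_norm field_simps)
      then have "L * norm (x' - x) \<le> e" by (simp add: algebra_simps) (smt (verit) norm_ge_zero)
      then show "dist (f x') (f x) \<le> e"
        using lip[of x' x] lip[of x x'] by (simp add: dist_real_def norm_minus_commute)
    qed
  qed
  then obtain x where x: "x \<in> X" "\<And>y. y \<in> X \<Longrightarrow> f x \<le> f y"
    using continuous_attains_inf[OF X(1,3)] by blast
  have uniq: "y = x" if y: "y \<in> X" "f y \<le> f x" for y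
  proof (rule ccontr)
    assume "y \<noteq> x"
    let ?m = "(1/2) *\<^sub>R x + (1/2) *\<^sub>R y"
    have m: "?m \<in> X" using X(2) x(1) y(1) by (rule convexD) auto
    obtain g where g: "g \<in> G" "\<And>h. h \<in> G \<Longrightarrow> norm (\<alpha> h ?m) \<le> norm (\<alpha> g ?m)"
      using continuous_attains_sup[OF G continuous_on_norm[OF cont]] by blast
    have "f ?m \<le> norm (\<alpha> g ?m)" using g by (intro least)
    then have le: "f x \<le> norm (\<alpha> g ?m)" using x(2)[OF m] by simp
    let ?a = "\<alpha> g x" let ?b = "\<alpha> g y"
    have am: "\<alpha> g ?m = (1/2) *\<^sub>R ?a + (1/2) *\<^sub>R ?b"
      using lin[OF g(1)] by (simp add: linear_add linear_scale)
    have ab: "?a \<noteq> ?b" using inj[OF g(1)] \<open>y \<noteq> x\<close> by (auto dest: injD)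
    have na: "norm ?a \<le> f x" "norm ?b \<le> f x" using up[OF g(1)] y(2) order_trans by blast+
    \<comment> \<open>Parallelogram law: since the supremum at the midpoint is attained at
      \<open>g\<close>, and \<open>\<alpha> g\<close> is injective, the midpoint of two distinct
      minimisers would have a strictly smaller value.\<close>
    have "(norm (\<alpha> g ?m))\<^sup>2 = ((norm ?a)\<^sup>2 + (norm ?b)\<^sup>2) / 2 - (norm (?a - ?b))\<^sup>2 / 4"
      unfolding am power2_norm_eq_inner by (simp add: inner_add_left inner_add_right inner_diff_left inner_diff_right inner_commute
          field_simps)
    also have "\<dots> < ((f x)\<^sup>2 + (f x)\<^sup>2) / 2"
    proof -
      have "0 < (norm (?a - ?b))\<^sup>2" using ab by simp
      moreover have "(norm ?a)\<^sup>2 \<le> (f x)\<^sup>2" "(norm ?b)\<^sup>2 \<le> (f x)\<^sup>2"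
        using na by (auto intro: power_mono)
      moreover have "a \<le> d \<Longrightarrow> b \<le> d \<Longrightarrow> 0 < c \<Longrightarrow> (a + b) / 2 - c / 4 < (d + d) / 2" for a b c d :: real
        by (simp add: field_simps)
      ultimately show ?thesis by blast
    qed
    finally have "(norm (\<alpha> g ?m))\<^sup>2 < (f x)\<^sup>2" by simp
    moreover have "(f x)\<^sup>2 \<le> (norm (\<alpha> g ?m))\<^sup>2"
      using le na(1) norm_ge_zero[of ?a] by (intro power_mono) linarith+
    ultimately show False by simp
  qed
  show ?thesis
  proof (rule bexI[OF _ x(1)], rule ballI)
    fix g assume g: "g \<in> G"
    show "\<alpha> g x = x"
    proof (rule uniq)
      show "\<alpha> g x \<in> X" using X(4)[OF g] x(1) by blast
      show "f (\<alpha> g x) \<le> f x"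
      proof (rule least)
        fix h assume "h \<in> G"
        then obtain k where "k \<in> G" "\<alpha> h (\<alpha> g x) = \<alpha> k x" using trans g by blast
        then show "norm (\<alpha> h (\<alpha> g x)) \<le> f x" using up by simp
      qed
    qed
  qed
qed

text \<open>The group acts by congruence on the compact convex hull of the forms
  \<open>cadj k ** k\<close>. All members of this hull are positive definite, so a fixed point in it
  is an invariant form.\<close>

lemma compact_subgroup_invariant_form:
  fixes K :: "(complex^'n::finite^'n) set"
  assumes K: "compact_subgroup K G" and inv: "\<And>g. g \<in> G \<Longrightarrow> invertible g"
  obtains H where "cadj H = H" "\<And>x. x \<noteq> 0 \<Longrightarrow> Re (cip (H *v x) x) > 0"
    "\<And>k. k \<in> K \<Longrightarrow> cadj k ** H ** k = H"
proof -
  have Kc: "compact K" and K1: "mat 1 \<in> K" and Km: "\<And>g h. g \<in> K \<Longrightarrow> h \<in> K \<Longrightarrow> g ** h \<in> K"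
    and Ki: "\<And>g. g \<in> K \<Longrightarrow> invertible g"
    using K inv by (auto simp: compact_subgroup_def)
  define \<alpha> where "\<alpha> k H = cadj k ** H ** k" for k H :: "complex^'n^'n"
  define X where "X = convex hull ((\<lambda>k. cadj k ** k) ` K)"
  have lin: "linear (\<alpha> k)" for k
    unfolding \<alpha>_def
    by (intro linearI) (simp_all add: matrix_add_ldistrib matrix_add_rdistrib
      bounded_bilinear.scaleR_right[OF bounded_bilinear_matrix_mult]
      bounded_bilinear.scaleR_left[OF bounded_bilinear_matrix_mult])
  \<comment> \<open>Congruence is a right action, hence the reversed product.\<close>
  have am: "\<alpha> g (\<alpha> h x) = \<alpha> (h ** g) x" for g h x
    by (simp add: \<alpha>_def cadj_mult matrix_mul_assoc)
  obtain B where B: "B > 0" "\<And>(A::complex^'n^'n) (C::complex^'n^'n). norm (A ** C) \<le> norm A * norm C * B"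
    using matrix_mult_norm_bound by blast
  obtain R where R: "\<And>k. k \<in> K \<Longrightarrow> norm k \<le> R" using compact_imp_bounded[OF Kc] by (auto simp: bounded_iff)
  have "compact (cadj ` K)" by (intro compact_continuous_image continuous_intros Kc)
  then obtain R' where R': "\<And>k. k \<in> K \<Longrightarrow> norm (cadj k) \<le> R'"
    using compact_imp_bounded by (fastforce simp: bounded_iff)
  have "R \<ge> 0" "R' \<ge> 0" using R[OF K1] R'[OF K1] norm_ge_zero order_trans by blast+
  have bnd: "norm (\<alpha> k x) \<le> (R' * B * R * B) * norm x" if "k \<in> K" for k x
  proof -
    have "norm (\<alpha> k x) \<le> norm (cadj k ** x) * norm k * B" unfolding \<alpha>_def by (rule B(2))
    also have "\<dots> \<le> (norm (cadj k) * norm x * B) * norm k * B"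
      using B by (intro mult_right_mono) auto
    also have "\<dots> \<le> (R' * norm x * B) * R * B"
      using B R[OF that] R'[OF that] \<open>R \<ge> 0\<close> \<open>R' \<ge> 0\<close> by (intro mult_right_mono mult_mono) auto
    finally show ?thesis by (simp add: algebra_simps)
  qed
  have "\<exists>H\<in>X. \<forall>g\<in>K. \<alpha> g H = H"
  proof (rule fixed_point_compact_linear_group[where G = K and \<alpha> = \<alpha> and X = X and L = "R' * B * R * B"])
    show "compact K" by (rule Kc)
    show "linear (\<alpha> g)" if "g \<in> K" for g by (rule lin)
    show "norm (\<alpha> g x) \<le> R' * B * R * B * norm x" if "g \<in> K" for g x using bnd[OF that] .
    show "inj (\<alpha> g)" if "g \<in> K" for g
    proof (rule inj_on_inverseI[of _ "\<alpha> (matrix_inv g)"])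
      fix x
      have "\<alpha> (matrix_inv g) (\<alpha> g x) = \<alpha> (mat 1) x" using Ki[OF that] by (simp add: am matrix_inv_right)
      then show "\<alpha> (matrix_inv g) (\<alpha> g x) = x" by (simp add: \<alpha>_def)
    qed
    show "continuous_on K (\<lambda>g. \<alpha> g x)" for x unfolding \<alpha>_def by (intro continuous_intros)
    show "\<exists>k\<in>K. \<forall>x. \<alpha> g (\<alpha> h x) = \<alpha> k x" if "g \<in> K" "h \<in> K" for g h
      using am Km[OF that(2,1)] by blast
    show "compact X" unfolding X_def
      by (intro compact_convex_hull compact_continuous_image continuous_intros Kc)
    show "convex X" by (simp add: X_def)
    show "X \<noteq> {}" using K1 by (auto simp: X_def)
    show "\<alpha> g ` X \<subseteq> X" if g: "g \<in> K" for g
    proof -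
      have "\<alpha> g ` (\<lambda>k. cadj k ** k) ` K \<subseteq> (\<lambda>k. cadj k ** k) ` K"
        using Km[OF _ g] by (auto simp: \<alpha>_def cadj_mult matrix_mul_assoc intro!: image_eqI[of _ _ "_ ** g"])
      then show ?thesis unfolding X_def convex_hull_linear_image[OF lin] by (rule hull_mono)
    qed
  qed (use K1 in auto)
  then obtain H where H: "H \<in> X" "\<And>g. g \<in> K \<Longrightarrow> \<alpha> g H = H" by blast
  let ?P = "{H :: complex^'n^'n. cadj H = H \<and> (\<forall>x. x \<noteq> 0 \<longrightarrow> Re (cip (H *v x) x) > 0)}"
  have "X \<subseteq> ?P" unfolding X_def
  proof (rule hull_minimal)
    show "(\<lambda>k. cadj k ** k) ` K \<subseteq> ?P"
    proof safe
      fix k assume k: "k \<in> K"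
      show "cadj (cadj k ** k) = cadj k ** k" by (simp add: cadj_mult)
      fix x :: "complex^'n" assume "x \<noteq> 0"
      then have "k *v x \<noteq> 0" using Ki[OF k] by (metis matrix_inv_cancel(1) matrix_vector_mult_0_right)
      moreover have "cip ((cadj k ** k) *v x) x = cip (k *v x) (k *v x)"
        by (simp add: matrix_vector_mul_assoc[symmetric] cip_adj)
      ultimately show "Re (cip ((cadj k ** k) *v x) x) > 0" by (simp add: cip_self)
    qed
    have "u *\<^sub>R H1 + v *\<^sub>R H2 \<in> ?P"
      if uv: "0 \<le> u" "0 \<le> v" "u + v = 1" and HP: "H1 \<in> ?P" "H2 \<in> ?P" for u v H1 H2
    proof -
      from HP have H1: "cadj H1 = H1" "cadj H2 = H2"
        and p1: "\<forall>x. x \<noteq> 0 \<longrightarrow> 0 < Re (cip (H1 *v x) x)" and p2: "\<forall>x. x \<noteq> 0 \<longrightarrow> 0 < Re (cip (H2 *v x) x)"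
        by simp_all
      have "cadj (u *\<^sub>R H1 + v *\<^sub>R H2) = u *\<^sub>R H1 + v *\<^sub>R H2"
        using H1 by (simp add: linear_add[OF linear_cadj] linear_scale[OF linear_cadj])
      moreover have "0 < Re (cip ((u *\<^sub>R H1 + v *\<^sub>R H2) *v x) x)" if x: "x \<noteq> 0" for x :: "complex^'n"
      proof -
      have "(u *\<^sub>R H1 + v *\<^sub>R H2) *v x = of_real u *s (H1 *v x) + of_real v *s (H2 *v x)"
        by (simp add: matrix_vector_mult_add_rdistrib scaleR_eq_scale[symmetric]
          bounded_bilinear.scaleR_left[OF bounded_bilinear_matrix_vector_mult])
      then have "Re (cip ((u *\<^sub>R H1 + v *\<^sub>R H2) *v x) x) = u * Re (cip (H1 *v x) x) + v * Re (cip (H2 *v x) x)"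
        by (simp add: cip_add_left cip_scale_left)
      moreover have "\<dots> > 0"
      proof (cases "u = 0")
        case True then show ?thesis using uv p2 x by simp
      next
        case False then show ?thesis using uv p1 p2 x by (intro add_pos_nonneg) (auto intro: less_imp_le)
      qed
      ultimately show ?thesis by simp
      qed
      ultimately show ?thesis by blast
    qed
    then show "convex ?P" unfolding convex_def by blast
  qed
  with H that show ?thesis unfolding \<alpha>_def by blast
qed

section \<open>Signatures\<close>

definition eps :: "'p::finite + 'q::finite \<Rightarrow> complex" where
  "eps i = (case i of Inl _ \<Rightarrow> 1 | Inr _ \<Rightarrow> - 1)"

lemma eps_simps [simp]: "eps (Inl a) = 1" "eps (Inr b) = - 1" "eps i * eps i = 1" "eps i * (eps i * x) = x" "cnj (eps i) = eps i"
  by (auto simp: eps_def split: sum.splits)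

lemma E_mat_entry: "E_mat $ i $ j = (if i = j then eps i else 0)"
  by (simp add: E_mat_def eps_def)

lemma E_mat_mv: "(E_mat *v x) $ i = eps i * x $ i"
  by (simp add: E_mat_def matrix_vector_mult_def eps_def mult_delta_left split: sum.splits)

lemma E_mat_E_mat: "E_mat ** E_mat = mat 1"
proof -
  have "E_mat *v (E_mat *v x) = mat 1 *v x" for x by (simp add: vec_eq_iff E_mat_mv)
  then show ?thesis unfolding matrix_eq matrix_vector_mul_assoc by blast
qed

lemma cadj_E_mat: "cadj E_mat = E_mat"
  by (auto simp: cadj_def E_mat_def vec_eq_iff split: sum.splits)

lemma herm_cip: "herm z w = cip (E_mat *v z) w"
  unfolding herm_def cip_def by (simp add: E_mat_mv algebra_simps)

lemma herm_self: "herm z z = (\<Sum>i\<in>UNIV. eps i * of_real ((cmod (z $ i))\<^sup>2))"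
  unfolding herm_cip cip_def E_mat_mv complex_norm_square by (simp add: mult.assoc)

lemma sum_UNIV_sum:
  "(\<Sum>i\<in>(UNIV :: ('a::finite + 'b::finite) set). f i) = (\<Sum>a\<in>UNIV. f (Inl a)) + (\<Sum>b\<in>UNIV. f (Inr b))"
  by (simp add: UNIV_Plus_UNIV[symmetric] sum.Plus del: UNIV_Plus_UNIV)

lemma Re_herm_self: "Re (herm z z) = (\<Sum>a\<in>UNIV. (cmod (z $ Inl a))\<^sup>2) - (\<Sum>b\<in>UNIV. (cmod (z $ Inr b))\<^sup>2)"
  by (simp add: herm_self sum_UNIV_sum sum_negf)

definition pos_on :: "(complex^('p::finite + 'q::finite)) set \<Rightarrow> bool" where
  "pos_on V \<longleftrightarrow> (\<forall>w\<in>V. w \<noteq> 0 \<longrightarrow> Re (herm w w) > 0)"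

definition neg_on :: "(complex^('p::finite + 'q::finite)) set \<Rightarrow> bool" where
  "neg_on V \<longleftrightarrow> (\<forall>w\<in>V. w \<noteq> 0 \<longrightarrow> Re (herm w w) < 0)"

lemma dim_disjoint_le:
  fixes A B V :: "(complex^'n::finite) set"
  assumes "vec.subspace A" "vec.subspace B" "vec.subspace V" "A \<subseteq> V" "B \<subseteq> V" "A \<inter> B \<subseteq> {0}"
  shows "vec.dim A + vec.dim B \<le> vec.dim V"
proof -
  have "vec.dim {x + y |x y. x \<in> A \<and> y \<in> B} + vec.dim (A \<inter> B) = vec.dim A + vec.dim B"
    using vec.dim_sums_Int[OF assms(1,2)] by simp
  moreover have "vec.dim (A \<inter> B) = 0" using assms(6) by simp
  moreover have "vec.dim {x + y |x y. x \<in> A \<and> y \<in> B} \<le> vec.dim V"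
    using assms by (intro vec.dim_subset) (auto intro: vec.subspace_add)
  ultimately show ?thesis by simp
qed

lemma pos_neg_dim_le:
  assumes "vec.subspace A" "vec.subspace B" "vec.subspace V" "A \<subseteq> V" "B \<subseteq> V"
    and "pos_on A" and "\<And>b. b \<in> B \<Longrightarrow> Re (herm b b) \<le> 0"
  shows "vec.dim A + vec.dim B \<le> vec.dim V"
proof (rule dim_disjoint_le[OF assms(1-5)])
  show "A \<inter> B \<subseteq> {0}"
  proof
    fix x assume "x \<in> A \<inter> B"
    then show "x \<in> {0}" using assms(6) assms(7)[of x] by (cases "x = 0") (auto simp: pos_on_def)
  qed
qed

lemma neg_pos_dim_le:
  assumes "vec.subspace A" "vec.subspace B" "vec.subspace V" "A \<subseteq> V" "B \<subseteq> V"
    and "neg_on B" and "\<And>a. a \<in> A \<Longrightarrow> Re (herm a a) \<ge> 0"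
  shows "vec.dim A + vec.dim B \<le> vec.dim V"
proof (rule dim_disjoint_le[OF assms(1-5)])
  show "A \<inter> B \<subseteq> {0}"
  proof
    fix x assume "x \<in> A \<inter> B"
    then show "x \<in> {0}" using assms(6) assms(7)[of x] by (cases "x = 0") (auto simp: neg_on_def)
  qed
qed

lemma herm_sign_alt:
  "herm_sign V =
    (Max {vec.dim W | W. vec.subspace W \<and> W \<subseteq> V \<and> pos_on W},
     Max {vec.dim W | W. vec.subspace W \<and> W \<subseteq> V \<and> neg_on W})"
  by (simp add: herm_sign_def pos_on_def neg_on_def)

lemma finite_dims: "finite {vec.dim W | W :: (complex^'n::finite) set. P W}"
proof (rule finite_subset)
  show "{vec.dim W | W :: (complex^'n) set. P W} \<subseteq> {..CARD('n)}"
    using dim_subset_UNIV_cart_gen by auto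
qed simp

text \<open>A positive subspace of dimension \<open>r\<close> and a negative one of dimension
  \<open>r'\<close> fill up \<open>r + r'\<close>. A larger definite subspace of either sign would
  meet the one of opposite sign, so witnesses replace the two maxima.\<close>

lemma flag_domain_iff:
  "V \<in> flag_domain r r' \<longleftrightarrow> V \<in> Gr (r + r') \<and>
    (\<exists>A B. vec.subspace A \<and> vec.subspace B \<and> A \<subseteq> V \<and> B \<subseteq> V \<and> vec.dim A = r \<and> vec.dim B = r' \<and>
      pos_on A \<and> neg_on B)" (is "_ \<longleftrightarrow> ?R")
proof
  assume V: "V \<in> flag_domain r r'"
  then have sub: "vec.subspace V" by (auto simp: flag_domain_def Gr_def)
  let ?P = "{vec.dim W | W. vec.subspace W \<and> W \<subseteq> V \<and> pos_on W}"
  let ?N = "{vec.dim W | W. vec.subspace W \<and> W \<subseteq> V \<and> neg_on W}"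
  have z: "vec.subspace {0} \<and> {0} \<subseteq> V \<and> pos_on {0} \<and> neg_on {0}"
    using vec.subspace_0[OF sub] by (auto simp: pos_on_def neg_on_def)
  have "Max ?P \<in> ?P" "Max ?N \<in> ?N" using z by (intro Max_in finite_dims; blast)+
  moreover have m: "Max ?P = r" "Max ?N = r'" using V by (auto simp: flag_domain_def herm_sign_alt)
  ultimately have "r \<in> ?P" "r' \<in> ?N" by (simp_all only: m)
  then obtain A B where "vec.subspace A \<and> vec.subspace B \<and> A \<subseteq> V \<and> B \<subseteq> V \<and> vec.dim A = r \<and> vec.dim B = r' \<and>
      pos_on A \<and> neg_on B" by auto
  moreover have "V \<in> Gr (r + r')" using V by (simp add: flag_domain_def)
  ultimately show ?R by blast
next
  assume R: ?R
  then obtain A B where AB: "vec.subspace A" "vec.subspace B" "A \<subseteq> V" "B \<subseteq> V" "vec.dim A = r" "vec.dim B = r'"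
    "pos_on A" "neg_on B" by (elim conjE exE)
  have V: "vec.subspace V" "vec.dim V = r + r'" using R by (auto simp: Gr_def)
  have "Max {vec.dim W | W. vec.subspace W \<and> W \<subseteq> V \<and> pos_on W} = r"
  proof (rule Max_eqI[OF finite_dims])
    fix d assume "d \<in> {vec.dim W | W. vec.subspace W \<and> W \<subseteq> V \<and> pos_on W}"
    then obtain W where W: "d = vec.dim W" "vec.subspace W" "W \<subseteq> V" "pos_on W" by blast
    have "Re (herm b b) \<le> 0" if "b \<in> B" for b
      using AB(8) that by (cases "b = 0") (auto simp: neg_on_def herm_cip less_imp_le)
    then show "d \<le> r" using pos_neg_dim_le[OF W(2) AB(2) V(1) W(3) AB(4) W(4)] AB V W by simp
  qed (use AB in blast)
  moreover have "Max {vec.dim W | W. vec.subspace W \<and> W \<subseteq> V \<and> neg_on W} = r'"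
  proof (rule Max_eqI[OF finite_dims])
    fix d assume "d \<in> {vec.dim W | W. vec.subspace W \<and> W \<subseteq> V \<and> neg_on W}"
    then obtain W where W: "d = vec.dim W" "vec.subspace W" "W \<subseteq> V" "neg_on W" by blast
    have "Re (herm b b) \<ge> 0" if "b \<in> A" for b
      using AB(7) that by (cases "b = 0") (auto simp: pos_on_def herm_cip less_imp_le)
    then show "d \<le> r'" using neg_pos_dim_le[OF AB(1) W(2) V(1) AB(3) W(3,4)] AB V W by simp
  qed (use AB in blast)
  ultimately show "V \<in> flag_domain r r'" using R by (simp add: flag_domain_def herm_sign_alt)
qed

lemma preserves_herm:
  assumes "cadj g ** E_mat ** g = E_mat"
  shows "herm (g *v z) (g *v w) = herm z w"
proof -
  have "herm (g *v z) (g *v w) = cip ((cadj g ** E_mat ** g) *v z) w"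
    by (simp add: herm_cip matrix_vector_mul_assoc[symmetric] cip_adj)
  then show ?thesis by (simp add: assms herm_cip)
qed

lemma invertible_preserves_herm:
  assumes "cadj g ** E_mat ** g = E_mat" shows "invertible g"
proof -
  have "(E_mat ** cadj g ** E_mat) ** g = mat 1"
    using assms by (simp add: matrix_mul_assoc[symmetric] E_mat_E_mat)
  then show ?thesis using invertible_left_inverse by blast
qed

lemma preserves_herm_inv:
  assumes "cadj g ** E_mat ** g = E_mat"
  shows "cadj (matrix_inv g) ** E_mat ** matrix_inv g = E_mat"
proof -
  let ?h = "matrix_inv g"
  have h: "g ** ?h = mat 1" using invertible_preserves_herm[OF assms] by (rule matrix_inv_right)
  then have h': "cadj ?h ** cadj g = mat 1" by (metis cadj_mat_1 cadj_mult)
  have "cadj ?h ** E_mat ** ?h = cadj ?h ** (cadj g ** E_mat ** g) ** ?h" by (simp add: assms)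
  also have "\<dots> = (cadj ?h ** cadj g) ** E_mat ** (g ** ?h)" by (simp add: matrix_mul_assoc)
  finally show ?thesis by (simp add: h h')
qed

lemma preserves_herm_mult:
  assumes "cadj g ** E_mat ** g = E_mat" "cadj h ** E_mat ** h = E_mat"
  shows "cadj (g ** h) ** E_mat ** (g ** h) = E_mat"
proof -
  have "cadj (g ** h) ** E_mat ** (g ** h) = cadj h ** (cadj g ** E_mat ** g) ** h"
    by (simp add: cadj_mult matrix_mul_assoc)
  then show ?thesis by (simp add: assms)
qed

lemma act_flag_domain:
  assumes g: "cadj g ** E_mat ** g = E_mat" and V: "V \<in> flag_domain r r'"
  shows "act g V \<in> flag_domain r r'"
proof -
  note ig = invertible_preserves_herm[OF g]
  obtain A B where AB: "vec.subspace A" "vec.subspace B" "A \<subseteq> V" "B \<subseteq> V" "vec.dim A = r" "vec.dim B = r'"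
    "pos_on A" "neg_on B" using V unfolding flag_domain_iff by blast
  have "pos_on (act g A)" "neg_on (act g B)"
    using AB by (auto simp: pos_on_def neg_on_def act_def preserves_herm[OF g])
  moreover have "act g A \<subseteq> act g V" "act g B \<subseteq> act g V" using AB by (auto simp: act_def)
  moreover have "V \<in> Gr (r + r')" using V by (simp add: flag_domain_def)
  ultimately show ?thesis unfolding flag_domain_iff
    using AB ig by (intro conjI exI[of _ "act g A"] exI[of _ "act g B"]) (simp_all add: act_Gr subspace_act dim_act)
qed

lemma SU_iff: "g \<in> SU \<longleftrightarrow> det g = 1 \<and> cadj g ** E_mat ** g = E_mat"
proof -
  have "cadj g ** E_mat ** g = E_mat" if "\<forall>z w. herm (g *v z) (g *v w) = herm z w"
  proof (rule matrix_eqI_cip)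
    fix x y
    show "cip ((cadj g ** E_mat ** g) *v x) y = cip (E_mat *v x) y"
      using that by (simp add: matrix_vector_mul_assoc[symmetric] cip_adj herm_cip)
  qed
  then show ?thesis unfolding SU_def SL_def by (auto simp: preserves_herm)
qed

section \<open>Maximal compact subgroups\<close>

text \<open>The group S(U(p) x U(p')): unitary matrices preserving \<open>E_mat\<close> commute with
  it and are therefore block diagonal.\<close>

definition UU :: "(complex^('p::finite + 'q::finite)^('p + 'q)) set" where
  "UU = {u. cadj u ** u = mat 1 \<and> cadj u ** E_mat ** u = E_mat \<and> det u = 1}"

lemma UU_D:
  assumes "u \<in> UU"
  shows "cadj u ** u = mat 1" "cadj u ** E_mat ** u = E_mat" "det u = 1" "u ** cadj u = mat 1"
    "E_mat ** u = u ** E_mat" "invertible u" "matrix_inv u = cadj u"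
proof -
  show 1: "cadj u ** u = mat 1" and 2: "cadj u ** E_mat ** u = E_mat" "det u = 1"
    using assms by (auto simp: UU_def)
  show 3: "u ** cadj u = mat 1" using 1 matrix_left_right_inverse by blast
  have "u ** (cadj u ** E_mat ** u) = u ** E_mat" using 2 by simp
  then show "E_mat ** u = u ** E_mat" by (simp add: matrix_mul_assoc 3)
  show "invertible u" "matrix_inv u = cadj u" using 3 by (auto intro: invertibleI matrix_inv_unique)
qed

lemma det_cadj: "det (cadj A) = cnj (det A)"
proof -
  have "cadj A = transpose (\<chi> i j. cnj (A $ i $ j))" by (simp add: cadj_def transpose_def)
  then have "det (cadj A) = det (\<chi> i j. cnj (A $ i $ j))" by simp
  also have "\<dots> = cnj (det A)" by (simp add: det_def)
  finally show ?thesis .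
qed

lemma UU_mult: assumes u: "u \<in> UU" and v: "v \<in> UU" shows "u ** v \<in> UU"
proof -
  have "cadj (u ** v) ** (u ** v) = cadj v ** (cadj u ** u) ** v" by (simp add: cadj_mult matrix_mul_assoc)
  then show ?thesis
    using UU_D[OF u] UU_D[OF v] by (simp add: UU_def preserves_herm_mult det_mul)
qed

lemma UU_cadj: assumes u: "u \<in> UU" shows "cadj u \<in> UU"
proof -
  have "u ** E_mat ** cadj u = E_mat ** (u ** cadj u)" using UU_D(5)[OF u] by (simp add: matrix_mul_assoc)
  then show ?thesis using UU_D[OF u] by (simp add: UU_def det_cadj)
qed

lemma compact_UU: "compact (UU :: (complex^('p::finite + 'q::finite)^('p + 'q)) set)"
proof -
  have "closed (UU :: (complex^('p + 'q)^('p + 'q)) set)"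
    unfolding UU_def by (intro closed_Collect_conj closed_Collect_eq continuous_intros)
  moreover have "bounded (UU :: (complex^('p + 'q)^('p + 'q)) set)"
  proof (rule boundedI)
    fix u :: "complex^('p + 'q)^('p + 'q)" assume u: "u \<in> UU"
    have "(norm u)\<^sup>2 = (\<Sum>i\<in>UNIV. \<Sum>j\<in>UNIV. (cmod (u $ i $ j))\<^sup>2)"
      by (simp add: norm_vec_def L2_set_def sum_nonneg)
    also have "\<dots> = (\<Sum>j\<in>UNIV. \<Sum>i\<in>UNIV. (cmod (u $ i $ j))\<^sup>2)" by (rule sum.swap)
    also have "\<dots> = (\<Sum>j\<in>(UNIV :: ('p + 'q) set). 1)"
    proof (rule sum.cong[OF refl])
      fix j
      have "(cadj u ** u) $ j $ j = of_real (\<Sum>i\<in>UNIV. (cmod (u $ i $ j))\<^sup>2)"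
        unfolding of_real_sum complex_norm_square
        by (simp add: matrix_matrix_mult_def cadj_def mult.commute)
      then have "complex_of_real (\<Sum>i\<in>UNIV. (cmod (u $ i $ j))\<^sup>2) = 1"
        using UU_D(1)[OF u] by (simp add: mat_def)
      then show "(\<Sum>i\<in>UNIV. (cmod (u $ i $ j))\<^sup>2) = 1" using of_real_eq_1_iff by blast
    qed
    finally have "(norm u)\<^sup>2 = real CARD('p + 'q)" by simp
    then show "norm u \<le> sqrt (real CARD('p + 'q))" by (simp add: real_le_rsqrt)
  qed
  ultimately show ?thesis by (simp add: compact_eq_bounded_closed)
qed

section \<open>Frames adapted to the Hermitian form and the conjugacy of maximal compact
  subgroups\<close>

definition colmat :: "('n \<Rightarrow> complex^'n) \<Rightarrow> complex^'n::finite^'n" where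
  "colmat e = (\<chi> a i. e i $ a)"

lemma mv_axis: "((A::complex^'n::finite^'n) *v axis j 1) $ i = A $ i $ j"
proof -
  have "(A *v axis j 1) $ i = (\<Sum>k\<in>UNIV. if k = j then A $ i $ k else 0)"
    unfolding matrix_vector_mult_def vec_lambda_beta by (rule sum.cong) (auto simp: axis_def)
  then show ?thesis by simp
qed

lemma colmat_mv: "colmat e *v x = (\<Sum>i\<in>UNIV. x $ i *s e i)"
  by (simp add: colmat_def matrix_vector_mult_def vec_eq_iff mult.commute)

lemma colmat_axis: "colmat e *v axis i 1 = e i"
  by (simp add: vec_eq_iff mv_axis colmat_def)

lemma colmat_form: "(cadj (colmat e) ** M ** colmat e) $ i $ j = cip (M *v e j) (e i)"
proof -
  have "(cadj (colmat e) ** M ** colmat e) $ i $ j = cip ((cadj (colmat e) ** M ** colmat e) *v axis j 1) (axis i 1)"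
    by (simp only: cip_axis mv_axis)
  then show ?thesis by (simp add: matrix_vector_mul_assoc[symmetric] cip_adj colmat_axis)
qed

lemma in_range_Inr: "x \<in> range Inr \<longleftrightarrow> x \<notin> range Inl"
  by (cases x) auto

lemma card_range_Inl: "card (range (Inl :: 'p::finite \<Rightarrow> 'p + 'q::finite)) = CARD('p)"
  and card_range_Inr: "card (range (Inr :: 'q \<Rightarrow> 'p + 'q)) = CARD('q)"
  by (simp_all add: card_image)

lemma herm_coord_Inl: "x \<in> coord_space (range Inl) \<Longrightarrow> Re (herm x x) \<ge> 0"
  and herm_coord_Inr: "x \<in> coord_space (range Inr) \<Longrightarrow> Re (herm x x) \<le> 0"
  by (simp_all add: Re_herm_self coord_space_def image_iff sum_nonneg)

text \<open>\<open>H\<close> and \<open>E_mat\<close> are diagonalised simultaneously. Sylvester's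
  law of inertia fixes how many diagonal values of \<open>E_mat\<close> have each sign, so a
  permutation and a rescaling of the basis restore \<open>E_mat\<close> while \<open>H\<close> stays
  diagonal.\<close>

lemma adapted_frame:
  fixes H :: "complex^('p::finite + 'q::finite)^('p + 'q)"
  assumes H: "cadj H = H" "\<And>x. x \<noteq> 0 \<Longrightarrow> Re (cip (H *v x) x) > 0"
  obtains T L where "cadj T ** E_mat ** T = E_mat" "\<And>i. L i > (0::real)"
    "\<And>i j. (cadj T ** H ** T) $ i $ j = (if i = j then of_real (L i) else 0)"
proof -
  have "\<exists>e. (\<forall>i\<in>(UNIV :: ('p + 'q) set). e i \<in> UNIV) \<and>
    (\<forall>i\<in>UNIV. \<forall>j\<in>UNIV. cip (H *v e i) (e j) = (if i = j then 1 else 0)) \<and>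
    (\<forall>i\<in>UNIV. \<forall>j\<in>UNIV. i \<noteq> j \<longrightarrow> cip (E_mat *v e i) (e j) = 0) \<and>
    (\<forall>x\<in>UNIV. x = (\<Sum>i\<in>UNIV. cip (H *v x) (e i) *s e i))"
    by (intro simultaneous_diagonalisation H cadj_E_mat) (simp_all add: card_cart_basis)
  then obtain e :: "'p + 'q \<Rightarrow> complex^('p + 'q)" where e:
    "\<forall>i\<in>UNIV. \<forall>j\<in>UNIV. cip (H *v e i) (e j) = (if i = j then 1 else 0)"
    "\<forall>i\<in>UNIV. \<forall>j\<in>UNIV. i \<noteq> j \<longrightarrow> cip (E_mat *v e i) (e j) = 0"
    "\<forall>x\<in>UNIV. x = (\<Sum>i\<in>UNIV. cip (H *v x) (e i) *s e i)"
    by (elim exE conjE)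
  define l where "l i = Re (cip (E_mat *v e i) (e i))" for i
  have le: "cip (E_mat *v e i) (e i) = of_real (l i)" for i
    using cip_form_real[OF cadj_E_mat, of "e i"] by (simp add: l_def complex_eq_iff)
  \<comment> \<open>A basis vector with value zero would be orthogonal, with respect to
    \<open>E_mat\<close>, to the whole basis, although \<open>E_mat\<close> is invertible.\<close>
  have l0: "l i \<noteq> 0" for i
  proof
    assume "l i = 0"
    then have z: "cip (E_mat *v e i) (e j) = 0" for j using e(2) le[of i] by (cases "i = j") auto
    have "cip (E_mat *v e i) y = 0" for y
      using z by (subst bspec[OF e(3), of y]) (simp_all add: cip_sum_right cip_scale_right)
    then have "E_mat *v e i = 0" using cip_ext[of "E_mat *v e i" 0] by simp
    then have "(E_mat ** E_mat) *v e i = 0" by (simp add: matrix_vector_mul_assoc[symmetric])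
    then have "e i = 0" by (simp add: E_mat_E_mat)
    then show False using e(1) by (metis UNIV_I cip_0(2) zero_neq_one)
  qed
  define T0 where "T0 = colmat e"
  have "cadj T0 ** H ** T0 = mat 1" using e(1) by (simp add: T0_def vec_eq_iff colmat_form mat_def)
  then have iT0: "invertible T0" using invertible_left_inverse by blast
  have hT0: "Re (herm (T0 *v y) (T0 *v y)) = (\<Sum>i\<in>UNIV. l i * (cmod (y $ i))\<^sup>2)" for y
  proof -
    have m: "(cadj T0 ** E_mat ** T0) $ i $ j = (if j = i then of_real (l i) else 0)" for i j
      unfolding T0_def colmat_form using e(2) le by auto
    have "herm (T0 *v y) (T0 *v y) = cip ((cadj T0 ** E_mat ** T0) *v y) y"
      by (simp add: herm_cip matrix_vector_mul_assoc[symmetric] cip_adj)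
    also have "(cadj T0 ** E_mat ** T0) *v y = (\<chi> i. of_real (l i) * y $ i)"
      by (simp add: vec_eq_iff matrix_vector_mult_def m mult_delta_left)
    also have "cip \<dots> y = of_real (\<Sum>i\<in>UNIV. l i * (cmod (y $ i))\<^sup>2)"
      unfolding of_real_sum of_real_mult complex_norm_square by (simp add: cip_def mult.assoc)
    finally show ?thesis by simp
  qed
  let ?P = "{i. l i > 0}" let ?N = "{i. l i < 0}"
  have nz: "\<exists>i. i \<in> J \<and> y $ i \<noteq> 0" if "y \<in> coord_space J" "T0 *v y \<noteq> 0" for y J
  proof (rule ccontr)
    assume "\<nexists>i. i \<in> J \<and> y $ i \<noteq> 0"
    then have "y = 0" using that(1) by (auto simp: coord_space_def vec_eq_iff)
    then show False using that(2) by simp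
  qed
  \<comment> \<open>The span of the basis vectors with positive value meets the negative coordinate
    space only in 0, which bounds their number.\<close>
  have P: "card ?P \<le> CARD('p)"
  proof -
    have "pos_on (act T0 (coord_space ?P))"
      unfolding pos_on_def act_def
    proof (clarify)
      fix y assume y: "y \<in> coord_space ?P" "T0 *v y \<noteq> 0"
      obtain i where i: "i \<in> ?P" "y $ i \<noteq> 0" using nz[OF y] by blast
      have "l j * (cmod (y $ j))\<^sup>2 \<ge> 0" for j
        using y(1) by (cases "l j > 0") (auto simp: coord_space_def)
      then show "0 < Re (herm (T0 *v y) (T0 *v y))"
        unfolding hT0 using i by (intro sum_pos2[of _ i]) auto
    qed
    from pos_neg_dim_le[OF _ subspace_coord_space[of "range Inr"] vec.subspace_UNIV _ _ this herm_coord_Inr]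
    have "card ?P + CARD('q) \<le> CARD('p) + CARD('q)"
      by (simp add: subspace_act dim_act[OF iT0] card_range_Inr card_cart_basis)
    then show ?thesis by simp
  qed
  have N: "card ?N \<le> CARD('q)"
  proof -
    have "neg_on (act T0 (coord_space ?N))"
      unfolding neg_on_def act_def
    proof (clarify)
      fix y assume y: "y \<in> coord_space ?N" "T0 *v y \<noteq> 0"
      obtain i where i: "i \<in> ?N" "y $ i \<noteq> 0" using nz[OF y] by blast
      have "- (l j * (cmod (y $ j))\<^sup>2) \<ge> 0" for j
        using y(1) by (cases "l j < 0") (auto simp: coord_space_def mult_le_0_iff)
      then have "0 < (\<Sum>j\<in>UNIV. - (l j * (cmod (y $ j))\<^sup>2))"
        using i by (intro sum_pos2[of _ i]) (auto simp: mult_less_0_iff)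
      then show "Re (herm (T0 *v y) (T0 *v y)) < 0"
        unfolding hT0 by (simp add: sum_negf)
    qed
    from neg_pos_dim_le[OF subspace_coord_space[of "range Inl"] _ vec.subspace_UNIV _ _ this herm_coord_Inl]
    have "CARD('p) + card ?N \<le> CARD('p) + CARD('q)"
      by (simp add: subspace_act dim_act[OF iT0] card_range_Inl card_cart_basis)
    then show ?thesis by simp
  qed
  \<comment> \<open>The two upper bounds add up to the full dimension, so both are
    equalities.\<close>
  have PN: "?P \<union> ?N = UNIV" "?P \<inter> ?N = {}" using l0 by (auto simp: neq_iff)
  then have "card ?P + card ?N = CARD('p) + CARD('q)"
    using card_Un_disjoint[of ?P ?N] by simp
  then have cP: "card ?P = CARD('p)" and cN: "card ?N = CARD('q)" using P N by auto
  obtain f g where f: "bij_betw f (range (Inl :: 'p \<Rightarrow> 'p + 'q)) ?P" and g: "bij_betw g (range (Inr :: 'q \<Rightarrow> 'p + 'q)) ?N"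
    using finite_same_card_bij[of "range (Inl :: 'p \<Rightarrow> 'p + 'q)" ?P] finite_same_card_bij[of "range (Inr :: 'q \<Rightarrow> 'p + 'q)" ?N]
    by (auto simp: card_range_Inl card_range_Inr cP cN)
  define h where "h i = (case i of Inl a \<Rightarrow> f i | Inr b \<Rightarrow> g i)" for i :: "'p + 'q"
  have hP: "l (h (Inl a)) > 0" and hN: "l (h (Inr b)) < 0" for a b
    using f g by (auto simp: h_def bij_betw_def)
  have hinj: "h i = h j \<longleftrightarrow> i = j" for i j
  proof
    assume eq: "h i = h j"
    show "i = j"
    proof (cases i; cases j)
      fix a b assume "i = Inl a" "j = Inl b"
      then show ?thesis using eq f by (auto simp: h_def bij_betw_def dest: inj_onD)
    next
      fix a b assume "i = Inr a" "j = Inr b"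
      then show ?thesis using eq g by (auto simp: h_def bij_betw_def dest: inj_onD)
    next
      fix a b assume "i = Inl a" "j = Inr b"
      then show ?thesis using eq hP[of a] hN[of b] by simp
    next
      fix a b assume "i = Inr a" "j = Inl b"
      then show ?thesis using eq hP[of b] hN[of a] by simp
    qed
  qed simp
  define s where "s i = 1 / sqrt \<bar>l (h i)\<bar>" for i
  have s: "s i > 0" for i using l0 by (simp add: s_def)
  have s2: "s i * s i = 1 / \<bar>l (h i)\<bar>" for i by (simp add: s_def)
  define T where "T = colmat (\<lambda>i. of_real (s i) *s e (h i))"
  have "(cadj T ** E_mat ** T) $ i $ j = E_mat $ i $ j" for i j
  proof (cases "i = j")
    case True
    have "(cadj T ** E_mat ** T) $ i $ i = of_real (s i * s i * l (h i))"
      unfolding T_def colmat_form by (simp add: vec.scale cip_scale_left cip_scale_right le)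
    also have "s i * s i * l (h i) = (case i of Inl _ \<Rightarrow> 1 | Inr _ \<Rightarrow> - 1)"
      unfolding s2
    proof (cases i)
      case (Inl a)
      then show "1 / \<bar>l (h i)\<bar> * l (h i) = (case i of Inl _ \<Rightarrow> 1 | Inr _ \<Rightarrow> - 1)" using hP[of a] by simp
    next
      case (Inr b)
      then show "1 / \<bar>l (h i)\<bar> * l (h i) = (case i of Inl _ \<Rightarrow> 1 | Inr _ \<Rightarrow> - 1)" using hN[of b] by simp
    qed
    finally show ?thesis using True by (auto simp: E_mat_def split: sum.splits)
  next
    case False
    then show ?thesis using e(2) hinj
      unfolding T_def colmat_form by (simp add: vec.scale cip_scale_left cip_scale_right E_mat_def)
  qed
  then have "cadj T ** E_mat ** T = E_mat" by (simp add: vec_eq_iff)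
  moreover have "(cadj T ** H ** T) $ i $ j = (if i = j then of_real (s i * s i) else 0)" for i j
    unfolding T_def colmat_form using e(1) hinj by (simp add: vec.scale cip_scale_left cip_scale_right)
  ultimately show ?thesis using that[of T "\<lambda>i. s i * s i"] s by simp
qed

text \<open>Since \<open>cadj u\<close> is inverse to \<open>E_mat ** u ** E_mat\<close>, invariance
  of \<open>M\<close> reads \<open>M ** u = E_mat ** u ** E_mat ** M\<close>. An entry of
  \<open>u\<close> linking the two blocks is then annihilated by the positive number
  \<open>L i + L j\<close>. So \<open>u\<close> commutes with \<open>E_mat\<close>, and preserving
  \<open>E_mat\<close> makes it unitary.\<close>

lemma UU_of_invariant_form:
  assumes u: "cadj u ** E_mat ** u = E_mat" "det u = 1"
    and L: "\<And>i. L i > (0::real)" "\<And>i j. M $ i $ j = (if i = j then of_real (L i) else 0)"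
    and M: "cadj u ** M ** u = M"
  shows "u \<in> UU"
proof -
  have "(cadj u) ** (E_mat ** u ** E_mat) = mat 1"
    using u(1) by (simp add: matrix_mul_assoc E_mat_E_mat)
  then have r: "(E_mat ** u ** E_mat) ** cadj u = mat 1" using matrix_left_right_inverse by blast
  have "M ** u = (E_mat ** u ** E_mat) ** cadj u ** M ** u" by (simp add: r)
  also have "\<dots> = (E_mat ** u ** E_mat) ** M" using M by (simp add: matrix_mul_assoc[symmetric])
  finally have eq: "M ** u = E_mat ** u ** E_mat ** M" .
  have ent: "(X ** M) $ i $ j = X $ i $ j * of_real (L j)" "(M ** X) $ i $ j = of_real (L i) * X $ i $ j" for X i j
    by (simp_all add: matrix_matrix_mult_def L(2) mult_delta_left mult_delta_right)
  have entE: "(X ** E_mat) $ i $ j = X $ i $ j * eps j" "(E_mat ** X) $ i $ j = eps i * X $ i $ j" for X i j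
    by (simp_all add: matrix_matrix_mult_def E_mat_def mult_delta_left mult_delta_right eps_def split: sum.splits)
  have "(E_mat ** u) $ i $ j = (u ** E_mat) $ i $ j" for i j
  proof (cases "eps i = eps j")
    case False
    then have "eps i * eps j = - 1" by (cases i; cases j) auto
    have "of_real (L i) * u $ i $ j = eps i * u $ i $ j * eps j * of_real (L j)"
      using arg_cong[OF eq, of "\<lambda>X. X $ i $ j"] by (simp only: ent entE)
    also have "\<dots> = (eps i * eps j) * (u $ i $ j * of_real (L j))" by (simp only: ac_simps)
    finally have "of_real (L i) * u $ i $ j = - (u $ i $ j * of_real (L j))"
      by (simp only: \<open>eps i * eps j = - 1\<close> mult_minus1)
    then have "of_real (L i + L j) * u $ i $ j = 0" by (simp add: algebra_simps)
    moreover have "L i + L j \<noteq> 0" using L(1)[of i] L(1)[of j] by linarith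
    ultimately have "u $ i $ j = 0" using mult_eq_0_iff of_real_eq_0_iff by blast
    then show ?thesis by (simp add: entE)
  qed (simp add: entE mult.commute)
  then have comm: "E_mat ** u = u ** E_mat" by (simp add: vec_eq_iff)
  have "cadj u ** u = cadj u ** E_mat ** u ** E_mat"
    using comm by (simp add: matrix_mul_assoc[symmetric] E_mat_E_mat)
  then have "cadj u ** u = mat 1" by (simp add: u(1) E_mat_E_mat)
  then show ?thesis using u by (simp add: UU_def)
qed

text \<open>In a frame that preserves \<open>E_mat\<close> and diagonalises an invariant positive
  form, \<open>K0\<close> becomes a subgroup of \<open>UU\<close>. The conjugate of
  \<open>UU\<close> is itself compact in \<open>SU\<close>, so maximality gives equality.\<close>

lemma maximal_compact_subgroup_SU:
  fixes K0 :: "(complex^('p::finite + 'q::finite)^('p + 'q)) set"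
  assumes K0: "maximal_compact_subgroup K0 SU"
  obtains T where "cadj T ** E_mat ** T = E_mat" "K0 = (\<lambda>u. T ** u ** matrix_inv T) ` UU"
proof -
  have cK: "compact_subgroup K0 SU" using K0 by (simp add: maximal_compact_subgroup_def)
  have KSU: "K0 \<subseteq> SU" using cK by (simp add: compact_subgroup_def)
  obtain H where H: "cadj H = H" "\<And>x. x \<noteq> 0 \<Longrightarrow> Re (cip (H *v x) x) > 0"
    "\<And>k. k \<in> K0 \<Longrightarrow> cadj k ** H ** k = H"
    using compact_subgroup_invariant_form[OF cK] invertible_preserves_herm SU_iff by metis
  obtain T L where T: "cadj T ** E_mat ** T = E_mat" and L: "\<And>i. L i > (0::real)"
    "\<And>i j. (cadj T ** H ** T) $ i $ j = (if i = j then of_real (L i) else 0)"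
    using adapted_frame[OF H(1,2)] by metis
  note iT = invertible_preserves_herm[OF T]
  let ?S = "matrix_inv T"
  have TS: "T ** ?S = mat 1" "?S ** T = mat 1" using iT by (simp_all add: matrix_inv_right matrix_inv_left)
  have TS': "cadj ?S ** cadj T = mat 1" by (metis TS(1) cadj_mat_1 cadj_mult)
  let ?K1 = "(\<lambda>u. T ** u ** ?S) ` UU"
  have sub: "K0 \<subseteq> ?K1"
  proof
    fix k assume k: "k \<in> K0"
    define u where "u = ?S ** k ** T"
    have k': "det k = 1" "cadj k ** E_mat ** k = E_mat" using k KSU SU_iff by blast+
    have "u \<in> UU"
    proof (rule UU_of_invariant_form[OF _ _ L])
      show "cadj u ** E_mat ** u = E_mat"
        unfolding u_def using T k'(2) preserves_herm_inv[OF T] by (intro preserves_herm_mult)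
      have "det ?S * det T = 1" using TS(2) by (metis det_I det_mul)
      then show "det u = 1" using k'(1) by (simp add: u_def det_mul)
      have "cadj u ** (cadj T ** H ** T) ** u = cadj T ** cadj k ** (cadj ?S ** cadj T) ** H ** (T ** ?S) ** k ** T"
        by (simp add: u_def cadj_mult matrix_mul_assoc)
      also have "\<dots> = cadj T ** (cadj k ** H ** k) ** T" by (simp add: TS TS' matrix_mul_assoc)
      finally show "cadj u ** (cadj T ** H ** T) ** u = cadj T ** H ** T" by (simp add: H(3)[OF k])
    qed
    moreover have "k = T ** u ** ?S"
    proof -
      have "T ** u ** ?S = (T ** ?S) ** k ** (T ** ?S)" by (simp add: u_def matrix_mul_assoc)
      then show ?thesis by (simp add: TS)
    qed
    ultimately show "k \<in> ?K1" by blast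
  qed
  have "compact_subgroup ?K1 SU"
    unfolding compact_subgroup_def
  proof (intro conjI ballI)
    show "?K1 \<subseteq> SU"
    proof
      fix k assume "k \<in> ?K1"
      then obtain u where u: "u \<in> UU" "k = T ** u ** ?S" by blast
      have "det T * det ?S = 1" using TS(1) by (metis det_I det_mul)
      then have "det k = 1" using UU_D(3)[OF u(1)] by (simp add: u(2) det_mul)
      moreover have "cadj k ** E_mat ** k = E_mat"
        unfolding u(2) using T UU_D(2)[OF u(1)] preserves_herm_inv[OF T] by (intro preserves_herm_mult)
      ultimately show "k \<in> SU" by (simp add: SU_iff)
    qed
    show "compact ?K1" by (intro compact_continuous_image compact_UU continuous_intros)
    have "(mat 1 :: complex^('p + 'q)^('p + 'q)) \<in> UU" by (simp add: UU_def)
    then show "mat 1 \<in> ?K1" using TS by (intro image_eqI[of _ _ "mat 1"]) simp_all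
    fix g assume "g \<in> ?K1"
    then obtain u where u: "u \<in> UU" "g = T ** u ** ?S" by blast
    show "matrix_inv g \<in> ?K1"
    proof (rule image_eqI[OF _ UU_cadj[OF u(1)]], rule matrix_inv_unique)
      have "g ** (T ** cadj u ** ?S) = T ** u ** (?S ** T) ** cadj u ** ?S" by (simp add: u(2) matrix_mul_assoc)
      also have "\<dots> = T ** (u ** cadj u) ** ?S" by (simp add: TS matrix_mul_assoc)
      finally show "g ** (T ** cadj u ** ?S) = mat 1" by (simp add: UU_D(4)[OF u(1)] TS)
    qed
    fix h assume "h \<in> ?K1"
    then obtain v where v: "v \<in> UU" "h = T ** v ** ?S" by blast
    have "g ** h = T ** u ** (?S ** T) ** v ** ?S" by (simp add: u(2) v(2) matrix_mul_assoc)
    also have "\<dots> = T ** (u ** v) ** ?S" by (simp add: TS matrix_mul_assoc)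
    finally show "g ** h \<in> ?K1" using UU_mult[OF u(1) v(1)] by blast
  qed
  then have "K0 = ?K1" using K0 sub by (auto simp: maximal_compact_subgroup_def)
  with T that show ?thesis by blast
qed

section \<open>Split subspaces\<close>

definition prp :: "complex^('p::finite + 'q::finite)^('p + 'q)" where
  "prp = (\<chi> i j. if i = j \<and> i \<in> range Inl then 1 else 0)"

lemma prp_mv: "(prp *v x) $ i = (if i \<in> range Inl then x $ i else 0)"
proof -
  have "(prp *v x) $ i = (\<Sum>j\<in>UNIV. if i = j then (if i \<in> range Inl then x $ j else 0) else 0)"
    unfolding prp_def matrix_vector_mult_def vec_lambda_beta by (rule sum.cong) auto
  then show ?thesis by simp
qed

definition split_space :: "(complex^('p::finite + 'q::finite)) set \<Rightarrow> bool" where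
  "split_space V \<longleftrightarrow> vec.subspace V \<and> (\<forall>v\<in>V. prp *v v \<in> V)"

lemma orth_complement:
  fixes S A :: "(complex^'n::finite) set"
  assumes S: "vec.subspace S" and A: "vec.subspace A" "A \<subseteq> S"
  shows "vec.subspace {x \<in> S. \<forall>a\<in>A. cip x a = 0}" "vec.dim {x \<in> S. \<forall>a\<in>A. cip x a = 0} = vec.dim S - vec.dim A"
proof -
  let ?A' = "{x \<in> S. \<forall>a\<in>A. cip x a = 0}"
  show A': "vec.subspace ?A'" using S by (auto simp: vec.subspace_def cip_add_left cip_scale_left)
  obtain e :: "nat \<Rightarrow> complex^'n" where e: "\<forall>i\<in>{..<vec.dim A}. e i \<in> A"
    "\<forall>i\<in>{..<vec.dim A}. \<forall>j\<in>{..<vec.dim A}. cip (mat 1 *v e i) (e j) = (if i = j then 1 else 0)"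
    "\<forall>x\<in>A. x = (\<Sum>i\<in>{..<vec.dim A}. cip (mat 1 *v x) (e i) *s e i)"
    using simultaneous_diagonalisation[of "mat 1" "mat 1" A "{..<vec.dim A}"] A
    by (auto simp: cip_self)
  have s: "{x + y |x y. x \<in> A \<and> y \<in> ?A'} = S"
  proof (intro set_eqI iffI)
    fix x assume x: "x \<in> S"
    define a where "a = (\<Sum>i\<in>{..<vec.dim A}. cip x (e i) *s e i)"
    have a: "a \<in> A" unfolding a_def using e(1) A by (intro vec.subspace_sum vec.subspace_scale) auto
    have "cip a (e j) = cip x (e j)" if "j < vec.dim A" for j
    proof -
      have "cip a (e j) = (\<Sum>i\<in>{..<vec.dim A}. if i = j then cip x (e i) else 0)"
        unfolding a_def cip_sum_left using e(2) that by (intro sum.cong) (auto simp: cip_scale_left)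
      then show ?thesis using that by simp
    qed
    then have "cip (x - a) (e j) = 0" if "j < vec.dim A" for j using that by (simp add: cip_diff_left)
    then have "cip (x - a) b = 0" if "b \<in> A" for b
      by (subst bspec[OF e(3) that]) (simp add: cip_sum_right cip_scale_right)
    moreover have "x - a \<in> S" using x a A S by (auto intro: vec.subspace_diff)
    ultimately have "x - a \<in> ?A'" by blast
    moreover have "x = a + (x - a)" by simp
    ultimately show "x \<in> {x + y |x y. x \<in> A \<and> y \<in> ?A'}" using a by blast
  qed (use S A in \<open>auto intro: vec.subspace_add\<close>)
  have "A \<inter> ?A' \<subseteq> {0}" by (auto simp: cip_self)
  then have z: "vec.dim (A \<inter> ?A') = 0" by simp
  have "vec.dim S = vec.dim A + vec.dim ?A'"
    using vec.dim_sums_Int[OF A(1) A'] unfolding s z by simp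
  then show "vec.dim ?A' = vec.dim S - vec.dim A" by simp
qed

lemma orthonormal_basis:
  fixes A :: "(complex^'n::finite) set" and K :: "'k set"
  assumes "vec.subspace A" "finite K" "card K = vec.dim A"
  obtains e where "\<And>i. i \<in> K \<Longrightarrow> e i \<in> A" "\<And>i j. i \<in> K \<Longrightarrow> j \<in> K \<Longrightarrow> cip (e i) (e j) = (if i = j then 1 else 0)"
proof -
  have "\<exists>e. (\<forall>i\<in>K. e i \<in> A) \<and> (\<forall>i\<in>K. \<forall>j\<in>K. cip (mat 1 *v e i) (e j) = (if i = j then 1 else 0)) \<and>
    (\<forall>i\<in>K. \<forall>j\<in>K. i \<noteq> j \<longrightarrow> cip (mat 1 *v e i) (e j) = 0) \<and>
    (\<forall>x\<in>A. x = (\<Sum>i\<in>K. cip (mat 1 *v x) (e i) *s e i))"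
    using assms by (intro simultaneous_diagonalisation) (auto simp: cip_self)
  then obtain e where "\<forall>i\<in>K. e i \<in> A" "\<forall>i\<in>K. \<forall>j\<in>K. cip (e i) (e j) = (if i = j then 1 else 0)"
    unfolding matrix_vector_mul_lid by (elim exE conjE)
  then show ?thesis by (intro that[of e]) simp_all
qed

lemma pos_on_coord_Inl: "pos_on (coord_space (range Inl) :: (complex^('p::finite + 'q::finite)) set)"
  unfolding pos_on_def
proof (intro ballI impI)
  fix w :: "complex^('p + 'q)" assume w: "w \<in> coord_space (range Inl)" "w \<noteq> 0"
  then obtain i where i: "w $ i \<noteq> 0" by (auto simp: vec_eq_iff)
  then obtain a where a: "i = Inl a" using w(1) by (cases i) (auto simp: coord_space_def)
  have "0 < (\<Sum>a\<in>UNIV. (cmod (w $ Inl a))\<^sup>2)" using i a by (intro sum_pos2[of _ a]) auto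
  moreover have "w $ Inr b = 0" for b using w(1) by (auto simp: coord_space_def)
  ultimately show "0 < Re (herm w w)" by (simp add: Re_herm_self)
qed

lemma neg_on_coord_Inr: "neg_on (coord_space (range Inr) :: (complex^('p::finite + 'q::finite)) set)"
  unfolding neg_on_def
proof (intro ballI impI)
  fix w :: "complex^('p + 'q)" assume w: "w \<in> coord_space (range Inr)" "w \<noteq> 0"
  then obtain i where i: "w $ i \<noteq> 0" by (auto simp: vec_eq_iff)
  then obtain a where a: "i = Inr a" using w(1) by (cases i) (auto simp: coord_space_def)
  have "0 < (\<Sum>a\<in>UNIV. (cmod (w $ Inr a))\<^sup>2)" using i a by (intro sum_pos2[of _ a]) auto
  moreover have "w $ Inl b = 0" for b using w(1) by (auto simp: coord_space_def)
  ultimately show "Re (herm w w) < 0" by (simp add: Re_herm_self)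
qed

text \<open>An orthonormal basis of \<open>A\<close> is completed by one of its orthogonal
  complement in \<open>coord_space J\<close>. Indexing both by coordinates turns the result into
  columns of a unitary matrix.\<close>

lemma adapted_orthonormal_basis:
  fixes A :: "(complex^'n::finite) set"
  assumes A: "vec.subspace A" "A \<subseteq> coord_space J" and I: "card (I \<inter> J) = vec.dim A"
  obtains e where "\<And>i. i \<in> J \<Longrightarrow> e i \<in> coord_space J" "\<And>i. i \<in> I \<inter> J \<Longrightarrow> e i \<in> A"
    "\<And>i j. i \<in> J \<Longrightarrow> j \<in> J \<Longrightarrow> cip (e i) (e j) = (if i = j then 1 else 0)"
proof -
  let ?A' = "{x \<in> coord_space J. \<forall>a\<in>A. cip x a = 0}"
  note A' = orth_complement[OF subspace_coord_space A]
  have c: "card (J - I) = vec.dim ?A'"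
    unfolding A'(2) using card_Diff_subset_Int[of J I] I by (simp add: Int_commute)
  obtain e1 where e1: "\<And>i. i \<in> I \<inter> J \<Longrightarrow> e1 i \<in> A"
    "\<And>i j. i \<in> I \<inter> J \<Longrightarrow> j \<in> I \<inter> J \<Longrightarrow> cip (e1 i) (e1 j) = (if i = j then 1 else 0)"
    by (rule orthonormal_basis[OF A(1) finite I]) blast
  obtain e2 where e2: "\<And>i. i \<in> J - I \<Longrightarrow> e2 i \<in> ?A'"
    "\<And>i j. i \<in> J - I \<Longrightarrow> j \<in> J - I \<Longrightarrow> cip (e2 i) (e2 j) = (if i = j then 1 else 0)"
    by (rule orthonormal_basis[OF A'(1) finite c]) blast
  have x: "cip (e2 i) (e1 j) = 0" "cip (e1 j) (e2 i) = 0" if "i \<in> J - I" "j \<in> I \<inter> J" for i j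
    using e1(1)[OF that(2)] e2(1)[OF that(1)] cip_commute[of "e1 j" "e2 i"] by auto
  show ?thesis
  proof (rule that[of "\<lambda>i. if i \<in> I then e1 i else e2 i"])
    fix i j assume "i \<in> J" "j \<in> J"
    then show "cip (if i \<in> I then e1 i else e2 i) (if j \<in> I then e1 j else e2 j) = (if i = j then 1 else 0)"
      using e1(2)[of i j] e2(2)[of i j] x[of i j] x[of j i] by auto
  qed (use e1(1) e2(1) A(2) in auto)
qed

lemma card_blocks: "card (I :: ('p::finite + 'q::finite) set) = card (I \<inter> range Inl) + card (I \<inter> range Inr)"
proof -
  have "I = (I \<inter> range Inl) \<union> (I \<inter> range Inr)" using UNIV_sum by blast
  moreover have "(I \<inter> range Inl) \<inter> (I \<inter> range Inr) = {}" by auto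
  ultimately show ?thesis by (metis card_Un_disjoint finite)
qed

text \<open>This is transitivity of \<open>UU\<close> on split subspaces of a given signature:
  adapted orthonormal bases of the two coordinate parts are the columns of a block diagonal unitary
  matrix.\<close>

lemma split_space_unitary_frame:
  fixes V :: "(complex^('p::finite + 'q::finite)) set"
  assumes V: "split_space V" "V \<in> flag_domain r r'"
    and I: "card (I \<inter> range Inl) = r" "card (I \<inter> range Inr) = r'"
  obtains u where "u \<in> UU" "act u (coord_space I) = V"
proof -
  let ?Ep = "coord_space (range Inl) :: (complex^('p + 'q)) set"
  let ?Em = "coord_space (range Inr) :: (complex^('p + 'q)) set"
  have sub: "vec.subspace V" and dV: "vec.dim V = r + r'" using V by (auto simp: flag_domain_def Gr_def)
  define A where "A = V \<inter> ?Ep" define B where "B = V \<inter> ?Em"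
  have A: "vec.subspace A" "A \<subseteq> ?Ep" "A \<subseteq> V" and B: "vec.subspace B" "B \<subseteq> ?Em" "B \<subseteq> V"
    using sub by (auto simp: A_def B_def vec.subspace_inter)
  have "V = {x + y |x y. x \<in> A \<and> y \<in> B}"
  proof (intro set_eqI iffI)
    fix v assume v: "v \<in> V"
    have "prp *v v \<in> A" using V(1) v by (auto simp: split_space_def A_def coord_space_def prp_mv)
    moreover have "v - prp *v v \<in> B"
      using V(1) v sub by (auto simp: split_space_def B_def coord_space_def prp_mv intro!: vec.subspace_diff)
        (metis Inl_Inr_False rangeI sumE)
    moreover have "v = prp *v v + (v - prp *v v)" by simp
    ultimately show "v \<in> {x + y |x y. x \<in> A \<and> y \<in> B}" by blast
  qed (use A B sub in \<open>auto intro: vec.subspace_add\<close>)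
  \<comment> \<open>The splitting bounds the sum of the dimensions from below and the signature
    bounds each of them from above, so both are exact.\<close>
  then have "r + r' \<le> vec.dim A + vec.dim B"
    using vec.dim_sums_Int[OF A(1) B(1)] dV by simp
  moreover have "vec.dim A \<le> r \<and> vec.dim B \<le> r'"
  proof -
    have "pos_on A" "neg_on B"
      using pos_on_coord_Inl neg_on_coord_Inr A B by (auto simp: pos_on_def neg_on_def)
    then have "vec.dim A \<le> Max {vec.dim W | W. vec.subspace W \<and> W \<subseteq> V \<and> pos_on W}"
      "vec.dim B \<le> Max {vec.dim W | W. vec.subspace W \<and> W \<subseteq> V \<and> neg_on W}"
      using A B by (intro Max_ge finite_dims; blast)+
    then show ?thesis using V(2) by (simp add: flag_domain_def herm_sign_alt)
  qed
  ultimately have dA: "vec.dim A = r" and dB: "vec.dim B = r'" by auto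
  obtain e1 where e1: "\<And>i. i \<in> range Inl \<Longrightarrow> e1 i \<in> ?Ep" "\<And>i. i \<in> I \<inter> range Inl \<Longrightarrow> e1 i \<in> A"
    "\<And>i j. i \<in> range Inl \<Longrightarrow> j \<in> range Inl \<Longrightarrow> cip (e1 i) (e1 j) = (if i = j then 1 else 0)"
    by (rule adapted_orthonormal_basis[OF A(1,2), of I]) (use I(1) dA in \<open>simp, blast\<close>)
  obtain e2 where e2: "\<And>i. i \<in> range Inr \<Longrightarrow> e2 i \<in> ?Em" "\<And>i. i \<in> I \<inter> range Inr \<Longrightarrow> e2 i \<in> B"
    "\<And>i j. i \<in> range Inr \<Longrightarrow> j \<in> range Inr \<Longrightarrow> cip (e2 i) (e2 j) = (if i = j then 1 else 0)"
    by (rule adapted_orthonormal_basis[OF B(1,2), of I]) (use I(2) dB in \<open>simp, blast\<close>)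
  define e where "e i = (if i \<in> range Inl then e1 i else e2 i)" for i
  have eE: "e i \<in> (if i \<in> range Inl then ?Ep else ?Em)" for i
    using e1(1)[of i] e2(1)[of i] in_range_Inr by (auto simp: e_def)
  have eV: "e i \<in> V" if "i \<in> I" for i
    using e1(2)[of i] e2(2)[of i] A B that by (auto simp: e_def in_range_Inr)
  have EE: "cip x y = 0" "cip y x = 0" if "x \<in> ?Ep" "y \<in> ?Em" for x y
  proof -
    have "x $ i = 0 \<or> y $ i = 0" for i
      using that unfolding coord_space_def mem_Collect_eq in_range_Inr by metis
    then have prod: "x $ i * cnj (y $ i) = 0" "y $ i * cnj (x $ i) = 0" for i
      by (metis mult_eq_0_iff complex_cnj_zero)+
    show "cip x y = 0" "cip y x = 0" by (simp_all only: cip_def prod sum.neutral_const)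
  qed
  have orth: "cip (e i) (e j) = (if i = j then 1 else 0)" for i j
  proof (cases "(i \<in> range Inl) = (j \<in> range Inl)")
    case False
    then have "i \<noteq> j" by auto
    then show ?thesis using False eE[of i] eE[of j] EE by (auto split: if_splits)
  next
    case True
    then show ?thesis using e1(3)[of i j] e2(3)[of i j] in_range_Inr by (auto simp: e_def)
  qed
  define u0 where "u0 = colmat e"
  have u1: "cadj u0 ** u0 = mat 1"
  proof -
    have "(cadj u0 ** u0) $ i $ j = (if i = j then 1 else 0)" for i j
      using colmat_form[of e "mat 1" i j] orth[of j i] by (auto simp: u0_def)
    then show ?thesis by (simp add: vec_eq_iff mat_def)
  qed
  have Ee: "E_mat *v e i = eps i *s e i" for i
    using eE[of i] by (cases i) (auto simp: vec_eq_iff E_mat_mv coord_space_def eps_def image_iff split: sum.splits)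
  have u2: "cadj u0 ** E_mat ** u0 = E_mat"
  proof -
    have "(cadj u0 ** E_mat ** u0) $ i $ j = E_mat $ i $ j" for i j
      using colmat_form[of e E_mat i j] orth[of j i] by (auto simp: u0_def Ee cip_scale_left E_mat_entry)
    then show ?thesis by (simp add: vec_eq_iff)
  qed
  \<comment> \<open>The determinant of \<open>u0\<close> has modulus one, hence so does this root of
    its inverse, and the scalar correction keeps the matrix unitary.\<close>
  define c where "c = exp (- Ln (det u0) / of_nat CARD('p + 'q))"
  have du: "cnj (det u0) * det u0 = 1" using u1 by (metis det_I det_cadj det_mul)
  then have d0: "det u0 \<noteq> 0" by auto
  have "det (sl_norm u0) = 1" using sl_norm_SL[of u0] d0 by (simp add: SL_def invertible_det_nz)
  then have cn: "c ^ CARD('p + 'q) * det u0 = 1" by (simp only: sl_norm_def det_mul det_mat c_def)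
  have "complex_of_real ((cmod (det u0))\<^sup>2) = 1"
    using du by (simp only: complex_norm_square mult.commute)
  then have "(cmod (det u0))\<^sup>2 = 1" using of_real_eq_1_iff by blast
  then have "cmod (det u0) = 1" by (intro power2_eq_imp_eq[of _ 1]) simp_all
  then have "cmod c ^ CARD('p + 'q) = 1 ^ CARD('p + 'q)"
    using arg_cong[OF cn, of cmod] by (simp only: norm_mult norm_power norm_one power_one mult_1_right)
  then have "cmod c = 1" by (rule power_eq_imp_eq_base) auto
  then have cc: "cnj c * c = 1" using complex_norm_square[of c] by (simp add: mult.commute)
  have "c \<noteq> 0" by (simp add: c_def)
  define u where "u = mat c ** u0"
  have cu: "cadj u = mat (cnj c) ** cadj u0" by (simp add: u_def cadj_def vec_eq_iff)
  have cX: "mat (cnj c) ** X ** Y ** (mat c ** Z) = X ** Y ** Z" for X Y Z :: "complex^('p + 'q)^('p + 'q)"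
  proof -
    have "mat (cnj c) ** X ** Y ** (mat c ** Z) = (mat (cnj c) ** (X ** Y ** mat c)) ** Z" by (simp add: matrix_mul_assoc)
    also have "mat (cnj c) ** (X ** Y ** mat c) = mat (cnj c) ** (mat c ** (X ** Y))"
      by (simp only: mult_mat_commute)
    also have "\<dots> = X ** Y" by (simp add: vec_eq_iff mult.assoc[symmetric] cc)
    finally show ?thesis .
  qed
  have "u \<in> UU"
  proof -
    have "cadj u ** u = mat 1" using u1 cX[of "cadj u0" "mat 1" u0] by (simp add: cu) (simp add: u_def)
    moreover have "cadj u ** E_mat ** u = E_mat" using u2 cX[of "cadj u0" E_mat u0] by (simp add: cu) (simp add: u_def)
    moreover have "det u = 1" using cn by (simp only: u_def det_mul det_mat)
    ultimately show ?thesis by (simp add: UU_def)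
  qed
  moreover have "act u0 (coord_space I) = V"
  proof (rule act_mono_eq)
    show "invertible u0" using u1 invertible_left_inverse by blast
    show "act u0 (coord_space I) \<subseteq> V"
    proof
      fix v assume "v \<in> act u0 (coord_space I)"
      then obtain x where x: "x \<in> coord_space I" "v = (\<Sum>i\<in>UNIV. x $ i *s e i)"
        by (auto simp: act_def u0_def colmat_mv)
      have "x $ i *s e i \<in> V" for i
        using eV[of i] x(1) sub by (cases "i \<in> I") (auto simp: coord_space_def vec.subspace_scale vec.subspace_0)
      then show "v \<in> V" unfolding x(2) using sub by (intro vec.subspace_sum) auto
    qed
    show "vec.dim V \<le> vec.dim (coord_space I)" using I dV by (simp add: card_blocks[of I])
  qed (use sub in simp_all)
  then have "act u (coord_space I) = V"
    unfolding u_def act_mult using sub \<open>c \<noteq> 0\<close> by (simp add: act_mat)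
  ultimately show ?thesis by (rule that)
qed

section \<open>The complex orbit consists of split subspaces\<close>

lemma prp_prp_mv: "prp *v (prp *v x) = prp *v x"
  by (simp add: vec_eq_iff prp_mv)

lemma prp_facts: "cadj prp = prp" "prp ** prp = prp"
proof -
  show "cadj prp = prp" by (auto simp: cadj_def prp_def vec_eq_iff)
  show "prp ** prp = prp" unfolding matrix_eq by (simp add: matrix_vector_mul_assoc[symmetric] prp_prp_mv)
qed

lemma prp_E_mat: "mat 2 ** prp = mat 1 + E_mat"
proof -
  have "(mat 2 ** prp) $ i $ j = (mat 1 + E_mat) $ i $ j" for i j :: "'a + 'b"
    unfolding mat_mult_entry by (cases i) (auto simp: prp_def E_mat_entry mat_def)
  then show ?thesis by (simp add: vec_eq_iff)
qed

lemma UU_prp: assumes "u \<in> UU" shows "prp ** u = u ** prp"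
proof -
  have "mat 2 ** (prp ** u) = mat 2 ** (u ** prp)"
  proof -
    have "mat 2 ** (prp ** u) = (mat 1 + E_mat) ** u" by (simp add: matrix_mul_assoc prp_E_mat)
    also have "\<dots> = u ** (mat 1 + E_mat)"
      using UU_D(5)[OF assms] by (simp add: matrix_add_rdistrib matrix_add_ldistrib)
    also have "\<dots> = (u ** mat 2) ** prp" by (simp add: prp_E_mat[symmetric] matrix_mul_assoc)
    also have "\<dots> = mat 2 ** (u ** prp)" by (simp only: mult_mat_commute matrix_mul_assoc)
    finally show ?thesis .
  qed
  then show ?thesis by (simp add: vec_eq_iff)
qed

section \<open>Orthogonal projections and the trace along an orbit\<close>

lemma cip_inner: "Re (cip x y) = x \<bullet> y"
  by (simp add: cip_def inner_vec_def inner_complex_def)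

definition is_oproj :: "complex^'n::finite^'n \<Rightarrow> (complex^'n) set \<Rightarrow> bool" where
  "is_oproj P S \<longleftrightarrow> cadj P = P \<and> (\<forall>v\<in>S. P *v v = v) \<and> (\<forall>x. P *v x \<in> S)"

lemma is_oproj_contraction:
  assumes P: "is_oproj P S" shows "norm (P *v x) \<le> norm x" "norm (x - P *v x) \<le> norm x"
proof -
  have PP: "P *v (P *v x) = P *v x" and c: "cadj P = P" using P by (auto simp: is_oproj_def)
  have o: "cip (P *v x) (x - P *v x) = 0"
    by (simp add: cip_diff_right) (metis PP c cip_adj)
  have "cip x x = cip (P *v x) (P *v x) + cip (x - P *v x) (x - P *v x)"
    using o cip_commute[of "x - P *v x" "P *v x"]
    by (simp add: cip_diff_left cip_diff_right algebra_simps)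
  then have e: "(norm x)\<^sup>2 = (norm (P *v x))\<^sup>2 + (norm (x - P *v x))\<^sup>2"
    unfolding cip_self by (metis of_real_add of_real_eq_iff)
  have "(norm (P *v x))\<^sup>2 \<le> (norm x)\<^sup>2" "(norm (x - P *v x))\<^sup>2 \<le> (norm x)\<^sup>2" unfolding e by simp_all
  then show "norm (P *v x) \<le> norm x" "norm (x - P *v x) \<le> norm x" by (auto intro: power2_le_imp_le)
qed

text \<open>Write \<open>P - Q = (1 - Q) P - Q (1 - P)\<close>. The first term is controlled
  directly by the gap; the second is the adjoint of \<open>(1 - P) Q\<close> and obeys the same
  bound.\<close>

lemma is_oproj_gap:
  assumes P: "is_oproj P S" and Q: "is_oproj Q S'"
    and g1: "\<And>v. v \<in> S \<Longrightarrow> \<exists>v'\<in>S'. norm (v - v') \<le> d * norm v"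
    and g2: "\<And>v. v \<in> S' \<Longrightarrow> \<exists>v'\<in>S. norm (v - v') \<le> d * norm v" and d: "d \<ge> 0"
  shows "norm (P *v x - Q *v x) \<le> 2 * d * norm x"
proof -
  have half: "norm (P *v y - Q *v (P *v y)) \<le> d * norm y"
    if P: "is_oproj P S" and Q: "is_oproj Q S'" and g: "\<And>v. v \<in> S \<Longrightarrow> \<exists>v'\<in>S'. norm (v - v') \<le> d * norm v"
    for P Q S S' and y :: "complex^'a"
  proof -
    have "P *v y \<in> S" using P by (simp add: is_oproj_def)
    then obtain v' where v': "v' \<in> S'" "norm (P *v y - v') \<le> d * norm (P *v y)" using g by blast
    have "P *v y - Q *v (P *v y) = (P *v y - v') - Q *v (P *v y - v')"
      using Q v'(1) by (simp add: is_oproj_def matrix_vector_mult_diff_distrib)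
    then have "norm (P *v y - Q *v (P *v y)) = norm ((P *v y - v') - Q *v (P *v y - v'))" by (rule arg_cong)
    also have "\<dots> \<le> norm (P *v y - v')" by (rule is_oproj_contraction(2)[OF Q])
    also have "\<dots> \<le> d * norm (P *v y)" by (rule v'(2))
    also have "\<dots> \<le> d * norm y" using is_oproj_contraction(1)[OF P] d by (intro mult_left_mono)
    finally show ?thesis .
  qed
  define w where "w = Q *v (x - P *v x)"
  have cP: "cadj P = P" and cQ: "cadj Q = Q" and Qw: "Q *v w = w" using P Q by (auto simp: is_oproj_def w_def)
  have "cip w w = cip (x - P *v x) w" unfolding w_def using Qw by (metis cQ cip_adj w_def)
  also have "\<dots> = cip x (Q *v w - P *v (Q *v w))"
    by (simp add: cip_diff_left cip_diff_right Qw) (metis cP cip_adj)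
  finally have "(norm w)\<^sup>2 = x \<bullet> (Q *v w - P *v (Q *v w))" by (metis Re_complex_of_real cip_inner cip_self)
  also have "\<dots> \<le> norm x * norm (Q *v w - P *v (Q *v w))" by (rule norm_cauchy_schwarz)
  also have "\<dots> \<le> norm x * (d * norm w)" using half[OF Q P g2] by (intro mult_left_mono) auto
  finally have "norm w * norm w \<le> (d * norm x) * norm w" by (simp add: power2_eq_square algebra_simps)
  then have "norm w \<le> d * norm x" using d by (cases "norm w = 0") (auto simp: mult_le_cancel_right)
  moreover have "P *v x - Q *v x = (P *v x - Q *v (P *v x)) - w" by (simp add: w_def matrix_vector_mult_diff_distrib)
  then have "norm (P *v x - Q *v x) \<le> norm (P *v x - Q *v (P *v x)) + norm w" by (metis norm_triangle_ineq4)
  ultimately show ?thesis using half[OF P Q g1, of x] by simp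
qed

text \<open>The real part of the trace of \<open>P ** prp\<close>. Elements of \<open>UU\<close>
  commute with \<open>prp\<close>, so this number is constant on an orbit of \<open>UU\<close> and
  detects any motion that leaves the orbit.\<close>

definition ptrace :: "complex^('p::finite + 'q::finite)^('p + 'q) \<Rightarrow> real" where
  "ptrace P = (\<Sum>a\<in>UNIV. Re (P $ Inl a $ Inl a))"

lemma ptrace_trace: "ptrace P = Re (trace (P ** prp))"
proof -
  have "(P ** prp) $ i $ i = (if i \<in> range Inl then P $ i $ i else 0)" for i
  proof -
    have "(P ** prp) $ i $ i = (\<Sum>k\<in>UNIV. if k = i then (if i \<in> range Inl then P $ i $ k else 0) else 0)"
      unfolding matrix_matrix_mult_def prp_def vec_lambda_beta by (rule sum.cong) auto
    then show ?thesis by simp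
  qed
  then show ?thesis by (simp add: ptrace_def trace_def sum_UNIV_sum image_iff)
qed

lemma ptrace_UU:
  assumes u: "u \<in> UU" and P: "is_oproj P S"
  shows "is_oproj (u ** P ** cadj u) (act u S)" "ptrace (u ** P ** cadj u) = ptrace P"
proof -
  note U = UU_D[OF u]
  have uu: "cadj u *v (u *v x) = x" for x by (simp add: matrix_vector_mul_assoc U(1))
  show "is_oproj (u ** P ** cadj u) (act u S)"
    using P by (auto simp: is_oproj_def cadj_mult matrix_mul_assoc act_def matrix_vector_mul_assoc[symmetric] uu)
  have "trace ((u ** P ** cadj u) ** prp) = trace (u ** (P ** (cadj u ** prp)))" by (simp add: matrix_mul_assoc)
  also have "\<dots> = trace (P ** (cadj u ** prp) ** u)" by (rule trace_mul_sym)
  also have "P ** (cadj u ** prp) ** u = P ** ((cadj u ** u) ** prp)"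
    using UU_prp[OF u] by (simp add: matrix_mul_assoc[symmetric])
  finally show "ptrace (u ** P ** cadj u) = ptrace P" by (simp add: ptrace_trace U(1))
qed

lemma is_oproj_orthogonal_frame:
  fixes v :: "'k \<Rightarrow> complex^'n::finite"
  assumes K: "finite K" and orth: "\<And>i j. i \<in> K \<Longrightarrow> j \<in> K \<Longrightarrow> i \<noteq> j \<Longrightarrow> cip (v i) (v j) = 0"
    and n: "\<And>i. i \<in> K \<Longrightarrow> cip (v i) (v i) = of_real (n i)" "\<And>i. i \<in> K \<Longrightarrow> n i > 0"
    and S: "vec.subspace S" "\<And>i. i \<in> K \<Longrightarrow> v i \<in> S" "\<And>x. x \<in> S \<Longrightarrow> \<exists>c. x = (\<Sum>i\<in>K. c i *s v i)"
  shows "is_oproj (\<chi> a b. \<Sum>i\<in>K. v i $ a * cnj (v i $ b) / of_real (n i)) S" (is "is_oproj ?P S")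
proof -
  have mv: "?P *v x = (\<Sum>i\<in>K. (cip x (v i) / of_real (n i)) *s v i)" for x
  proof -
    have "(?P *v x) $ a = (\<Sum>b\<in>UNIV. \<Sum>i\<in>K. v i $ a * cnj (v i $ b) / of_real (n i) * x $ b)" for a
      by (simp add: matrix_vector_mult_def sum_distrib_right)
    also have "\<dots> a = (\<Sum>i\<in>K. \<Sum>b\<in>UNIV. v i $ a * cnj (v i $ b) / of_real (n i) * x $ b)" for a
      by (rule sum.swap)
    also have "\<dots> a = (\<Sum>i\<in>K. (cip x (v i) / of_real (n i)) * v i $ a)" for a
      by (simp add: cip_def sum_distrib_right sum_distrib_left sum_divide_distrib algebra_simps)
    finally show ?thesis by (simp add: vec_eq_iff)
  qed
  have "?P *v x = x" if x: "x \<in> S" for x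
  proof -
    obtain c where c: "x = (\<Sum>i\<in>K. c i *s v i)" using S(3)[OF x] by blast
    have "cip x (v j) = c j * of_real (n j)" if j: "j \<in> K" for j
    proof -
      have "cip x (v j) = (\<Sum>i\<in>K. if i = j then c i * of_real (n i) else 0)"
        unfolding c cip_sum_left using orth n j by (intro sum.cong) (auto simp: cip_scale_left)
      then show ?thesis using K j by simp
    qed
    then have "?P *v x = (\<Sum>i\<in>K. c i *s v i)" unfolding mv using n(2) by (intro sum.cong) force+
    then show ?thesis using c by simp
  qed
  moreover have "?P *v x \<in> S" for x unfolding mv using S by (intro vec.subspace_sum vec.subspace_scale) auto
  moreover have "cadj ?P = ?P" by (simp add: cadj_def vec_eq_iff mult.commute)
  ultimately show ?thesis by (simp add: is_oproj_def)
qed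

lemma ptrace_orthogonal_frame:
  fixes v :: "'k \<Rightarrow> complex^('p::finite + 'q::finite)"
  shows "ptrace (\<chi> a b. \<Sum>i\<in>K. v i $ a * cnj (v i $ b) / of_real (n i)) = (\<Sum>i\<in>K. (norm (prp *v v i))\<^sup>2 / n i)"
proof -
  have "(norm (prp *v x))\<^sup>2 = (\<Sum>a\<in>UNIV. (cmod (x $ Inl a))\<^sup>2)" for x :: "complex^('p + 'q)"
    by (simp add: norm_vec_def L2_set_def sum_nonneg sum_UNIV_sum prp_mv image_iff)
  moreover have "Re (v i $ Inl a * cnj (v i $ Inl a) / of_real (n i)) = (cmod (v i $ Inl a))\<^sup>2 / n i" for i a
    by (simp add: complex_norm_square[symmetric] flip: of_real_divide)
  ultimately show ?thesis
    unfolding ptrace_def vec_lambda_beta Re_sum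
    by (subst sum.swap) (simp only: sum_divide_distrib)
qed

text \<open>Choose an orthonormal basis of \<open>S\<close> that diagonalises the compression of
  \<open>prp\<close>, with eigenvalues \<open>c i\<close> between 0 and 1. The flow sends
  \<open>c i\<close> to \<open>(1 + t)\<^sup>2 * c i / n i\<close>, an increase by
  \<open>c i * (1 - c i) * (2 * t + t\<^sup>2) / n i\<close>, and some \<open>c i\<close> is
  strictly between 0 and 1 unless \<open>S\<close> is split.\<close>

lemma ptrace_flow:
  fixes S :: "(complex^('p::finite + 'q::finite)) set"
  assumes S: "vec.subspace S" and ns: "\<not> split_space S"
  obtains P g where "is_oproj P S" "g > 0"
    "\<And>t. 0 < t \<Longrightarrow> t \<le> (1::real) \<Longrightarrow> \<exists>Q. is_oproj Q (act (mat 1 + mat (of_real t) ** prp) S) \<and> ptrace Q \<ge> ptrace P + g * t"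
proof -
  let ?K = "{..<vec.dim S}"
  have "\<exists>e. (\<forall>i\<in>?K. e i \<in> S) \<and> (\<forall>i\<in>?K. \<forall>j\<in>?K. cip (mat 1 *v e i) (e j) = (if i = j then 1 else 0)) \<and>
    (\<forall>i\<in>?K. \<forall>j\<in>?K. i \<noteq> j \<longrightarrow> cip (prp *v e i) (e j) = 0) \<and>
    (\<forall>x\<in>S. x = (\<Sum>i\<in>?K. cip (mat 1 *v x) (e i) *s e i))"
    using S by (intro simultaneous_diagonalisation) (auto simp: cip_self prp_facts)
  then obtain e where e: "\<forall>i\<in>?K. e i \<in> S" "\<forall>i\<in>?K. \<forall>j\<in>?K. cip (e i) (e j) = (if i = j then 1 else 0)"
    "\<forall>i\<in>?K. \<forall>j\<in>?K. i \<noteq> j \<longrightarrow> cip (prp *v e i) (e j) = 0"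
    "\<forall>x\<in>S. x = (\<Sum>i\<in>?K. cip x (e i) *s e i)"
    unfolding matrix_vector_mul_lid by (elim exE conjE)
  define c where "c i = (norm (prp *v e i))\<^sup>2" for i
  have cc: "cip (prp *v x) y = cip (prp *v x) (prp *v y)" for x y :: "complex^('p + 'q)"
    by (metis cip_adj prp_facts(1) prp_prp_mv)
  have ci: "cip (prp *v e i) (e i) = of_real (c i)" for i
    by (subst cc) (simp add: c_def cip_self)
  have n1: "norm (e i) = 1" if "i \<in> ?K" for i
  proof -
    have "complex_of_real ((norm (e i))\<^sup>2) = 1" using e(2) that by (simp add: cip_self[symmetric] del: of_real_power)
    then have "(norm (e i))\<^sup>2 = 1" using of_real_eq_1_iff by blast
    then show ?thesis by (intro power2_eq_imp_eq[of _ 1]) simp_all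
  qed
  have sub1: "(norm (e i - prp *v e i))\<^sup>2 = 1 - c i" if "i \<in> ?K" for i
  proof -
    have "cip (e i - prp *v e i) (e i - prp *v e i) = cip (e i) (e i) - cip (e i) (prp *v e i) - cip (prp *v e i) (e i) + cip (prp *v e i) (prp *v e i)"
      by (simp add: cip_diff_left cip_diff_right)
    also have "cip (e i) (prp *v e i) = of_real (c i)" using cip_commute[of "e i" "prp *v e i"] ci[of i] by simp
    also have "cip (prp *v e i) (prp *v e i) = of_real (c i)" by (simp add: c_def cip_self)
    also have "cip (e i) (e i) = 1" using e(2) that by simp
    finally have "complex_of_real ((norm (e i - prp *v e i))\<^sup>2) = of_real (1 - c i)" by (simp add: cip_self ci)
    then show ?thesis using of_real_eq_iff by blast
  qed
  have c1: "c i \<le> 1" if "i \<in> ?K" for i using sub1[OF that] zero_le_power2[of "norm (e i - prp *v e i)"] by linarith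
  have c0: "c i \<ge> 0" for i by (simp add: c_def)
  \<comment> \<open>\<open>c i\<close> is the squared length of the positive part of the unit vector
    \<open>e i\<close>. The value 0 means that this part vanishes, the value 1 that it is all of
    \<open>e i\<close>; if only these occur, \<open>S\<close> is split.\<close>
  have "\<exists>i\<in>?K. c i \<noteq> 0 \<and> c i \<noteq> 1"
  proof (rule ccontr)
    assume "\<not> (\<exists>i\<in>?K. c i \<noteq> 0 \<and> c i \<noteq> 1)"
    then have "prp *v e i \<in> S" if "i \<in> ?K" for i
    proof (cases "c i = 0")
      case True
      then have "prp *v e i = 0" by (simp add: c_def)
      then show ?thesis using S vec.subspace_0 by metis
    next
      case False
      then have "c i = 1" using \<open>\<not> (\<exists>i\<in>?K. c i \<noteq> 0 \<and> c i \<noteq> 1)\<close> that by blast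
      then have "e i - prp *v e i = 0" using sub1[OF that] by simp
      then show ?thesis using e(1) that by (metis eq_iff_diff_eq_0)
    qed
    then have "prp *v x \<in> S" if "x \<in> S" for x
    proof -
      have "prp *v x = (\<Sum>i\<in>?K. cip x (e i) *s (prp *v e i))"
        by (subst bspec[OF e(4) that]) (simp add: vec.sum vec.scale)
      then show ?thesis using \<open>\<And>i. i \<in> ?K \<Longrightarrow> prp *v e i \<in> S\<close> S by (auto intro!: vec.subspace_sum vec.subspace_scale)
    qed
    then show False using ns S by (simp add: split_space_def)
  qed
  then obtain i0 where i0: "i0 \<in> ?K" "c i0 \<noteq> 0" "c i0 \<noteq> 1" by blast
  \<comment> \<open>From \<open>n i \<le> 4\<close> and \<open>2 * t + t\<^sup>2 \<ge> 2 * t\<close>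
    the increase at \<open>i0\<close> is at least \<open>c i0 * (1 - c i0) / 2 * t\<close>.\<close>
  define g where "g = c i0 * (1 - c i0) / 2"
  have g: "g > 0" using i0 c0[of i0] c1[of i0] by (simp add: g_def)
  define P where "P = (\<chi> a b. \<Sum>i\<in>?K. e i $ a * cnj (e i $ b) / of_real 1)"
  have P: "is_oproj P S" unfolding P_def
  proof (rule is_oproj_orthogonal_frame)
    show "\<exists>c. x = (\<Sum>i\<in>?K. c i *s e i)" if "x \<in> S" for x
      using bspec[OF e(4) that] by (rule exI[of _ "\<lambda>i. cip x (e i)"])
  qed (use e S in simp_all)
  have tP: "ptrace P = (\<Sum>i\<in>?K. c i)"
    unfolding P_def by (subst ptrace_orthogonal_frame) (simp add: c_def)
  have "\<exists>Q. is_oproj Q (act (mat 1 + mat (of_real t) ** prp) S) \<and> ptrace Q \<ge> ptrace P + g * t"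
    if t: "0 < t" "t \<le> 1" for t :: real
  proof -
    let ?M = "mat 1 + mat (of_real t) ** prp :: complex^('p + 'q)^('p + 'q)"
    have mc: "mat d *v y = d *s y" for d and y :: "complex^('p + 'q)"
      by (simp add: vec_eq_iff matrix_vector_mult_def mat_def mult_delta_left)
    have Mv: "?M *v x = x + of_real t *s (prp *v x)" for x
      by (simp add: matrix_vector_mult_add_rdistrib matrix_vector_mul_assoc[symmetric] mc)
    define v where "v i = ?M *v e i" for i
    have ve: "v i = e i + of_real t *s (prp *v e i)" for i by (simp only: v_def Mv)
    \<comment> \<open>The squared norm of \<open>v i\<close>. The moved frame stays orthogonal
      because both the Gram matrix and the matrix of \<open>prp\<close> are diagonal in the basis
      \<open>e\<close>.\<close>
    define n where "n i = 1 + (2 * t + t\<^sup>2) * c i" for i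
    have cv: "cip (v i) (v j) = cip (e i) (e j) + of_real (2 * t + t\<^sup>2) * cip (prp *v e i) (e j)" for i j
    proof -
      have "cip (e i) (prp *v e j) = cip (prp *v e i) (e j)" by (metis cip_adj prp_facts(1))
      moreover have "cip (prp *v e i) (prp *v e j) = cip (prp *v e i) (e j)" using cc by metis
      ultimately show ?thesis
        by (simp add: ve cip_add_left cip_add_right cip_scale_left cip_scale_right algebra_simps power2_eq_square)
    qed
    have npos: "n i > 0" for i unfolding n_def using t c0[of i] by (intro add_pos_nonneg mult_nonneg_nonneg) auto
    let ?Q = "\<chi> a b. \<Sum>i\<in>?K. v i $ a * cnj (v i $ b) / of_real (n i)"
    have "is_oproj ?Q (act ?M S)"
    proof (rule is_oproj_orthogonal_frame)
      show "cip (v i) (v j) = 0" if "i \<in> ?K" "j \<in> ?K" "i \<noteq> j" for i j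
        using e(2,3) that by (simp add: cv)
      show "cip (v i) (v i) = of_real (n i)" if "i \<in> ?K" for i
        using e(2) that by (simp add: cv ci n_def)
      show "v i \<in> act ?M S" if "i \<in> ?K" for i using e(1) that by (auto simp: v_def act_def)
      fix x assume "x \<in> act ?M S"
      then obtain y where y: "y \<in> S" "x = ?M *v y" by (auto simp: act_def)
      have "x = (\<Sum>i\<in>?K. cip y (e i) *s v i)"
        unfolding y(2) v_def by (subst bspec[OF e(4) y(1)]) (simp add: vec.sum vec.scale)
      then show "\<exists>c. x = (\<Sum>i\<in>?K. c i *s v i)" by (rule exI[of _ "\<lambda>i. cip y (e i)"])
    qed (use S npos in \<open>simp_all add: subspace_act\<close>)
    moreover have "ptrace ?Q = (\<Sum>i\<in>?K. (1 + t)\<^sup>2 * c i / n i)"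
    proof -
      have "prp *v v i = (1 + t) *\<^sub>R (prp *v e i)" for i
        by (simp add: ve vec.add vec.scale prp_prp_mv scaleR_eq_scale vec.scale_left_distrib)
      then have "(norm (prp *v v i))\<^sup>2 = (1 + t)\<^sup>2 * c i" for i
        using t by (simp only: c_def norm_scaleR power_mult_distrib power2_abs)
      then show ?thesis by (simp only: ptrace_orthogonal_frame)
    qed
    moreover have "(\<Sum>i\<in>?K. (1 + t)\<^sup>2 * c i / n i) \<ge> (\<Sum>i\<in>?K. c i + (if i = i0 then g * t else 0))"
    proof (rule sum_mono)
      fix i assume i: "i \<in> ?K"
      have eq: "(1 + t)\<^sup>2 * c i / n i - c i = c i * (1 - c i) * (2 * t + t\<^sup>2) / n i"
        using npos[of i] by (simp add: field_simps) (simp add: n_def power2_eq_square algebra_simps)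
      have nn: "c i * (1 - c i) \<ge> 0" using c0[of i] c1[OF i] by simp
      have "n i \<le> 4"
      proof -
        have "t\<^sup>2 \<le> 1" using t by (simp add: power_le_one)
        then have "(2 * t + t\<^sup>2) * c i \<le> 3 * 1" using t c0[of i] c1[OF i] by (intro mult_mono) auto
        then show ?thesis by (simp add: n_def)
      qed
      have "c i * (1 - c i) / 2 * t = c i * (1 - c i) * (2 * t) / 4" by simp
      also have "\<dots> \<le> c i * (1 - c i) * (2 * t + t\<^sup>2) / n i"
        using nn t npos[of i] \<open>n i \<le> 4\<close> by (intro frac_le mult_left_mono) (auto intro!: mult_nonneg_nonneg)
      finally have b: "c i * (1 - c i) / 2 * t \<le> (1 + t)\<^sup>2 * c i / n i - c i" by (simp only: eq)
      have "0 \<le> c i * (1 - c i) / 2 * t" using nn t by simp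
      then show "c i + (if i = i0 then g * t else 0) \<le> (1 + t)\<^sup>2 * c i / n i"
      proof (cases "i = i0")
        case True
        then have "g * t = c i * (1 - c i) / 2 * t" by (simp add: g_def)
        then have "c i + g * t \<le> (1 + t)\<^sup>2 * c i / n i" using b by linarith
        then show ?thesis using True by simp
      next
        case False
        have "c i \<le> (1 + t)\<^sup>2 * c i / n i" using b \<open>0 \<le> c i * (1 - c i) / 2 * t\<close> by linarith
        then show ?thesis using False by simp
      qed
    qed
    moreover have "(\<Sum>i\<in>?K. c i + (if i = i0 then g * t else 0)) = ptrace P + g * t"
      using i0(1) by (simp add: tP sum.distrib)
    ultimately show ?thesis by (intro exI[of _ ?Q]) simp
  qed
  with P g that show ?thesis by blast
qed

text \<open>Each coordinate is read off by a matrix \<open>G i\<close> that sends \<open>D i\<close>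
  to a fixed basis vector and the other \<open>D j\<close> to 0, so it is bounded by the norm of the
  whole combination.\<close>

lemma independent_lower_bound:
  fixes D :: "nat \<Rightarrow> complex^'m::finite"
  assumes "vec.dim (D ` {..<q}) = q"
  obtains M where "M > 0" "\<And>z. (\<Sum>i<q. cmod (z i)) \<le> M * norm (\<Sum>i<q. z i *s D i)"
proof -
  have fin: "finite (D ` {..<q})" by simp
  have "vec.dim (D ` {..<q}) \<le> card (D ` {..<q})"
    by (rule vec.dim_le_card[OF vec.span_superset fin])
  moreover have "card (D ` {..<q}) \<le> q" using card_image_le[of "{..<q}" D] by simp
  ultimately have card: "card (D ` {..<q}) = q" using assms by simp
  then have inj: "inj_on D {..<q}" by (intro eq_card_imp_inj_on) simp_all
  have ind: "vec.independent (D ` {..<q})"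
  proof (rule vec.card_le_dim_spanning[OF subset_refl vec.span_superset fin])
    show "card (D ` {..<q}) \<le> vec.dim (D ` {..<q})" using card assms by simp
  qed
  obtain K where K: "K > 0" "\<And>(A::complex^'m^'m) x. norm (A *v x) \<le> norm A * norm x * K"
    using matrix_vector_mult_norm_bound by blast
  let ?u = "axis undefined 1 :: complex^'m"
  have "\<exists>G::complex^'m^'m. \<forall>j<q. G *v D j = (if j = i then ?u else 0)" if "i < q" for i
  proof -
    obtain g where g: "Vector_Spaces.linear (*s) (*s) g" "\<forall>x\<in>D ` {..<q}. g x = (if x = D i then ?u else 0)"
      using vec.linear_independent_extend[OF ind, of "\<lambda>x. if x = D i then ?u else 0"] by blast
    have "matrix g *v D j = (if j = i then ?u else 0)" if "j < q" for j
      using g that \<open>i < q\<close> inj by (auto simp: matrix_works inj_on_eq_iff)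
    then show ?thesis by blast
  qed
  then obtain G :: "nat \<Rightarrow> complex^'m^'m" where G: "\<And>i j. i < q \<Longrightarrow> j < q \<Longrightarrow> G i *v D j = (if j = i then ?u else 0)"
    by metis
  define M where "M = 1 + (\<Sum>i<q. norm (G i) * K)"
  have "(\<Sum>i<q. cmod (z i)) \<le> M * norm (\<Sum>i<q. z i *s D i)" for z
  proof -
    let ?x = "\<Sum>i<q. z i *s D i"
    have "cmod (z i) \<le> norm (G i) * K * norm ?x" if "i < q" for i
    proof -
      have "G i *v ?x = (\<Sum>j<q. if j = i then z j *s ?u else 0)"
        unfolding vec.sum using G[OF that] by (intro sum.cong) (auto simp: vec.scale)
      then have "G i *v ?x = z i *s ?u" using that by simp
      moreover have "cmod (z i) \<le> norm (z i *s ?u)"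
        using Finite_Cartesian_Product.norm_nth_le[of "z i *s ?u" undefined] by (simp add: axis_def)
      ultimately show ?thesis using K(2)[of "G i" ?x] by (simp add: algebra_simps)
    qed
    then have "(\<Sum>i<q. cmod (z i)) \<le> (\<Sum>i<q. norm (G i) * K * norm ?x)" by (intro sum_mono) auto
    also have "\<dots> = (\<Sum>i<q. norm (G i) * K) * norm ?x" by (rule sum_distrib_right[symmetric])
    also have "\<dots> \<le> M * norm ?x" by (intro mult_right_mono) (simp_all add: M_def)
    finally show ?thesis .
  qed
  moreover have "M > 0" unfolding M_def using K by (intro add_pos_nonneg sum_nonneg) auto
  ultimately show ?thesis using that by blast
qed

text \<open>The parameter is complex because the estimate serves both the circle, with
  \<open>s = cis \<theta> - 1\<close>, and the real flow.\<close>

lemma chart_first_order: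
  fixes X :: "complex^'n::finite^'n"
  assumes V: "V = gr_graph I A" and e: "e > 0"
  obtains d where "d > 0" "\<And>s. cmod s < d \<Longrightarrow> act (mat 1 + mat s ** X) V \<in> gr_chart_dom I \<and>
    norm (gr_coord I (act (mat 1 + mat s ** X) V) - gr_coord I V - s *s chart_deriv I A X) \<le> e * cmod s"
proof -
  obtain d1 where d1: "d1 > 0" "\<And>y::complex^'n^'n. dist y (mat 1) < d1 \<Longrightarrow> act y V \<in> gr_chart_dom I"
    using eventually_act_chart[of I A] unfolding eventually_nhds_metric V by blast
  define n where "n = norm X + 1"
  have n: "n > 0" by (simp add: n_def add_nonneg_pos)
  obtain d2 where d2: "d2 > 0" "\<And>y::complex^'n^'n. norm (y - mat 1) < d2 \<Longrightarrow>
      norm (gr_coord I (act y V) - gr_coord I (act (mat 1) V) - chart_deriv I A (y - mat 1)) \<le> e / n * norm (y - mat 1)"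
    using has_derivative_gr_coord_act[of I A] e n unfolding has_derivative_at_alt V by (meson divide_pos_pos)
  show ?thesis
  proof (rule that[of "min d1 d2 / n"])
    show "min d1 d2 / n > 0" using d1 d2 n by simp
    fix s assume s: "cmod s < min d1 d2 / n"
    let ?y = "mat 1 + mat s ** X"
    have ny: "norm (?y - mat 1) \<le> cmod s * n"
      by (simp add: norm_mat_mult n_def mult_left_mono)
    moreover have "cmod s * n < min d1 d2" using s n by (simp add: field_simps)
    ultimately have l: "norm (?y - mat 1) < d1" "norm (?y - mat 1) < d2" by auto
    have "norm (gr_coord I (act ?y V) - gr_coord I V - s *s chart_deriv I A X) \<le> e / n * norm (?y - mat 1)"
      using d2(2)[OF l(2)] by (simp add: chart_deriv_scale)
    also have "\<dots> \<le> e / n * (cmod s * n)" using ny e n by (intro mult_left_mono) auto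
    finally have "norm (gr_coord I (act ?y V) - gr_coord I V - s *s chart_deriv I A X) \<le> e * cmod s" using n by simp
    moreover have "dist ?y (mat 1) < d1" using l(1) by (simp only: dist_norm)
    ultimately show "act ?y V \<in> gr_chart_dom I \<and>
      norm (gr_coord I (act ?y V) - gr_coord I V - s *s chart_deriv I A X) \<le> e * cmod s"
      using d1(2) by blast
  qed
qed

lemma ptrace_diff:
  fixes P Q :: "complex^('p::finite + 'q::finite)^('p + 'q)"
  assumes "\<And>x. norm (P *v x - Q *v x) \<le> d * norm x"
  shows "\<bar>ptrace P - ptrace Q\<bar> \<le> real CARD('p) * d"
proof -
  have "\<bar>Re (P $ i $ i) - Re (Q $ i $ i)\<bar> \<le> d" for i
  proof -
    have "complex_of_real ((norm (axis i 1 :: complex^('p + 'q)))\<^sup>2) = 1"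
      by (simp only: cip_self[symmetric] cip_axis) (simp add: axis_def)
    then have "(norm (axis i 1 :: complex^('p + 'q)))\<^sup>2 = 1" using of_real_eq_1_iff by blast
    then have n1: "norm (axis i 1 :: complex^('p + 'q)) = 1" by (intro power2_eq_imp_eq[of _ 1]) simp_all
    have "\<bar>Re (P $ i $ i) - Re (Q $ i $ i)\<bar> \<le> cmod ((P *v axis i 1 - Q *v axis i 1) $ i)"
      using abs_Re_le_cmod[of "P $ i $ i - Q $ i $ i"] by (simp add: mv_axis)
    also have "\<dots> \<le> norm (P *v axis i 1 - Q *v axis i 1)" by (rule Finite_Cartesian_Product.norm_nth_le)
    also have "\<dots> \<le> d" using assms[of "axis i 1"] n1 by simp
    finally show ?thesis .
  qed
  then have "(\<Sum>a\<in>(UNIV :: 'p set). \<bar>Re (P $ Inl a $ Inl a) - Re (Q $ Inl a $ Inl a)\<bar>) \<le> (\<Sum>a\<in>(UNIV :: 'p set). d)"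
    by (intro sum_mono)
  moreover have "\<bar>ptrace P - ptrace Q\<bar> \<le> (\<Sum>a\<in>(UNIV :: 'p set). \<bar>Re (P $ Inl a $ Inl a) - Re (Q $ Inl a $ Inl a)\<bar>)"
    unfolding ptrace_def sum_subtractf[symmetric] by (rule sum_abs)
  ultimately show ?thesis by simp
qed

text \<open>Vectors of the two graphs over the same \<open>x\<close> in \<open>coord_space I\<close>
  are compared; \<open>x\<close> consists of the coordinates in \<open>I\<close> of the graph vector
  and is bounded by it. This converts distance in a chart into the gap that controls orthogonal
  projections.\<close>

lemma graph_gap:
  fixes R :: "complex^'n::finite^'n"
  assumes R: "invertible R"
  obtains C where "C > 0" "\<And>A B v. v \<in> act R (gr_graph I A) \<Longrightarrow>
    \<exists>v'\<in>act R (gr_graph I B). norm (v - v') \<le> C * norm (A - B) * norm v"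
proof -
  obtain K where K: "K > 0" "\<And>(A::complex^'n^'n) x. norm (A *v x) \<le> norm A * norm x * K"
    using matrix_vector_mult_norm_bound by blast
  define l where "l A = graph_mat I A - mat 1" for A :: "complex^('n \<times> 'n)"
  have "linear l" by (intro linearI) (auto simp: l_def graph_mat_def mat_def vec_eq_iff)
  then have "bounded_linear l" by (simp add: linear_conv_bounded_linear)
  then obtain L where L: "L > 0" "\<And>A. norm (l A) \<le> norm A * L" using bounded_linear.pos_bounded by blast
  define C where "C = 1 + norm R * K * (L * K) * (norm (matrix_inv R) * K)"
  have C: "C > 0" unfolding C_def using K L by (intro add_pos_nonneg mult_nonneg_nonneg) auto
  show ?thesis
  proof (rule that[OF C])
    fix A B v assume "v \<in> act R (gr_graph I A)"
    then obtain x where x: "x \<in> coord_space I" "v = R *v (graph_mat I A *v x)"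
      by (auto simp: gr_graph_eq_act act_def)
    let ?v' = "R *v (graph_mat I B *v x)"
    have "?v' \<in> act R (gr_graph I B)" using x(1) by (auto simp: gr_graph_eq_act act_def)
    moreover have "norm (v - ?v') \<le> C * norm (A - B) * norm v"
    proof -
      have "l (A - B) = graph_mat I A - graph_mat I B"
        using linear_diff[OF \<open>linear l\<close>, of A B] by (simp add: l_def)
      then have "v - ?v' = R *v (l (A - B) *v x)"
        by (simp add: x(2) matrix_vector_mult_diff_distrib matrix_vector_mult_diff_rdistrib)
      then have "norm (v - ?v') \<le> norm R * norm (l (A - B) *v x) * K" using K(2) by simp
      also have "\<dots> \<le> norm R * (norm (l (A - B)) * norm x * K) * K"
        using K by (intro mult_right_mono mult_left_mono) auto
      also have "\<dots> \<le> norm R * ((norm (A - B) * L) * norm x * K) * K"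
        using K L by (intro mult_right_mono mult_left_mono) auto
      also have "\<dots> \<le> norm R * ((norm (A - B) * L) * (norm (matrix_inv R) * norm v * K) * K) * K"
      proof -
        have "norm x \<le> norm (graph_mat I A *v x)"
        proof (rule norm_le_componentwise_cart)
          fix i show "norm (x $ i) \<le> norm ((graph_mat I A *v x) $ i)"
            using x(1) by (cases "i \<in> I") (auto simp: graph_mat_mv coord_space_def)
        qed
        also have "graph_mat I A *v x = matrix_inv R *v v" using R by (simp add: x(2))
        also have "norm \<dots> \<le> norm (matrix_inv R) * norm v * K" by (rule K(2))
        finally show ?thesis using K L by (intro mult_right_mono mult_left_mono) auto
      qed
      also have "\<dots> = (norm R * K * (L * K) * (norm (matrix_inv R) * K)) * norm (A - B) * norm v"
        by (simp add: algebra_simps)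
      also have "\<dots> \<le> C * norm (A - B) * norm v"
        unfolding C_def by (intro mult_right_mono) auto
      finally show ?thesis .
    qed
    ultimately show "\<exists>v'\<in>act R (gr_graph I B). norm (v - v') \<le> C * norm (A - B) * norm v" by blast
  qed
qed

lemma diagonal_UU:
  fixes d :: "'p::finite + 'q::finite \<Rightarrow> complex"
  assumes d: "\<And>i. cmod (d i) = 1" "(\<Prod>i\<in>UNIV. d i) = 1"
  shows "(\<chi> i j. if i = j then d i else 0) \<in> UU"
proof -
  let ?X = "(\<chi> i j. if i = j then d i else 0) :: complex^('p + 'q)^('p + 'q)"
  have cd: "cnj (d i) * d i = 1" for i using complex_norm_square[of "d i"] d(1)[of i] by (simp add: mult.commute)
  have X: "(M ** ?X) $ i $ j = M $ i $ j * d j" "(cadj ?X ** M) $ i $ j = cnj (d i) * M $ i $ j" for M i j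
    by (simp_all add: matrix_matrix_mult_def cadj_def mult_delta_left mult_delta_right if_distrib[of cnj] cong: if_cong)
  have "cadj ?X ** ?X = mat 1" by (simp only: vec_eq_iff X) (auto simp: mat_def cd cadj_def)
  moreover have "cadj ?X ** E_mat ** ?X = E_mat"
    by (simp only: vec_eq_iff X) (auto simp: E_mat_entry cd mult.assoc mult.left_commute)
  moreover have "det ?X = 1" by (subst det_diagonal) (simp_all add: d(2))
  ultimately show ?thesis by (simp add: UU_def)
qed

text \<open>Multiplication by \<open>cis \<theta>\<close> on the positive block has determinant
  \<open>cis (p * \<theta>)\<close>. The scalar \<open>cis (- \<theta> * p / n)\<close> corrects
  this without affecting the action on subspaces.\<close>

lemma circle_UU:
  obtains c where "c \<noteq> 0" "mat c ** (mat 1 + mat (cis \<theta> - 1) ** prp) \<in> (UU :: (complex^('p::finite + 'q::finite)^('p + 'q)) set)"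
proof -
  let ?n = "real CARD('p + 'q)" let ?p = "real CARD('p)"
  define c where "c = cis (- \<theta> * ?p / ?n)"
  define d where "d i = (case i of Inl _ \<Rightarrow> c * cis \<theta> | Inr _ \<Rightarrow> c)" for i :: "'p + 'q"
  have "(\<Prod>i\<in>UNIV. d i) = (c * cis \<theta>) ^ CARD('p) * c ^ CARD('q)"
    by (simp add: UNIV_Plus_UNIV[symmetric] prod.Plus d_def del: UNIV_Plus_UNIV)
  also have "\<dots> = c ^ CARD('p + 'q) * cis \<theta> ^ CARD('p)"
    by (simp add: power_mult_distrib power_add)
  also have "\<dots> = cis (?n * (- \<theta> * ?p / ?n)) * cis (?p * \<theta>)" by (simp only: c_def Complex.DeMoivre)
  also have "?n * (- \<theta> * ?p / ?n) = - (?p * \<theta>)"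
  proof -
    have "?n > 0" by (rule of_nat_0_less_iff[THEN iffD2]) (rule zero_less_card_finite)
    then show ?thesis by (simp add: field_simps del: card_sum)
  qed
  also have "cis (- (?p * \<theta>)) * cis (?p * \<theta>) = 1" by (simp add: cis_mult)
  finally have pr: "(\<Prod>i\<in>UNIV. d i) = 1" .
  have "cmod (d i) = 1" for i by (auto simp: d_def c_def norm_mult split: sum.splits)
  from diagonal_UU[OF this pr] have "(\<chi> i j. if i = j then d i else 0) \<in> UU" .
  also have "(\<chi> i j. if i = j then d i else 0) = mat c ** (mat 1 + mat (cis \<theta> - 1) ** prp)"
  proof -
    have "(if i = j then d i else 0) = (mat c ** (mat 1 + mat (cis \<theta> - 1) ** prp)) $ i $ j" for i j
      unfolding mat_mult_entry vector_add_component
      by (cases i) (auto simp: d_def prp_def mat_def algebra_simps)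
    then show ?thesis unfolding vec_eq_iff vec_lambda_beta by blast
  qed
  finally show ?thesis by (intro that[of c]) (simp add: c_def)
qed

text \<open>Two curves through \<open>V\<close> with the same velocity are compared: one inside
  \<open>C0\<close>, along which the trace is constant, and the flow \<open>1 + t P'\<close>, along
  which it grows at least linearly. Their distance is of smaller order than \<open>t\<close>, a
  contradiction. The first curve exists because the tangent space of \<open>C0\<close> is complex
  and contains the velocity of the circle action, a multiple of that of the flow.\<close>

lemma complex_orbit_split:
  fixes V :: "(complex^('p::finite + 'q::finite)) set"
  assumes T: "cadj T ** E_mat ** T = E_mat" and V: "V \<in> flag_domain r r'"
    and C0: "C0 = {act k V | k. k \<in> (\<lambda>u. T ** u ** matrix_inv T) ` UU}"
    and sm: "gr_complex_submanifold (r + r') C0"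
  shows "split_space (act (matrix_inv T) V)"
proof (rule ccontr)
  let ?k = "r + r'" let ?R = "matrix_inv T"
  define S where "S = act ?R V"
  assume "\<not> split_space (act (matrix_inv T) V)"
  then have ns: "\<not> split_space S" by (simp add: S_def)
  note iT = invertible_preserves_herm[OF T]
  have VGr: "V \<in> Gr ?k" using V by (simp add: flag_domain_def)
  then have subV: "vec.subspace V" by (simp add: Gr_def)
  then have subS: "vec.subspace S" by (simp add: S_def subspace_act)
  obtain P g where P: "is_oproj P S" and g: "g > 0" and flow:
    "\<And>t. 0 < t \<Longrightarrow> t \<le> (1::real) \<Longrightarrow> \<exists>Q. is_oproj Q (act (mat 1 + mat (of_real t) ** prp) S) \<and> ptrace Q \<ge> ptrace P + g * t"
    using ptrace_flow[OF subS ns] by metis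
  have "mat 1 \<in> UU" by (simp add: UU_def)
  then have "T ** mat 1 ** ?R \<in> (\<lambda>u. T ** u ** ?R) ` UU" by (rule imageI)
  then have "act (T ** mat 1 ** ?R) V \<in> C0" unfolding C0 by blast
  then have VC: "V \<in> C0" using iT by (simp add: matrix_inv_right)
  obtain q where "\<forall>V\<in>C0. \<exists>U F \<rho>. openin (gr_topology ?k) U \<and> \<rho> > 0 \<and> F (\<lambda>_. 0) = V \<and>
      gr_holomorphic_on ?k q F (open_polydisk q \<rho>) \<and>
      (\<forall>z\<in>open_polydisk q \<rho>. gr_differential_rank ?k q F z q) \<and>
      homeomorphic_map (top_of_set (open_polydisk q \<rho>)) (subtopology (gr_topology ?k) (C0 \<inter> U)) F"
    using sm unfolding gr_complex_submanifold_def by blast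
  from bspec[OF this VC] obtain U F \<rho> where U: "openin (gr_topology ?k) U" and \<rho>: "\<rho> > 0" and F0: "F (\<lambda>_. 0) = V"
    and rk: "\<forall>z\<in>open_polydisk q \<rho>. gr_differential_rank ?k q F z q"
    and hom: "homeomorphic_map (top_of_set (open_polydisk q \<rho>)) (subtopology (gr_topology ?k) (C0 \<inter> U)) F"
    by (elim exE conjE)
  let ?B = "open_polydisk q \<rho>"
  have zB: "(\<lambda>_. 0) \<in> ?B" using \<rho> by (simp add: open_polydisk_def cspace_def)
  have C0Gr: "C0 \<subseteq> Gr ?k" using sm by (simp add: gr_complex_submanifold_def)
  have FB: "F z \<in> C0 \<inter> U" if "z \<in> ?B" for z
    using homeomorphic_imp_surjective_map[OF hom] that C0Gr by (auto simp: topspace_gr_topology)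
  obtain I D where I: "card I = ?k" and dom: "V \<in> gr_chart_dom I"
    and hcd: "has_complex_derivative q (gr_coord I \<circ> F) D (\<lambda>_. 0)" and dimD: "vec.dim (D ` {..<q}) = q"
    using bspec[OF rk zB] unfolding gr_differential_rank_def F0 by blast
  obtain A where VA: "V = gr_graph I A" using dom by (auto simp: gr_chart_dom_def)
  obtain M where M: "M > 0" "\<And>z. (\<Sum>i<q. cmod (z i)) \<le> M * norm (\<Sum>i<q. z i *s D i)"
    using independent_lower_bound[OF dimD] by blast
  define P' where "P' = T ** prp ** ?R"
  define \<kappa> where "\<kappa> = chart_deriv I A P'"
  have flowT: "act ?R (act (mat 1 + mat s ** P') V) = act (mat 1 + mat s ** prp) S" for s
  proof -
    have "?R ** (mat 1 + mat s ** P') = (mat 1 + mat s ** prp) ** ?R"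
    proof -
      have "?R ** (mat s ** P') = mat s ** (?R ** P')" by (metis matrix_mul_assoc mult_mat_commute)
      also have "?R ** P' = prp ** ?R" using iT by (simp add: P'_def matrix_mul_assoc matrix_inv_left)
      finally show ?thesis by (simp add: matrix_add_ldistrib matrix_add_rdistrib matrix_mul_assoc)
    qed
    then show ?thesis by (simp add: S_def act_mult[symmetric])
  qed
  have circ: "act (mat 1 + mat (cis \<theta> - 1) ** P') V \<in> C0" for \<theta>
  proof -
    let ?d = "mat 1 + mat (cis \<theta> - 1) ** prp :: complex^('p + 'q)^('p + 'q)"
    obtain c where c: "c \<noteq> 0" "mat c ** ?d \<in> UU" using circle_UU by blast
    have "act (T ** (mat c ** ?d) ** ?R) V \<in> C0" unfolding C0 using c(2) by blast
    also have "act (T ** (mat c ** ?d) ** ?R) V = act T (act (mat c) (act ?d S))" by (simp add: act_mult S_def)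
    also have "\<dots> = act T (act ?R (act (mat 1 + mat (cis \<theta> - 1) ** P') V))"
      using c(1) by (simp add: act_mat subspace_act subS flowT)
    finally show ?thesis using iT by simp
  qed
  \<comment> \<open>The parametrisation is open onto a neighbourhood of \<open>V\<close> in
    \<open>C0\<close>, so points of \<open>C0\<close> near \<open>V\<close> on the curve have small
    parameters. Together with the lower bound \<open>M\<close> this replaces an inverse function
    theorem.\<close>
  have param: "\<exists>d>0. \<forall>s. cmod s < d \<and> act (mat 1 + mat s ** P') V \<in> C0 \<longrightarrow>
      (\<exists>z\<in>?B. (\<forall>i<q. cmod (z i) < \<epsilon>) \<and> F z = act (mat 1 + mat s ** P') V)" if \<epsilon>: "\<epsilon> > 0" for \<epsilon>
  proof -
    let ?N = "?B \<inter> {z. \<forall>i\<in>{..<q}. cmod (z i) < \<epsilon>}"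
    have "{z :: nat \<Rightarrow> complex. \<forall>i\<in>{..<q}. cmod (z i) < \<epsilon>} = (\<Inter>i\<in>{..<q}. {z. cmod (z i) < \<epsilon>})"
      by auto
    moreover have "open {z :: nat \<Rightarrow> complex. cmod (z i) < \<epsilon>}" for i
      by (intro open_Collect_less continuous_intros continuous_on_product_coordinates)
    ultimately have "open {z :: nat \<Rightarrow> complex. \<forall>i\<in>{..<q}. cmod (z i) < \<epsilon>}"
      by (simp add: open_INT)
    then have "openin (top_of_set ?B) ?N" by (rule openin_open_Int)
    then have "openin (subtopology (gr_topology ?k) (C0 \<inter> U)) (F ` ?N)"
      using homeomorphic_imp_open_map[OF hom] by (simp add: open_map_def)
    then obtain W where W: "openin (gr_topology ?k) W" "F ` ?N = W \<inter> (C0 \<inter> U)"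
      unfolding openin_subtopology by blast
    have "(\<lambda>_. 0) \<in> ?N" using zB \<epsilon> by simp
    then have "F (\<lambda>_. 0) \<in> F ` ?N" by (rule imageI)
    then have "V \<in> F ` ?N" by (simp only: F0)
    then have "V \<in> W \<inter> U" using W(2) by blast
    from eventually_act_openin_gr[OF openin_Int[OF W(1) U] this]
    obtain d where d: "d > 0" "\<And>y::complex^('p + 'q)^('p + 'q). dist y (mat 1) < d \<Longrightarrow> act y V \<in> W \<inter> U"
      unfolding eventually_nhds_metric by blast
    define n where "n = norm P' + 1"
    have n: "n > 0" by (simp add: n_def add_nonneg_pos)
    show ?thesis
    proof (intro exI[of _ "d / n"] conjI allI impI)
      show "d / n > 0" using d n by simp
      fix s assume s: "cmod s < d / n \<and> act (mat 1 + mat s ** P') V \<in> C0"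
      have "dist (mat 1 + mat s ** P') (mat 1) \<le> cmod s * n"
        by (simp add: dist_norm norm_mat_mult n_def mult_left_mono)
      also have "\<dots> < d" using s n by (simp add: field_simps)
      finally have "act (mat 1 + mat s ** P') V \<in> F ` ?N" using d(2) s W(2) by blast
      then show "\<exists>z\<in>?B. (\<forall>i<q. cmod (z i) < \<epsilon>) \<and> F z = act (mat 1 + mat s ** P') V" by auto
    qed
  qed
  have hcd': "\<exists>\<delta>>0. \<forall>z\<in>cspace q. (\<Sum>i<q. cmod (z i)) < \<delta> \<longrightarrow>
      norm (gr_coord I (F z) - gr_coord I V - (\<Sum>i<q. z i *s D i)) \<le> \<epsilon> * (\<Sum>i<q. cmod (z i))" if "\<epsilon> > 0" for \<epsilon>
    using hcd that unfolding has_complex_derivative_def by (simp add: F0)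
  text \<open>The derivative of the circle orbit, divided by \<open>i\<close>, is tangent to the complex manifold \<open>C0\<close>.\<close>
  let ?Rg = "range (\<lambda>a. \<Sum>i<q. a i *s D i)"
  have "vec.subspace ?Rg"
    unfolding vec.subspace_def
  proof (intro conjI ballI allI)
    show "0 \<in> ?Rg" by (rule image_eqI[of _ _ "\<lambda>_. 0"]) simp_all
    fix x y assume "x \<in> ?Rg" "y \<in> ?Rg"
    then obtain a b where "x = (\<Sum>i<q. a i *s D i)" "y = (\<Sum>i<q. b i *s D i)" by blast
    then show "x + y \<in> ?Rg"
      by (intro image_eqI[of _ _ "\<lambda>i. a i + b i"]) (simp_all add: vec.scale_left_distrib sum.distrib)
  next
    fix c x assume "x \<in> ?Rg"
    then obtain a where "x = (\<Sum>i<q. a i *s D i)" by blast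
    then show "c *s x \<in> ?Rg"
      by (intro image_eqI[of _ _ "\<lambda>i. c * a i"]) (simp_all add: vec.scale_sum_right vector_smult_assoc)
  qed
  then have clR: "closed ?Rg" by (rule closed_vec_subspace)
  have "\<exists>w\<in>?Rg. dist w \<kappa> < \<eta>" if \<eta>: "\<eta> > 0" for \<eta>
  proof -
    define N where "N = norm \<kappa> + 1"
    have N: "N > 0" by (simp add: N_def add_nonneg_pos)
    \<comment> \<open>\<open>e1\<close> controls the expansion of the circle in the chart,
      \<open>e2\<close> that of the parametrisation. The bound \<open>e2 * M \<le> 1 / 2\<close>
      first yields \<open>norm w \<le> 2 * N * cmod s\<close>; after that each error contributes at
      most \<open>\<eta> / 4 * cmod s\<close>.\<close>
    define e1 where "e1 = min 1 (\<eta> / 4)"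
    have e1: "e1 > 0" "e1 \<le> 1" "e1 \<le> \<eta> / 4" using \<eta> by (auto simp: e1_def)
    define e2 where "e2 = min (1 / (2 * M)) (\<eta> / (8 * M * N))"
    have e2: "e2 > 0" using \<eta> M N by (simp add: e2_def)
    have e2M: "e2 * M \<le> 1 / 2" "e2 * M * (2 * N) \<le> \<eta> / 4"
    proof -
      have "e2 * M \<le> 1 / (2 * M) * M" using M by (intro mult_right_mono) (auto simp: e2_def)
      then show "e2 * M \<le> 1 / 2" using M by simp
      have "e2 * (M * (2 * N)) \<le> \<eta> / (8 * M * N) * (M * (2 * N))" using M N by (intro mult_right_mono) (auto simp: e2_def)
      also have "\<dots> = \<eta> / 4" using M N by (simp add: field_simps)
      finally show "e2 * M * (2 * N) \<le> \<eta> / 4" by (simp add: mult.assoc)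
    qed
    obtain d1 where d1: "d1 > 0" "\<And>s. cmod s < d1 \<Longrightarrow> act (mat 1 + mat s ** P') V \<in> gr_chart_dom I \<and>
        norm (gr_coord I (act (mat 1 + mat s ** P') V) - gr_coord I V - s *s \<kappa>) \<le> e1 * cmod s"
      using chart_first_order[OF VA e1(1), of P'] unfolding \<kappa>_def by blast
    obtain \<delta> where \<delta>: "\<delta> > 0" "\<And>z. z \<in> cspace q \<Longrightarrow> (\<Sum>i<q. cmod (z i)) < \<delta> \<Longrightarrow>
        norm (gr_coord I (F z) - gr_coord I V - (\<Sum>i<q. z i *s D i)) \<le> e2 * (\<Sum>i<q. cmod (z i))"
      using hcd'[OF e2] by blast
    \<comment> \<open>The \<open>+ 1\<close> covers \<open>q = 0\<close> and makes the sum of the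
      \<open>q\<close> bounds strictly smaller than \<open>\<delta>\<close>.\<close>
    obtain d2 where d2: "d2 > 0" "\<And>s. cmod s < d2 \<Longrightarrow> act (mat 1 + mat s ** P') V \<in> C0 \<Longrightarrow>
        \<exists>z\<in>?B. (\<forall>i<q. cmod (z i) < \<delta> / (real q + 1)) \<and> F z = act (mat 1 + mat s ** P') V"
      using param[of "\<delta> / (real q + 1)"] \<delta>(1) by (auto simp: add_nonneg_pos)
    have "isCont (\<lambda>\<theta>. exp (\<i> * complex_of_real \<theta>)) 0" by (intro continuous_intros)
    then have "cis \<midarrow>0\<rightarrow> cis 0" by (simp add: isCont_def cis_conv_exp[symmetric])
    moreover have "min d1 d2 > 0" using d1 d2 by simp
    ultimately have "\<exists>d>0. \<forall>\<theta>. \<theta> \<noteq> 0 \<and> dist \<theta> 0 < d \<longrightarrow> dist (cis \<theta>) (cis 0) < min d1 d2"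
      unfolding LIM_def by blast
    then obtain d3 where d3: "d3 > 0" "\<And>\<theta>. \<theta> \<noteq> 0 \<Longrightarrow> dist \<theta> 0 < d3 \<Longrightarrow> dist (cis \<theta>) (cis 0) < min d1 d2"
      by blast
    \<comment> \<open>The cap at 1 keeps \<open>\<theta>\<close> strictly between 0 and pi, so
      \<open>sin \<theta>\<close> and hence \<open>s\<close> do not vanish.\<close>
    define \<theta> where "\<theta> = min (d3 / 2) 1"
    have \<theta>: "0 < \<theta>" "\<theta> \<le> 1" "\<bar>\<theta>\<bar> < d3" using d3 by (auto simp: \<theta>_def)
    define s where "s = cis \<theta> - 1"
    have "sin \<theta> > 0" using \<theta> pi_gt3 by (intro sin_gt_zero) auto
    then have s0: "s \<noteq> 0" by (auto simp: s_def complex_eq_iff)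
    have sd: "cmod s < d1" "cmod s < d2" using d3(2)[of \<theta>] \<theta> by (simp_all add: s_def dist_norm)
    obtain z where z: "z \<in> ?B" "\<forall>i<q. cmod (z i) < \<delta> / (real q + 1)" "F z = act (mat 1 + mat s ** P') V"
      using d2(2)[OF sd(2)] circ[of \<theta>] by (auto simp: s_def)
    have "(\<Sum>i<q. cmod (z i)) \<le> (\<Sum>i<q. \<delta> / (real q + 1))" using z(2) by (intro sum_mono) (auto intro: less_imp_le)
    also have "\<dots> < \<delta>" using \<delta>(1) by (simp add: field_simps)
    finally have zs: "(\<Sum>i<q. cmod (z i)) < \<delta>" .
    define w where "w = (\<Sum>i<q. z i *s D i)"
    have zc: "z \<in> cspace q" using z(1) by (simp add: open_polydisk_def)
    have b1: "norm (gr_coord I (F z) - gr_coord I V - w) \<le> e2 * (\<Sum>i<q. cmod (z i))"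
      using \<delta>(2)[OF zc zs] by (simp add: w_def)
    have b2: "norm (gr_coord I (F z) - gr_coord I V - s *s \<kappa>) \<le> e1 * cmod s"
      using d1(2)[OF sd(1)] by (simp add: z(3))
    have b3: "(\<Sum>i<q. cmod (z i)) \<le> M * norm w" using M(2)[of z] by (simp add: w_def)
    have diff: "norm (s *s \<kappa> - w) \<le> e1 * cmod s + e2 * M * norm w"
    proof -
      have "s *s \<kappa> - w = (gr_coord I (F z) - gr_coord I V - w) - (gr_coord I (F z) - gr_coord I V - s *s \<kappa>)" by simp
      then have "norm (s *s \<kappa> - w) \<le> norm (gr_coord I (F z) - gr_coord I V - w) + norm (gr_coord I (F z) - gr_coord I V - s *s \<kappa>)"
        by (metis norm_triangle_ineq4)
      moreover have "e2 * (\<Sum>i<q. cmod (z i)) \<le> e2 * (M * norm w)" using b3 e2 by (intro mult_left_mono) auto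
      ultimately show ?thesis using b1 b2 by (simp add: mult.assoc)
    qed
    have nsc: "norm (c *s x) = cmod c * norm x" for c and x :: "complex^(('p + 'q) \<times> ('p + 'q))"
      by (simp add: norm_vec_def L2_set_def norm_mult power_mult_distrib sum_distrib_left[symmetric] real_sqrt_mult)
    have "norm w \<le> 2 * N * cmod s"
    proof -
      have "norm w \<le> norm (s *s \<kappa>) + norm (s *s \<kappa> - w)" by (metis norm_triangle_sub norm_minus_commute)
      also have "\<dots> \<le> cmod s * norm \<kappa> + (1 * cmod s + 1 / 2 * norm w)"
        using diff e1(2) e2M(1) mult_right_mono[OF e1(2), of "cmod s"] mult_right_mono[OF e2M(1), of "norm w"]
        by (simp add: nsc)
      finally show ?thesis by (simp add: N_def algebra_simps)
    qed
    then have "e2 * M * norm w \<le> e2 * M * (2 * N * cmod s)" using e2 M by (intro mult_left_mono) auto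
    also have "\<dots> = (e2 * M * (2 * N)) * cmod s" by simp
    also have "\<dots> \<le> \<eta> / 4 * cmod s" using e2M(2) by (intro mult_right_mono) auto
    finally have "e2 * M * norm w \<le> \<eta> / 4 * cmod s" .
    moreover have "e1 * cmod s \<le> \<eta> / 4 * cmod s" using e1(3) by (intro mult_right_mono) auto
    ultimately have fin: "norm (s *s \<kappa> - w) \<le> \<eta> / 2 * cmod s" using diff by simp
    \<comment> \<open>Dividing by the complex number \<open>s\<close>, which is
      \<open>\<i> * \<theta>\<close> to first order, does not leave \<open>?Rg\<close>: here the
      complex structure of \<open>C0\<close> enters.\<close>
    let ?w = "(1 / s) *s w"
    have "?w \<in> ?Rg" unfolding w_def
      by (rule image_eqI[of _ _ "\<lambda>i. (1 / s) * z i"]) (simp_all add: vec.scale_sum_right vector_smult_assoc)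
    moreover have "dist ?w \<kappa> < \<eta>"
    proof -
      have "\<kappa> - ?w = (1 / s) *s (s *s \<kappa> - w)" using s0 by (simp add: vector_smult_assoc vector_ssub_ldistrib)
      from arg_cong[OF this, of norm] have "norm (\<kappa> - ?w) = 1 / cmod s * norm (s *s \<kappa> - w)"
        by (simp only: nsc norm_divide norm_one)
      also have "\<dots> \<le> \<eta> / 2" using fin s0 by (simp add: field_simps)
      finally show ?thesis using \<eta> by (simp add: dist_norm norm_minus_commute)
    qed
    ultimately show ?thesis by blast
  qed
  then have "\<kappa> \<in> ?Rg" using closed_approachable[OF clR] by blast
  then obtain a where a: "\<kappa> = (\<Sum>i<q. a i *s D i)" by blast
  \<comment> \<open>The real line in the direction \<open>a\<close>. While it stays in the polydisk
    its image under \<open>F\<close> lies in \<open>C0\<close>, and it leaves \<open>V\<close> with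
    the velocity \<open>\<kappa>\<close> of the flow \<open>1 + t P'\<close>.\<close>
  define Z where "Z t i = (if i < q then of_real t * a i else 0)" for t :: real and i :: nat
  define Aa where "Aa = 1 + (\<Sum>i<q. cmod (a i))"
  have Aa: "Aa > 0" unfolding Aa_def by (intro add_pos_nonneg sum_nonneg) auto
  have Zc: "Z t \<in> cspace q" for t by (simp add: Z_def cspace_def)
  have Zs: "(\<Sum>i<q. cmod (Z t i)) \<le> t * Aa" if "t > 0" for t
    using that by (simp add: Z_def norm_mult sum_distrib_left[symmetric] Aa_def)
  have Zi: "cmod (Z t i) \<le> t * Aa" if "t > 0" "i < q" for t i
  proof -
    have "cmod (Z t i) \<le> (\<Sum>i<q. cmod (Z t i))" using that by (intro member_le_sum) auto
    then show ?thesis using Zs[OF that(1)] by linarith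
  qed
  have ZD: "(\<Sum>i<q. Z t i *s D i) = of_real t *s \<kappa>" for t
    by (simp add: Z_def a vec.scale_sum_right vector_smult_assoc)
  have ZB: "Z t \<in> ?B" if "t > 0" "t * Aa < \<rho>" for t
    using Zi[OF that(1)] that Zc by (force simp: open_polydisk_def)
  have chart: "\<exists>t1>0. \<forall>t. 0 < t \<and> t < t1 \<and> Z t \<in> ?B \<longrightarrow> F (Z t) \<in> gr_chart_dom I"
  proof -
    let ?W = "Gr ?k \<inter> gr_chart_dom I :: (complex^('p + 'q)) set set"
    have "openin (gr_topology ?k) ?W"
      unfolding openin_gr_topology_act
    proof (intro conjI ballI)
      fix X assume X: "X \<in> ?W"
      then obtain B where B: "X = gr_graph I B" by (auto simp: gr_chart_dom_def)
      show "\<forall>\<^sub>F y in nhds (mat 1). act y X \<in> ?W"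
        using eventually_invertible_nhds[OF invertible_mat_1] eventually_act_chart[of I B]
        by eventually_elim (use X B act_Gr in auto)
    qed simp
    then have "openin (subtopology (gr_topology ?k) (C0 \<inter> U)) (?W \<inter> (C0 \<inter> U))"
      unfolding openin_subtopology by blast
    from openin_continuous_map_preimage[OF homeomorphic_imp_continuous_map[OF hom] this]
    obtain Q where Q: "open Q" "{z \<in> ?B. F z \<in> ?W \<inter> (C0 \<inter> U)} = ?B \<inter> Q"
      by (auto simp: openin_open)
    have "F (\<lambda>_. 0) \<in> ?W \<inter> (C0 \<inter> U)" using FB[OF zB] dom VGr by (simp add: F0)
    then have "(\<lambda>_. 0) \<in> Q" using Q(2) zB by blast
    moreover have "Z 0 = (\<lambda>_. 0)" by (simp add: Z_def fun_eq_iff)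
    ultimately have ZQ: "0 \<in> Z -` Q" by simp
    have "continuous_on UNIV Z"
    proof (rule continuous_on_coordinatewise_then_product)
      fix i show "continuous_on UNIV (\<lambda>t. Z t i)"
        unfolding Z_def by (cases "i < q") (auto intro!: continuous_intros)
    qed
    then have "open (Z -` Q)" using Q(1) by (simp add: continuous_on_open_vimage)
    then obtain t1 where t1: "t1 > 0" "ball 0 t1 \<subseteq> Z -` Q"
      using ZQ openE by blast
    have "F (Z t) \<in> gr_chart_dom I" if "0 < t" "t < t1" "Z t \<in> ?B" for t
    proof -
      have "t \<in> ball 0 t1" using that by (simp add: dist_real_def)
      then have "Z t \<in> ?B \<inter> Q" using t1 that by blast
      then show ?thesis using Q(2) by blast
    qed
    then show ?thesis using t1(1) by blast
  qed
  then obtain t1 where t1: "t1 > 0" "\<And>t. 0 < t \<Longrightarrow> t < t1 \<Longrightarrow> Z t \<in> ?B \<Longrightarrow> F (Z t) \<in> gr_chart_dom I" by blast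
  obtain G where G: "G > 0" "\<And>A B v. v \<in> act ?R (gr_graph I A) \<Longrightarrow>
    \<exists>v'\<in>act ?R (gr_graph I B). norm (v - v') \<le> G * norm (A - B) * norm v"
    using graph_gap[OF invertible_matrix_inv[OF iT]] by metis
  let ?p = "real CARD('p)"
  have p: "?p > 0" by simp
  \<comment> \<open>Two chart errors \<open>\<eta> * t\<close>, multiplied by \<open>G\<close>,
    doubled by the projection estimate and summed over the positive diagonal entries, give
    \<open>4 * ?p * G * \<eta> * t = g * t / 2\<close>, half of the growth along the flow.\<close>
  define \<eta> where "\<eta> = g / (8 * ?p * G)"
  have \<eta>: "\<eta> > 0" using g p G by (simp add: \<eta>_def)
  obtain d1 where d1: "d1 > 0" "\<And>s. cmod s < d1 \<Longrightarrow> act (mat 1 + mat s ** P') V \<in> gr_chart_dom I \<and>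
      norm (gr_coord I (act (mat 1 + mat s ** P') V) - gr_coord I V - s *s \<kappa>) \<le> \<eta> * cmod s"
    using chart_first_order[OF VA \<eta>, of P'] unfolding \<kappa>_def by blast
  have \<eta>A: "\<eta> / Aa > 0" using \<eta> Aa by simp
  obtain \<delta> where \<delta>: "\<delta> > 0" "\<And>z. z \<in> cspace q \<Longrightarrow> (\<Sum>i<q. cmod (z i)) < \<delta> \<Longrightarrow>
      norm (gr_coord I (F z) - gr_coord I V - (\<Sum>i<q. z i *s D i)) \<le> \<eta> / Aa * (\<Sum>i<q. cmod (z i))"
    using hcd'[OF \<eta>A] by blast
  define t where "t = min (min (d1 / 2) (t1 / 2)) (min (min (\<delta> / (2 * Aa)) (\<rho> / (2 * Aa))) 1)"
  have t: "t > 0" "t \<le> 1" "t < d1" "t < t1" "t * Aa < \<delta>" "t * Aa < \<rho>"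
  proof -
    show "t > 0" using d1 t1 \<delta> \<rho> Aa by (simp add: t_def)
    show "t \<le> 1" by (simp add: t_def)
    have "t \<le> d1 / 2" "t \<le> t1 / 2" "t \<le> \<delta> / (2 * Aa)" "t \<le> \<rho> / (2 * Aa)" by (auto simp: t_def min_le_iff_disj)
    then have "t \<le> d1 / 2" "t \<le> t1 / 2" "2 * (t * Aa) \<le> \<delta>" "2 * (t * Aa) \<le> \<rho>" using Aa by (auto simp: field_simps)
    then show "t < d1" "t < t1" "t * Aa < \<delta>" "t * Aa < \<rho>" using d1 t1 \<delta> \<rho> by linarith+
  qed
  note ZtB = ZB[OF t(1,6)]
  obtain B1 where B1: "F (Z t) = gr_graph I B1" using t1(2)[OF t(1,4) ZtB] by (auto simp: gr_chart_dom_def)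
  have "cmod (of_real t) < d1" using t by simp
  note d1' = d1(2)[OF this]
  obtain B2 where B2: "act (mat 1 + mat (of_real t) ** P') V = gr_graph I B2" using d1' by (auto simp: gr_chart_dom_def)
  have gg: "gr_graph I (gr_coord I (gr_graph I B)) = gr_graph I B" for B
    unfolding gr_coord_graph unfolding gr_graph_def
    by (intro Collect_cong all_cong sum.cong refl arg_cong2[where f="(=)"]) auto
  define A1 where "A1 = gr_coord I (F (Z t))"
  define A2 where "A2 = gr_coord I (act (mat 1 + mat (of_real t) ** P') V)"
  have A1: "F (Z t) = gr_graph I A1" by (simp add: A1_def B1 gg)
  have A2: "act (mat 1 + mat (of_real t) ** P') V = gr_graph I A2" unfolding A2_def B2 gg ..
  have nA: "norm (A1 - A2) \<le> 2 * \<eta> * t"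
  proof -
    have "norm (A1 - gr_coord I V - of_real t *s \<kappa>) \<le> \<eta> / Aa * (\<Sum>i<q. cmod (Z t i))"
      using \<delta>(2)[OF Zc[of t]] Zs[OF t(1)] t(5) by (simp add: A1_def ZD)
    also have "\<dots> \<le> \<eta> / Aa * (t * Aa)" using Zs[OF t(1)] \<eta>A by (intro mult_left_mono) auto
    also have "\<dots> = \<eta> * t" using Aa by simp
    finally have "norm (A1 - gr_coord I V - of_real t *s \<kappa>) \<le> \<eta> * t" .
    moreover have "norm (A2 - gr_coord I V - of_real t *s \<kappa>) \<le> \<eta> * t" using d1' t by (simp add: A2_def)
    moreover have "A1 - A2 = (A1 - gr_coord I V - of_real t *s \<kappa>) - (A2 - gr_coord I V - of_real t *s \<kappa>)" by simp
    then have "norm (A1 - A2) \<le> norm (A1 - gr_coord I V - of_real t *s \<kappa>) + norm (A2 - gr_coord I V - of_real t *s \<kappa>)"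
      by (metis norm_triangle_ineq4)
    ultimately show ?thesis by simp
  qed
  obtain u where u: "u \<in> UU" "F (Z t) = act (T ** u ** ?R) V" using FB[OF ZtB] unfolding C0 by blast
  have RF: "act ?R (F (Z t)) = act u S" unfolding u(2) by (simp add: act_mult S_def iT)
  define P1 where "P1 = u ** P ** cadj u"
  have P1: "is_oproj P1 (act ?R (gr_graph I A1))" "ptrace P1 = ptrace P"
    using ptrace_UU[OF u(1) P] by (simp_all add: P1_def RF[symmetric] A1[symmetric])
  obtain Q where Q: "is_oproj Q (act (mat 1 + mat (of_real t) ** prp) S)" "ptrace Q \<ge> ptrace P + g * t"
    using flow[OF t(1,2)] by blast
  have Q': "is_oproj Q (act ?R (gr_graph I A2))" using Q(1) by (simp only: A2[symmetric] flowT)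
  define gp where "gp = G * norm (A1 - A2)"
  have "norm (P1 *v x - Q *v x) \<le> 2 * gp * norm x" for x
  proof (rule is_oproj_gap[OF P1(1) Q'])
    show "\<exists>v'\<in>act ?R (gr_graph I A2). norm (v - v') \<le> gp * norm v" if "v \<in> act ?R (gr_graph I A1)" for v
      using G(2)[OF that, of A2] by (simp add: gp_def)
    show "\<exists>v'\<in>act ?R (gr_graph I A1). norm (v - v') \<le> gp * norm v" if "v \<in> act ?R (gr_graph I A2)" for v
      using G(2)[OF that, of A1] by (simp add: gp_def norm_minus_commute)
    show "gp \<ge> 0" using G by (simp add: gp_def)
  qed
  from ptrace_diff[OF this] have "\<bar>ptrace P1 - ptrace Q\<bar> \<le> ?p * (2 * gp)" .
  also have "\<dots> \<le> ?p * (2 * (G * (2 * \<eta> * t)))"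
    unfolding gp_def using nA G by (intro mult_left_mono) auto
  also have "\<dots> = g * t / 2" using p G by (simp add: \<eta>_def field_simps)
  finally have "\<bar>ptrace P1 - ptrace Q\<bar> \<le> g * t / 2" .
  moreover have "g * t > 0" using g t by simp
  ultimately show False using Q(2) P1(2) by linarith
qed

section \<open>Cycles through coordinate subspaces\<close>

lemma flag_domainI:
  assumes "V \<in> Gr (r + r')" "vec.subspace A" "vec.subspace B" "A \<subseteq> V" "B \<subseteq> V" "vec.dim A = r" "vec.dim B = r'"
    "pos_on A" "neg_on B"
  shows "V \<in> flag_domain r r'"
  unfolding flag_domain_iff using assms by blast

lemma coord_space_mono: "I \<subseteq> J \<Longrightarrow> coord_space I \<subseteq> coord_space J"
  by (auto simp: coord_space_def)

lemma not_eventually_nhds_sequence: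
  fixes a :: "'a::metric_space"
  assumes "\<not> (\<forall>\<^sub>F y in nhds a. P y)"
  obtains Y where "Y \<longlonglongrightarrow> a" "\<And>m. \<not> P (Y m)"
proof -
  have "\<exists>y. dist y a < inverse (real (Suc m)) \<and> \<not> P y" for m
    using assms unfolding eventually_nhds_metric by (metis inverse_positive_iff_positive of_nat_0_less_iff zero_less_Suc)
  then obtain Y where Y: "\<And>m. dist (Y m) a < inverse (real (Suc m))" "\<And>m. \<not> P (Y m)" by metis
  have "(\<lambda>m. dist (Y m) a) \<longlonglongrightarrow> 0"
    by (rule tendsto_sandwich[OF _ _ tendsto_const LIMSEQ_inverse_real_of_nat])
      (auto intro!: always_eventually less_imp_le Y(1) simp del: of_nat_Suc)
  then have "Y \<longlonglongrightarrow> a" by (rule tendsto_dist_iff[THEN iffD2])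
  with Y(2) that show ?thesis by blast
qed

lemma continuous_on_herm_mult:
  "continuous_on S f \<Longrightarrow> continuous_on S g \<Longrightarrow> continuous_on S (\<lambda>x. Re (herm (f x) (g x)))"
  unfolding herm_cip by (intro continuous_intros)

lemma tendsto_herm:
  fixes x :: "complex^('p::finite + 'q::finite)"
  assumes "(f \<longlongrightarrow> x) F" shows "((\<lambda>m. Re (herm (f m) (f m))) \<longlongrightarrow> Re (herm x x)) F"
proof -
  have "continuous_on UNIV (\<lambda>x :: complex^('p + 'q). Re (herm x x))"
    by (intro continuous_on_herm_mult continuous_on_id)
  then have "isCont (\<lambda>x. Re (herm x x)) x" by (simp add: continuous_on_eq_continuous_at)
  then show ?thesis by (rule isCont_tendsto_compose[OF _ assms])
qed

text \<open>If this failed arbitrarily close to the identity, unit vectors of \<open>A\<close>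
  violating it would accumulate at a unit vector of \<open>A\<close> that violates definiteness
  itself. The factor \<open>\<sigma>\<close> treats both signs at once.\<close>

lemma eventually_definite:
  fixes A :: "(complex^('p::finite + 'q::finite)) set"
  assumes A: "vec.subspace A" and s: "\<forall>w\<in>A. w \<noteq> 0 \<longrightarrow> \<sigma> * Re (herm w w) > (0::real)"
  shows "\<forall>\<^sub>F y in nhds (mat 1). \<forall>w\<in>act y A. w \<noteq> 0 \<longrightarrow> \<sigma> * Re (herm w w) > 0"
proof (rule ccontr)
  assume "\<not> (\<forall>\<^sub>F y in nhds (mat 1). \<forall>w\<in>act y A. w \<noteq> 0 \<longrightarrow> \<sigma> * Re (herm w w) > 0)"
  then obtain Y where Y: "Y \<longlonglongrightarrow> (mat 1 :: complex^('p + 'q)^('p + 'q))"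
    "\<And>m. \<not> (\<forall>w\<in>act (Y m) A. w \<noteq> 0 \<longrightarrow> \<sigma> * Re (herm w w) > 0)"
    using not_eventually_nhds_sequence by blast
  have "\<exists>x\<in>A. norm x = 1 \<and> \<sigma> * Re (herm (Y m *v x) (Y m *v x)) \<le> 0" for m
  proof -
    obtain x where x: "x \<in> A" "Y m *v x \<noteq> 0" "\<sigma> * Re (herm (Y m *v x) (Y m *v x)) \<le> 0"
      using Y(2)[of m] by (auto simp: act_def not_less)
    then have x0: "x \<noteq> 0" by auto
    let ?x = "(1 / norm x) *\<^sub>R x"
    have "?x \<in> A" using x A by (simp add: subspace_scale vec_subspace_imp_subspace)
    moreover have "norm ?x = 1" using x0 by simp
    moreover have "Re (herm (Y m *v ?x) (Y m *v ?x)) = (1 / norm x)\<^sup>2 * Re (herm (Y m *v x) (Y m *v x))"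
      by (simp add: herm_cip scaleR_eq_scale vec.scale cip_scale_left cip_scale_right power2_eq_square del: of_real_divide flip: of_real_mult)
    then have "\<sigma> * Re (herm (Y m *v ?x) (Y m *v ?x)) = (1 / norm x)\<^sup>2 * (\<sigma> * Re (herm (Y m *v x) (Y m *v x)))"
      by (simp only: ac_simps)
    then have "\<sigma> * Re (herm (Y m *v ?x) (Y m *v ?x)) \<le> 0" using x(3)
      by (simp only: mult_le_0_iff) (simp add: x(3))
    ultimately show ?thesis by blast
  qed
  then obtain X where X: "\<And>m. X m \<in> A" "\<And>m. norm (X m) = 1" "\<And>m. \<sigma> * Re (herm (Y m *v X m) (Y m *v X m)) \<le> 0"
    by metis
  have "compact (A \<inter> sphere 0 1)" using closed_vec_subspace[OF A] by (intro closed_Int_compact) auto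
  then obtain x \<phi> where x: "x \<in> A \<inter> sphere 0 1" "strict_mono \<phi>" "(X \<circ> \<phi>) \<longlonglongrightarrow> x"
    using X by (auto simp: compact_def elim!: allE[of _ X])
  have "(\<lambda>m. (Y \<circ> \<phi>) m *v (X \<circ> \<phi>) m) \<longlonglongrightarrow> mat 1 *v x"
    by (intro tendsto_intros x(3) LIMSEQ_subseq_LIMSEQ[OF Y(1) x(2)])
  from tendsto_mult[OF tendsto_const[of \<sigma>] tendsto_herm[OF this]]
  have "\<sigma> * Re (herm (mat 1 *v x) (mat 1 *v x)) \<le> 0"
    by (rule LIMSEQ_le_const2) (use X(3) in auto)
  moreover have "x \<noteq> 0" using x(1) by auto
  ultimately show False using s x(1) by auto
qed

lemma eventually_act_flag_domain:
  fixes V :: "(complex^('p::finite + 'q::finite)) set"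
  assumes V: "V \<in> flag_domain r r'"
  shows "\<forall>\<^sub>F y in nhds (mat 1). act y V \<in> flag_domain r r'"
proof -
  obtain A B where AB: "vec.subspace A" "vec.subspace B" "A \<subseteq> V" "B \<subseteq> V" "vec.dim A = r" "vec.dim B = r'"
    "pos_on A" "neg_on B" and VG: "V \<in> Gr (r + r')" using V unfolding flag_domain_iff by blast
  have "\<forall>\<^sub>F y in nhds (mat 1). pos_on (act y A)"
    using eventually_definite[OF AB(1), of 1] AB(7) by (simp add: pos_on_def)
  moreover have "\<forall>\<^sub>F y in nhds (mat 1). neg_on (act y B)"
    using eventually_definite[OF AB(2), of "-1"] AB(8) by (simp add: neg_on_def)
  ultimately show ?thesis using eventually_invertible_nhds[OF invertible_mat_1]
  proof eventually_elim
    case (elim y)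
    have "act y A \<subseteq> act y V" "act y B \<subseteq> act y V" using AB by (auto simp: act_def)
    then show ?case
      using AB VG elim by (intro flag_domainI[where A = "act y A" and B = "act y B"]) (simp_all add: act_Gr subspace_act dim_act)
  qed
qed

section \<open>Translates of the standard cycle\<close>

definition Cstd :: "('p::finite + 'q::finite) set \<Rightarrow> (complex^('p + 'q)) set set" where
  "Cstd I = (\<lambda>u. act u (coord_space I)) ` UU"

text \<open>Even for \<open>b\<close> that is not unitary the image stays split and keeps its
  signature, and \<open>UU\<close> is transitive on such subspaces. So the cycle is homogeneous
  under the complex block diagonal group, which supplies holomorphic families inside it.\<close>

lemma block_act_Cstd:
  fixes b :: "complex^('p::finite + 'q::finite)^('p + 'q)"
  assumes b: "invertible b" "prp ** b = b ** prp" and X: "X \<in> Cstd I"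
  shows "act b X \<in> Cstd I"
proof -
  obtain u where u: "u \<in> UU" "X = act u (coord_space I)" using X by (auto simp: Cstd_def)
  let ?c = "b ** u"
  have ic: "invertible ?c" using b(1) UU_D(6)[OF u(1)] by (rule invertible_mult)
  have c: "prp *v (?c *v x) = ?c *v (prp *v x)" for x
  proof -
    have "prp ** ?c = ?c ** prp" using b(2) UU_prp[OF u(1)] by (metis matrix_mul_assoc)
    then show ?thesis by (simp add: matrix_vector_mul_assoc)
  qed
  have bX: "act b X = act ?c (coord_space I)" by (simp add: u(2) act_mult)
  have "split_space (act b X)"
    unfolding split_space_def bX
  proof (intro conjI ballI)
    fix v assume "v \<in> act ?c (coord_space I)"
    then obtain x where x: "x \<in> coord_space I" "v = ?c *v x" by (auto simp: act_def)
    have "prp *v x \<in> coord_space I" using x(1) by (simp add: coord_space_def prp_mv)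
    then show "prp *v v \<in> act ?c (coord_space I)" unfolding x(2) c by (auto simp: act_def)
  qed (simp add: subspace_act)
  moreover have "act b X \<in> flag_domain (card (I \<inter> range Inl)) (card (I \<inter> range Inr))"
  proof (rule flag_domainI[where A = "act ?c (coord_space (I \<inter> range Inl))" and B = "act ?c (coord_space (I \<inter> range Inr))"])
    show "act b X \<in> Gr (card (I \<inter> range Inl) + card (I \<inter> range Inr))"
      unfolding bX card_blocks[symmetric] using ic by (intro act_Gr) (auto simp: Gr_def)
    show "act ?c (coord_space (I \<inter> range Inl)) \<subseteq> act b X"
      unfolding bX unfolding act_def by (intro image_mono coord_space_mono) blast
    show "act ?c (coord_space (I \<inter> range Inr)) \<subseteq> act b X"
      unfolding bX unfolding act_def by (intro image_mono coord_space_mono) blast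
    show "pos_on (act ?c (coord_space (I \<inter> range Inl)))"
    proof -
      have "?c *v x \<in> coord_space (range Inl)" if "x \<in> coord_space (I \<inter> range Inl)" for x
      proof -
        have "prp *v x = x" using that by (auto simp: vec_eq_iff prp_mv coord_space_def)
        then have e: "prp *v (?c *v x) = ?c *v x" using c by simp
        have "(?c *v x) $ i = 0" if "i \<notin> range Inl" for i
          using arg_cong[OF e, of "\<lambda>v. v $ i"] that by (simp add: prp_mv)
        then show ?thesis unfolding coord_space_def by blast
      qed
      then have "act ?c (coord_space (I \<inter> range Inl)) \<subseteq> coord_space (range Inl)" by (auto simp: act_def)
      then show ?thesis using pos_on_coord_Inl by (force simp: pos_on_def)
    qed
    show "neg_on (act ?c (coord_space (I \<inter> range Inr)))"
    proof -
      have "?c *v x \<in> coord_space (range Inr)" if "x \<in> coord_space (I \<inter> range Inr)" for x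
      proof -
        have "prp *v x = 0" using that by (auto simp: vec_eq_iff prp_mv coord_space_def)
        then have z: "prp *v (?c *v x) = 0" using c by simp
        have "(?c *v x) $ Inl a = 0" for a using arg_cong[OF z, of "\<lambda>v. v $ Inl a"] by (simp add: prp_mv)
        then have "(?c *v x) $ i = 0" if "i \<notin> range Inr" for i using that by (cases i) auto
        then show ?thesis unfolding coord_space_def by blast
      qed
      then have "act ?c (coord_space (I \<inter> range Inr)) \<subseteq> coord_space (range Inr)" by (auto simp: act_def)
      then show ?thesis using neg_on_coord_Inr by (force simp: neg_on_def)
    qed
  qed (simp_all add: subspace_act dim_act[OF ic])
  ultimately obtain u' where "u' \<in> UU" "act u' (coord_space I) = act b X"
    by (rule split_space_unitary_frame[OF _ _ refl refl])
  then show ?thesis by (auto simp: Cstd_def)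
qed

lemma block_act_cycle_Cstd:
  fixes b :: "complex^('p::finite + 'q::finite)^('p + 'q)"
  assumes b: "invertible b" "prp ** b = b ** prp"
  shows "act_cycle b (Cstd I) = Cstd I"
proof
  show "act_cycle b (Cstd I) \<subseteq> Cstd I" using block_act_Cstd[OF b] by (auto simp: act_cycle_def)
  have "prp ** matrix_inv b = (matrix_inv b ** b) ** prp ** matrix_inv b" using b(1) by (simp add: matrix_inv_left)
  also have "\<dots> = matrix_inv b ** (b ** prp) ** matrix_inv b" by (simp add: matrix_mul_assoc)
  also have "\<dots> = matrix_inv b ** (prp ** b) ** matrix_inv b" by (simp only: b(2))
  also have "\<dots> = matrix_inv b ** prp ** (b ** matrix_inv b)" by (simp add: matrix_mul_assoc)
  finally have bi: "prp ** matrix_inv b = matrix_inv b ** prp" using b(1) by (simp add: matrix_inv_right)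
  show "Cstd I \<subseteq> act_cycle b (Cstd I)"
  proof
    fix X assume "X \<in> Cstd I"
    then have "act (matrix_inv b) X \<in> Cstd I" by (rule block_act_Cstd[OF invertible_matrix_inv[OF b(1)] bi])
    then have "act b (act (matrix_inv b) X) \<in> act_cycle b (Cstd I)" unfolding act_cycle_def by (rule imageI)
    then show "X \<in> act_cycle b (Cstd I)" using b(1) by simp
  qed
qed

lemma UU_act_cycle_Cstd: "u \<in> UU \<Longrightarrow> act_cycle u (Cstd I) = Cstd I"
  using block_act_cycle_Cstd[OF UU_D(6) UU_prp] by blast

text \<open>Records the outcome of the group theory: the base cycle is a translate, by a matrix
  preserving the Hermitian form, of the standard cycle through a coordinate subspace. From here on
  \<open>K0\<close> no longer appears.\<close>

locale framed_cycle =
  fixes r r' :: nat and T0 :: "complex^('p::finite + 'q::finite)^('p + 'q)"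
    and I0 :: "('p + 'q) set" and C0 :: "(complex^('p + 'q)) set set"
  assumes T0: "cadj T0 ** E_mat ** T0 = E_mat"
    and I0: "card (I0 \<inter> range Inl) = r" "card (I0 \<inter> range Inr) = r'"
    and C0: "C0 = act_cycle T0 (Cstd I0)"
    and k_bounds: "1 \<le> r + r'" "r + r' < CARD('p) + CARD('q)"
begin

abbreviation "D \<equiv> flag_domain r r' :: (complex^('p + 'q)) set set"
abbreviation "E0 \<equiv> coord_space I0"

lemma card_I0: "card I0 = r + r'"
  using card_blocks[of I0] I0 by simp

lemma invertible_T0: "invertible T0"
  by (rule invertible_preserves_herm[OF T0])

lemma E0_D: "E0 \<in> D"
proof (rule flag_domainI[where A = "coord_space (I0 \<inter> range Inl)" and B = "coord_space (I0 \<inter> range Inr)"])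
  show "E0 \<in> Gr (r + r')" by (simp add: Gr_def card_I0)
  have "coord_space (I0 \<inter> range Inl) \<subseteq> coord_space (range Inl)" by (rule coord_space_mono) blast
  then show "pos_on (coord_space (I0 \<inter> range Inl))" using pos_on_coord_Inl by (force simp: pos_on_def)
  have "coord_space (I0 \<inter> range Inr) \<subseteq> coord_space (range Inr)" by (rule coord_space_mono) blast
  then show "neg_on (coord_space (I0 \<inter> range Inr))" using neg_on_coord_Inr by (force simp: neg_on_def)
  show "coord_space (I0 \<inter> range Inl) \<subseteq> E0" "coord_space (I0 \<inter> range Inr) \<subseteq> E0"
    by (simp_all add: coord_space_mono)
qed (use I0 in simp_all)

lemma E0_Cstd: "E0 \<in> Cstd I0"
  unfolding Cstd_def by (rule image_eqI[of _ _ "mat 1"]) (simp_all add: UU_def)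

lemma E0_Gr: "E0 \<in> Gr (r + r')"
  using E0_D by (simp add: flag_domain_def)

lemma C0_D: "C0 \<subseteq> D"
  using T0 E0_D UU_D(2) by (auto simp: C0 act_cycle_def Cstd_def intro!: act_flag_domain)

lemma C0_subspace: "\<forall>V\<in>C0. vec.subspace V"
  using C0_D by (auto simp: flag_domain_def Gr_def)

lemma M_Z_frame:
  assumes "C \<in> M_Z C0"
  obtains T where "invertible T" "C = act_cycle T (Cstd I0)"
proof -
  obtain y where y: "invertible y" "C = act_cycle y C0" using assms M_Z_invertible[OF C0_subspace] by auto
  show ?thesis
    by (rule that[of "y ** T0"]) (simp_all add: y C0 act_cycle_mult invertible_mult invertible_T0)
qed

text \<open>\<open>UU\<close> stabilises the standard cycle and is transitive on it, so the frame of
  a cycle can be adjusted until it sends \<open>E0\<close> to a prescribed point.\<close>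

lemma point_frame:
  assumes "C \<in> M_Z C0" "V \<in> C"
  obtains T where "invertible T" "C = act_cycle T (Cstd I0)" "V = act T E0"
proof -
  obtain T where T: "invertible T" "C = act_cycle T (Cstd I0)" using M_Z_frame[OF assms(1)] by blast
  then obtain u where u: "u \<in> UU" "V = act T (act u E0)" using assms(2) by (auto simp: act_cycle_def Cstd_def)
  show ?thesis
    by (rule that[of "T ** u"])
      (simp_all add: T u act_mult act_cycle_mult UU_act_cycle_Cstd invertible_mult UU_D(6)[OF u(1)])
qed

lemma cycle_points_Gr: "C \<in> M_Z C0 \<Longrightarrow> V \<in> C \<Longrightarrow> V \<in> Gr (r + r')"
  using point_frame act_Gr E0_Gr by metis

lemma UU_convergent_subsequence:
  fixes u :: "nat \<Rightarrow> complex^('p + 'q)^('p + 'q)"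
  assumes "\<And>m. u m \<in> UU"
  obtains v \<phi> where "v \<in> UU" "strict_mono \<phi>" "(u \<circ> \<phi>) \<longlonglongrightarrow> v"
  using compact_UU assms unfolding compact_def by blast

text \<open>Otherwise translates ever closer to \<open>C\<close> would have points outside
  \<open>D\<close>; by compactness of \<open>UU\<close> a subsequence of these converges to a point
  of \<open>C\<close>, contradicting openness of \<open>D\<close>.\<close>

lemma eventually_cycle_subset:
  assumes C: "C \<in> M_Z C0" "C \<subseteq> D"
  shows "\<forall>\<^sub>F y in nhds (mat 1). act_cycle y C \<subseteq> D"
proof (rule ccontr)
  assume "\<not> ?thesis"
  then obtain Y where Y: "Y \<longlonglongrightarrow> (mat 1 :: complex^('p + 'q)^('p + 'q))" "\<And>m. \<not> act_cycle (Y m) C \<subseteq> D"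
    using not_eventually_nhds_sequence by blast
  obtain T where T: "invertible T" "C = act_cycle T (Cstd I0)" using M_Z_frame[OF C(1)] by blast
  have "\<exists>u\<in>UU. act (Y m ** T ** u) E0 \<notin> D" for m
    using Y(2)[of m] by (auto simp: T act_cycle_def Cstd_def act_mult)
  then obtain u where u: "\<And>m. u m \<in> UU" "\<And>m. act (Y m ** T ** u m) E0 \<notin> D" by metis
  obtain v \<phi> where v: "v \<in> UU" "strict_mono \<phi>" "(u \<circ> \<phi>) \<longlonglongrightarrow> v" by (rule UU_convergent_subsequence[OF u(1)])
  let ?X = "act (T ** v) E0"
  have iTv: "invertible (T ** v)" using T(1) UU_D(6)[OF v(1)] by (rule invertible_mult)
  have "?X \<in> C" using v(1) by (auto simp: T(2) act_cycle_def Cstd_def act_mult)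
  then have ev: "\<forall>\<^sub>F z in nhds (mat 1). act z ?X \<in> D" using C(2) by (intro eventually_act_flag_domain) blast
  let ?z = "\<lambda>m. ((Y \<circ> \<phi>) m ** T ** (u \<circ> \<phi>) m) ** matrix_inv (T ** v)"
  have "?z \<longlonglongrightarrow> (mat 1 ** T ** v) ** matrix_inv (T ** v)"
    by (intro tendsto_intros v(3) LIMSEQ_subseq_LIMSEQ[OF Y(1) v(2)])
  then have "?z \<longlonglongrightarrow> mat 1" using iTv by (simp add: matrix_inv_right)
  from eventually_compose_filterlim[OF ev this]
  have "\<forall>\<^sub>F m in sequentially. act (?z m) ?X \<in> D" .
  then obtain m where "act (?z m) ?X \<in> D" unfolding eventually_sequentially by blast
  moreover have "act (?z m) ?X = act (Y (\<phi> m) ** T ** u (\<phi> m)) E0"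
    using iTv by (simp add: act_mult[of _ "matrix_inv (T ** v)"])
  ultimately show False using u(2) by simp
qed

text \<open>Incidence is a closed relation: by compactness of \<open>UU\<close>, incident pairs
  approaching \<open>(V, C)\<close> produce a point of \<open>C\<close> that is contained in
  \<open>V\<close> and equals it by dimension. A single \<open>S\<close> moves both the point and
  the cycle, as the covering argument below requires.\<close>

lemma incidence_closed:
  assumes C: "C \<in> M_Z C0" and V: "V \<in> Gr (r + r')" "V \<notin> C"
  shows "\<exists>S. open S \<and> mat 1 \<in> S \<and> (\<forall>y\<in>S. invertible y) \<and> (\<forall>y\<in>S. \<forall>y'\<in>S. act y V \<notin> act_cycle y' C)"
proof -
  obtain T where T: "invertible T" "C = act_cycle T (Cstd I0)" using M_Z_frame[OF C] by blast
  let ?P = "\<lambda>(y, y'). act y V \<notin> act_cycle y' C"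
  have ev: "\<forall>\<^sub>F z in nhds (mat 1, mat 1). ?P z"
  proof (rule ccontr)
    assume "\<not> ?thesis"
    then obtain Y where Y: "Y \<longlonglongrightarrow> (mat 1 :: complex^('p + 'q)^('p + 'q), mat 1 :: complex^('p + 'q)^('p + 'q))"
      "\<And>m. \<not> ?P (Y m)"
      using not_eventually_nhds_sequence by blast
    have Y1: "(\<lambda>m. fst (Y m)) \<longlonglongrightarrow> mat 1" "(\<lambda>m. snd (Y m)) \<longlonglongrightarrow> mat 1"
      using tendsto_fst[OF Y(1)] tendsto_snd[OF Y(1)] by simp_all
    have "\<exists>u\<in>UU. act (fst (Y m)) V = act (snd (Y m) ** T ** u) E0" for m
      using Y(2)[of m] by (auto simp: case_prod_beta T act_cycle_def Cstd_def act_mult)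
    then obtain u where u: "\<And>m. u m \<in> UU" "\<And>m. act (fst (Y m)) V = act (snd (Y m) ** T ** u m) E0" by metis
    obtain v \<phi> where v: "v \<in> UU" "strict_mono \<phi>" "(u \<circ> \<phi>) \<longlonglongrightarrow> v" by (rule UU_convergent_subsequence[OF u(1)])
    have subV: "vec.subspace V" using V by (simp add: Gr_def)
    have "T ** v *v x \<in> V" if x: "x \<in> E0" for x
    proof -
      let ?w = "\<lambda>m. (matrix_inv (fst (Y (\<phi> m))) ** (snd (Y (\<phi> m)) ** T ** (u \<circ> \<phi>) m)) *v x"
      have "?w \<longlonglongrightarrow> (matrix_inv (mat 1) ** (mat 1 ** T ** v)) *v x"
        by (intro tendsto_intros v(3) invertible_mat_1 LIMSEQ_subseq_LIMSEQ[OF Y1(1) v(2), unfolded o_def]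
            LIMSEQ_subseq_LIMSEQ[OF Y1(2) v(2), unfolded o_def])
      moreover have "matrix_inv (mat 1 :: complex^('p + 'q)^('p + 'q)) = mat 1" by (rule matrix_inv_unique) simp
      ultimately have lim: "?w \<longlonglongrightarrow> T ** v *v x" by simp
      have "\<forall>\<^sub>F m in sequentially. invertible (fst (Y (\<phi> m)))"
        by (rule eventually_compose_filterlim[OF eventually_invertible_nhds[OF invertible_mat_1]
            LIMSEQ_subseq_LIMSEQ[OF Y1(1) v(2), unfolded o_def]])
      then have "\<forall>\<^sub>F m in sequentially. ?w m \<in> V"
      proof eventually_elim
        case (elim m)
        have "(snd (Y (\<phi> m)) ** T ** u (\<phi> m)) *v x \<in> act (fst (Y (\<phi> m))) V"
          unfolding u(2) using x by (auto simp: act_def)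
        then obtain w where "w \<in> V" "(snd (Y (\<phi> m)) ** T ** u (\<phi> m)) *v x = fst (Y (\<phi> m)) *v w" by (auto simp: act_def)
        then show ?case using elim by (simp add: matrix_vector_mul_assoc[symmetric])
      qed
      then show ?thesis
        using closed_vec_subspace[OF subV] lim by (intro Lim_in_closed_set[OF _ _ _ lim]) auto
    qed
    then have sub: "act (T ** v) E0 \<subseteq> V" by (auto simp: act_def)
    have "act (T ** v) E0 = V"
      using T(1) UU_D(6)[OF v(1)] subV sub V(1)
      by (intro act_mono_eq) (auto simp: invertible_mult Gr_def card_I0)
    then have "V \<in> C" using v(1) by (auto simp: T(2) act_cycle_def Cstd_def act_mult)
    then show False using V(2) by blast
  qed
  obtain S1 where S1: "open S1" "(mat 1, mat 1) \<in> S1" "\<forall>z\<in>S1. ?P z" using ev unfolding eventually_nhds by blast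
  obtain A B where AB: "open A" "open B" "(mat 1, mat 1) \<in> A \<times> B" "A \<times> B \<subseteq> S1"
    using open_prod_elim[OF S1(1,2)] by (metis)
  obtain S2 where S2: "open S2" "mat 1 \<in> S2" "\<forall>y\<in>S2. invertible (y :: complex^('p + 'q)^('p + 'q))"
    using eventually_invertible_nhds[OF invertible_mat_1] unfolding eventually_nhds by blast
  show ?thesis
  proof (intro exI[of _ "A \<inter> B \<inter> S2"] conjI ballI)
    show "open (A \<inter> B \<inter> S2)" using AB S2 by auto
    show "mat 1 \<in> A \<inter> B \<inter> S2" using AB S2 by auto
    show "invertible y" if "y \<in> A \<inter> B \<inter> S2" for y using that S2 by blast
    show "act y V \<notin> act_cycle y' C" if "y \<in> A \<inter> B \<inter> S2" "y' \<in> A \<inter> B \<inter> S2" for y y'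
      using that AB(4) S1(3) by blast
  qed
qed

lemma open_orbit_gr:
  assumes S: "open S" "\<And>y. y \<in> S \<Longrightarrow> invertible y" and V: "V \<in> Gr (r + r')"
  shows "openin (gr_topology (r + r')) {act y V | y. y \<in> S}"
  unfolding openin_gr_topology_act
proof (intro conjI ballI)
  show "{act y V | y. y \<in> S} \<subseteq> Gr (r + r')" using S(2) V act_Gr by blast
  fix X assume "X \<in> {act y V | y. y \<in> S}"
  then obtain y where y: "y \<in> S" "X = act y V" by blast
  have "((\<lambda>z. z ** y) \<longlongrightarrow> mat 1 ** y) (nhds (mat 1))" by (intro tendsto_intros filterlim_ident)
  then have "\<forall>\<^sub>F z in nhds (mat 1). z ** y \<in> S" using S(1) y(1) topological_tendstoD by fastforce
  then show "\<forall>\<^sub>F z in nhds (mat 1). act z X \<in> {act y V | y. y \<in> S}"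
    by eventually_elim (use y(2) act_mult in blast)
qed

lemma open_orbit_cycle:
  assumes S: "open S" "\<And>y. y \<in> S \<Longrightarrow> invertible y" and C: "C \<in> M_Z C0"
  shows "openin (cycle_topology C0) {act_cycle y C | y. y \<in> S}"
  unfolding openin_cycle_topology_act[OF C0_subspace]
proof (intro conjI ballI)
  show "{act_cycle y C | y. y \<in> S} \<subseteq> M_Z C0" using S(2) C M_Z_act[OF C0_subspace] by blast
  fix X assume "X \<in> {act_cycle y C | y. y \<in> S}"
  then obtain y where y: "y \<in> S" "X = act_cycle y C" by blast
  have "((\<lambda>z. z ** y) \<longlongrightarrow> mat 1 ** y) (nhds (mat 1))" by (intro tendsto_intros filterlim_ident)
  then have "\<forall>\<^sub>F z in nhds (mat 1). z ** y \<in> S" using S(1) y(1) topological_tendstoD by fastforce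
  then show "\<forall>\<^sub>F z in nhds (mat 1). act_cycle z X \<in> {act_cycle y C | y. y \<in> S}"
    by eventually_elim (use y(2) act_cycle_mult in blast)
qed

section \<open>The cycle domain and the domain swept out by its cycles\<close>

abbreviation "MD \<equiv> M_D D C0"

lemma MD_subset: "MD \<subseteq> {C \<in> M_Z C0. C \<subseteq> D}"
  unfolding M_D_def using connected_component_of_subset_topspace[of "subtopology (cycle_topology C0) {C \<in> M_Z C0. C \<subseteq> D}" C0]
  by auto

text \<open>A small ball of matrices is connected, hence so is its image among the cycles inside
  \<open>D\<close>. The image contains \<open>C\<close> and therefore stays in the component of
  \<open>C\<close>.\<close>

lemma eventually_MD:
  assumes C: "C \<in> MD"
  shows "\<forall>\<^sub>F y in nhds (mat 1). act_cycle y C \<in> MD"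
proof -
  let ?X = "subtopology (cycle_topology C0) {C \<in> M_Z C0. C \<subseteq> D}"
  have CZ: "C \<in> M_Z C0" "C \<subseteq> D" using C MD_subset by blast+
  have "\<forall>\<^sub>F y in nhds (mat 1). invertible y \<and> act_cycle y C \<subseteq> D"
    using eventually_invertible_nhds[OF invertible_mat_1] eventually_cycle_subset[OF CZ] by (rule eventually_conj)
  then obtain d where d: "d > 0" "\<And>y. dist y (mat 1) < d \<Longrightarrow> invertible y \<and> act_cycle y C \<subseteq> D"
    unfolding eventually_nhds_metric by blast
  let ?B = "ball (mat 1 :: complex^('p + 'q)^('p + 'q)) d"
  let ?f = "\<lambda>y. act_cycle y C"
  have dB: "invertible y \<and> act_cycle y C \<subseteq> D" if "y \<in> ?B" for y using d(2)[of y] that by (simp add: dist_commute)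
  have "continuous_map (top_of_set ?B) ?X ?f"
    unfolding continuous_map_def
  proof (intro conjI funcsetI allI impI)
    fix y assume "y \<in> topspace (top_of_set ?B)"
    then show "act_cycle y C \<in> topspace ?X"
      using dB[of y] M_Z_act[OF C0_subspace CZ(1)] topspace_cycle_topology[OF C0_subspace] by auto
  next
    fix U assume "openin ?X U"
    then obtain U1 where U1: "openin (cycle_topology C0) U1" "U = U1 \<inter> {C \<in> M_Z C0. C \<subseteq> D}"
      unfolding openin_subtopology by blast
    have "open {y \<in> ?B. act_cycle y C \<in> U1}"
    proof (subst open_subopen, intro ballI)
      fix y assume y: "y \<in> {y \<in> ?B. act_cycle y C \<in> U1}"
      then have iy: "invertible y" using dB by blast
      have "((\<lambda>z. z ** matrix_inv y) \<longlongrightarrow> y ** matrix_inv y) (nhds y)" by (intro tendsto_intros filterlim_ident)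
      then have "((\<lambda>z. z ** matrix_inv y) \<longlongrightarrow> mat 1) (nhds y)" using iy by (simp add: matrix_inv_right)
      moreover have "\<forall>\<^sub>F z in nhds (mat 1). act_cycle z (act_cycle y C) \<in> U1"
        using U1(1) y openin_cycle_topology_act[OF C0_subspace] by blast
      ultimately have "\<forall>\<^sub>F z in nhds y. act_cycle (z ** matrix_inv y) (act_cycle y C) \<in> U1"
        using eventually_compose_filterlim by blast
      then have "\<forall>\<^sub>F z in nhds y. act_cycle z C \<in> U1"
        using iy by (simp add: act_cycle_mult[of _ "matrix_inv y"])
      moreover have "\<forall>\<^sub>F z in nhds y. z \<in> ?B" using y by (intro eventually_nhds_in_open) auto
      ultimately have "\<forall>\<^sub>F z in nhds y. z \<in> {y \<in> ?B. act_cycle y C \<in> U1}" by eventually_elim blast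
      then show "\<exists>S. open S \<and> y \<in> S \<and> S \<subseteq> {y \<in> ?B. act_cycle y C \<in> U1}"
        unfolding eventually_nhds by blast
    qed
    moreover have "{y \<in> topspace (top_of_set ?B). act_cycle y C \<in> U} = {y \<in> ?B. act_cycle y C \<in> U1}"
      using dB M_Z_act[OF C0_subspace CZ(1)] by (auto simp: U1(2))
    ultimately show "openin (top_of_set ?B) {y \<in> topspace (top_of_set ?B). act_cycle y C \<in> U}"
      by (metis (no_types, lifting) inf.absorb_iff2 mem_Collect_eq openin_open_Int subsetI)
  qed
  moreover have "connectedin (top_of_set ?B) ?B"
    by (simp add: connectedin_subtopology convex_connected)
  ultimately have "connectedin ?X (?f ` ?B)" by (rule connectedin_continuous_map_image)
  moreover have "C \<in> ?f ` ?B" using d(1) by (intro image_eqI[of _ _ "mat 1"]) simp_all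
  ultimately have "?f ` ?B \<subseteq> connected_component_of_set ?X C" by (rule connected_component_of_maximal)
  moreover have "connected_component_of_set ?X C = MD"
  proof -
    have "connected_component_of ?X C0 C" using C unfolding M_D_def by simp
    then have "connected_component_of ?X C0 = connected_component_of ?X C"
      unfolding connected_component_of_equiv[of ?X C0 C] by (elim conjE)
    then show ?thesis unfolding M_D_def by simp
  qed
  ultimately have "\<forall>y. dist y (mat 1) < d \<longrightarrow> act_cycle y C \<in> MD" by (auto simp: dist_commute)
  then show ?thesis unfolding eventually_nhds_metric using d(1) by blast
qed

lemma openin_MD_topology:
  "openin (M_D_topology D C0) U \<longleftrightarrow> U \<subseteq> MD \<and> (\<forall>C\<in>U. \<forall>\<^sub>F y in nhds (mat 1). act_cycle y C \<in> U)"
proof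
  assume "openin (M_D_topology D C0) U"
  then obtain U1 where U1: "openin (cycle_topology C0) U1" "U = U1 \<inter> MD"
    unfolding M_D_topology_def openin_subtopology by blast
  have "\<forall>\<^sub>F y in nhds (mat 1). act_cycle y C \<in> U" if "C \<in> U" for C
  proof -
    have "\<forall>\<^sub>F y in nhds (mat 1). act_cycle y C \<in> U1"
      using U1 that openin_cycle_topology_act[OF C0_subspace] by blast
    moreover have "\<forall>\<^sub>F y in nhds (mat 1). act_cycle y C \<in> MD" using U1 that by (intro eventually_MD) blast
    ultimately show ?thesis by eventually_elim (simp add: U1(2))
  qed
  then show "U \<subseteq> MD \<and> (\<forall>C\<in>U. \<forall>\<^sub>F y in nhds (mat 1). act_cycle y C \<in> U)" using U1(2) by blast
next
  assume U: "U \<subseteq> MD \<and> (\<forall>C\<in>U. \<forall>\<^sub>F y in nhds (mat 1). act_cycle y C \<in> U)"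
  then have "openin (cycle_topology C0) U"
    unfolding openin_cycle_topology_act[OF C0_subspace] using MD_subset by blast
  moreover have "U = U \<inter> MD" using U by blast
  ultimately show "openin (M_D_topology D C0) U" unfolding M_D_topology_def openin_subtopology by blast
qed

lemma topspace_MD: "topspace (M_D_topology D C0) = MD"
proof -
  have "openin (M_D_topology D C0) MD" unfolding openin_MD_topology using eventually_MD by blast
  moreover have "topspace (M_D_topology D C0) \<subseteq> MD" unfolding M_D_topology_def by simp
  ultimately show ?thesis using openin_subset by blast
qed

lemma swept_domain_eq:
  assumes "B \<subseteq> MD" shows "swept_domain D C0 B = \<Union>B"
proof -
  have "V \<in> swept_domain D C0 B" if "V \<in> C" "C \<in> B" for V C
  proof -
    have "(V, C) \<in> {x \<in> X_D D C0. snd x \<in> B}" using that assms MD_subset by (auto simp: X_D_def)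
    then show ?thesis unfolding swept_domain_def by force
  qed
  then show ?thesis by (auto simp: swept_domain_def X_D_def)
qed

text \<open>Plays the role of properness of the projection to cycles. If all cycles in the closure
  missed \<open>V\<close>, finitely many neighbourhoods from \<open>incidence_closed\<close> would
  cover this compact set, and the intersection of their matrix sets would give a neighbourhood of
  \<open>V\<close> that meets no cycle of \<open>B\<close>.\<close>

lemma closure_incidence:
  assumes B: "B \<subseteq> MD" and cpt: "compactin (M_D_topology D C0) (M_D_topology D C0 closure_of B)"
    and V: "V \<in> Gr (r + r')"
    and lim: "\<And>W. openin (gr_topology (r + r')) W \<Longrightarrow> V \<in> W \<Longrightarrow> W \<inter> \<Union>B \<noteq> {}"
  obtains C where "C \<in> M_D_topology D C0 closure_of B" "V \<in> C"
proof -
  let ?X = "M_D_topology D C0"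
  let ?cl = "?X closure_of B"
  have "\<exists>C\<in>?cl. V \<in> C"
  proof (rule ccontr)
    assume neg: "\<not> (\<exists>C\<in>?cl. V \<in> C)"
    have clM: "?cl \<subseteq> MD" using closure_of_subset_topspace topspace_MD by metis
    have "\<exists>S. open S \<and> mat 1 \<in> S \<and> (\<forall>y\<in>S. invertible y) \<and> (\<forall>y\<in>S. \<forall>y'\<in>S. act y V \<notin> act_cycle y' C)"
      if C: "C \<in> ?cl" for C
    proof -
      have "C \<in> M_Z C0" using C clM MD_subset by blast
      moreover have "V \<notin> C" using neg C by blast
      ultimately show ?thesis by (rule incidence_closed[OF _ V])
    qed
    then have "\<forall>C\<in>?cl. \<exists>S. open S \<and> mat 1 \<in> S \<and> (\<forall>y\<in>S. invertible y) \<and> (\<forall>y\<in>S. \<forall>y'\<in>S. act y V \<notin> act_cycle y' C)"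
      by blast
    from bchoice[OF this] obtain S where S0: "\<forall>C\<in>?cl. open (S C) \<and> mat 1 \<in> S C \<and> (\<forall>y\<in>S C. invertible y) \<and>
      (\<forall>y\<in>S C. \<forall>y'\<in>S C. act y V \<notin> act_cycle y' C)" by (elim exE)
    have S: "open (S C)" "mat 1 \<in> S C" "y \<in> S C \<Longrightarrow> invertible y"
      "y \<in> S C \<Longrightarrow> y' \<in> S C \<Longrightarrow> act y V \<notin> act_cycle y' C" if "C \<in> ?cl" for C y y'
      using bspec[OF S0 that] by simp_all
    define N where "N C = {act_cycle y C | y. y \<in> S C} \<inter> MD" for C
    have Nopen: "openin ?X (N C)" if C: "C \<in> ?cl" for C
    proof -
      have CZ: "C \<in> M_Z C0" using C clM MD_subset by blast
      have "openin (cycle_topology C0) {act_cycle y C | y. y \<in> S C}"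
        by (rule open_orbit_cycle[OF S(1)[OF C] S(3)[OF C] CZ])
      then show ?thesis unfolding N_def M_D_topology_def openin_subtopology by blast
    qed
    have CN: "C \<in> N C" if C: "C \<in> ?cl" for C
    proof -
      have "act_cycle (mat 1) C \<in> {act_cycle y C | y. y \<in> S C}" using S(2)[OF C] by blast
      then show ?thesis using C clM by (auto simp: N_def)
    qed
    have "\<exists>\<F>. finite \<F> \<and> \<F> \<subseteq> N ` ?cl \<and> ?cl \<subseteq> \<Union>\<F>"
      using cpt Nopen CN unfolding compactin_def by (elim conjE allE[of _ "N ` ?cl"]) blast
    then obtain \<F> where "finite \<F>" "\<F> \<subseteq> N ` ?cl" "?cl \<subseteq> \<Union>\<F>" by blast
    then obtain \<G> where \<G>: "finite \<G>" "\<G> \<subseteq> ?cl" "?cl \<subseteq> \<Union>(N ` \<G>)"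
      using finite_subset_image by metis
    define S' where "S' = (\<Inter>C\<in>\<G>. S C) \<inter> {y. invertible y}"
    have oinv: "open {y :: complex^('p + 'q)^('p + 'q). invertible y}"
    proof (subst open_subopen, intro ballI)
      fix y :: "complex^('p + 'q)^('p + 'q)" assume "y \<in> {y. invertible y}"
      then show "\<exists>T. open T \<and> y \<in> T \<and> T \<subseteq> {y. invertible y}"
        using eventually_invertible_nhds[of y] unfolding eventually_nhds by blast
    qed
    have S'o: "open S'" unfolding S'_def using \<G> S(1) oinv by (intro open_Int open_INT) auto
    have S'1: "mat 1 \<in> S'" unfolding S'_def using \<G> S(2) by auto
    have "openin (gr_topology (r + r')) {act y V | y. y \<in> S'}"
      by (rule open_orbit_gr[OF S'o _ V]) (simp add: S'_def)
    moreover have "V \<in> {act y V | y. y \<in> S'}"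
    proof -
      have "act (mat 1) V \<in> {act y V | y. y \<in> S'}" using S'1 by blast
      then show ?thesis by simp
    qed
    ultimately obtain X where X: "X \<in> {act y V | y. y \<in> S'}" "X \<in> \<Union>B" using lim by blast
    then obtain y where y: "y \<in> S'" "X = act y V" by blast
    obtain C' where C': "X \<in> C'" "C' \<in> B" using X by blast
    have "B \<subseteq> ?cl" using B by (intro closure_of_subset) (simp add: topspace_MD)
    then obtain C where C: "C \<in> \<G>" "C' \<in> N C" using C' \<G>(3) by blast
    then obtain y' where y': "y' \<in> S C" "C' = act_cycle y' C" by (auto simp: N_def)
    have "y \<in> S C" using y C by (auto simp: S'_def)
    then show False using S(4)[of C y y'] C \<G>(2) y y' C' by blast
  qed
  then show ?thesis using that by blast
qed

lemma openin_Union_cycles: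
  assumes "openin (M_D_topology D C0) B"
  shows "openin (gr_topology (r + r')) (\<Union>B)"
  unfolding openin_gr_topology_act
proof (intro conjI ballI)
  have B: "B \<subseteq> MD" using assms openin_MD_topology by blast
  then show "\<Union>B \<subseteq> Gr (r + r')" using MD_subset cycle_points_Gr by blast
  fix V assume "V \<in> \<Union>B"
  then obtain C where C: "V \<in> C" "C \<in> B" by blast
  have "\<forall>\<^sub>F y in nhds (mat 1). act_cycle y C \<in> B" using assms C openin_MD_topology by blast
  then show "\<forall>\<^sub>F y in nhds (mat 1). act y V \<in> \<Union>B"
    by eventually_elim (use C in \<open>auto simp: act_cycle_def\<close>)
qed

text \<open>A multiple of an elementary matrix, not the projection of the incidence space. The
  coefficient is an argument because the functionals applied to it are only real linear, while
  matrix entries are complex.\<close>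

definition mu :: "'p + 'q \<Rightarrow> 'p + 'q \<Rightarrow> complex \<Rightarrow> complex^('p + 'q)^('p + 'q)" where
  "mu j i c = (\<chi> a b. if a = j \<and> b = i then c else 0)"

lemma mu_mv: "mu j i c *v x = axis j (c * x $ i)"
proof -
  have "(mu j i c *v x) $ a = (axis j (c * x $ i)) $ a" for a
  proof -
    have "(mu j i c *v x) $ a = (\<Sum>b\<in>UNIV. if b = i then (if a = j then c * x $ b else 0) else 0)"
      unfolding matrix_vector_mult_def mu_def vec_lambda_beta by (rule sum.cong) auto
    then show ?thesis by (simp add: axis_def)
  qed
  then show ?thesis by (simp add: vec_eq_iff)
qed

section \<open>A path leaving the flag domain and the frontier of the swept domain\<close>

lemma square_zero_invertible:
  fixes N :: "complex^'n::finite^'n"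
  assumes "N ** N = 0" shows "invertible (mat 1 + N)"
proof (rule invertibleI)
  show "(mat 1 + N) ** (mat 1 - N) = mat 1"
    by (simp add: matrix_add_rdistrib matrix_diff_ldistrib assms)
qed

text \<open>\<open>I0\<close> is neither empty nor everything, so there are indices inside and
  outside it. If they lie in the same block, any index of the other block can replace one of the
  two.\<close>

lemma exists_opposite_pair:
  obtains i0 j0 where "i0 \<in> I0" "j0 \<notin> I0" "(i0 \<in> range Inl) \<noteq> (j0 \<in> range Inl)"
proof -
  have "I0 \<noteq> {}" using card_I0 k_bounds by auto
  have "I0 \<noteq> UNIV" using card_I0 k_bounds by auto
  obtain i1 j1 where ij: "i1 \<in> I0" "j1 \<notin> I0" using \<open>I0 \<noteq> {}\<close> \<open>I0 \<noteq> UNIV\<close> by blast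
  show ?thesis
  proof (cases "(i1 \<in> range Inl) = (j1 \<in> range Inl)")
    case False then show ?thesis using that ij by blast
  next
    case True
    obtain l :: "'p + 'q" where l: "(l \<in> range Inl) \<noteq> (i1 \<in> range Inl)"
      using in_range_Inr by (metis Inl_Inr_False rangeI rangeE)
    show ?thesis
    proof (cases "l \<in> I0")
      case True then show ?thesis using that[of l j1] ij l \<open>(i1 \<in> range Inl) = (j1 \<in> range Inl)\<close> by blast
    next
      case False then show ?thesis using that[of i1 l] ij l by blast
    qed
  qed
qed

text \<open>The basis vector \<open>i0\<close> acquires \<open>t\<close> times a basis vector of
  opposite sign, so its value under the form is scaled by \<open>1 - t\<^sup>2\<close>. The
  signature persists for \<open>t < 1\<close>; at \<open>t = 1\<close> the vector becomes null and
  one dimension of its sign is lost.\<close>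

lemma path_leaves_D:
  assumes ij: "i0 \<in> I0" "j0 \<notin> I0" "(i0 \<in> range Inl) \<noteq> (j0 \<in> range Inl)"
  shows "0 \<le> t \<Longrightarrow> t < 1 \<Longrightarrow> act (mat 1 + mu j0 i0 (of_real t)) E0 \<in> D"
    and "act (mat 1 + mu j0 i0 1) E0 \<notin> D"
proof -
  let ?M = "\<lambda>c. mat 1 + mu j0 i0 c"
  have ne: "i0 \<noteq> j0" using ij by auto
  have iM: "invertible (?M c)" for c
    by (rule square_zero_invertible)
      (use ne in \<open>simp add: matrix_eq matrix_vector_mul_assoc[symmetric] mu_mv axis_def vec_eq_iff\<close>)
  have Mv: "?M c *v x = x + axis j0 (c * x $ i0)" for c x by (simp add: matrix_vector_mult_add_rdistrib mu_mv)
  have sum_part: "(\<Sum>a\<in>UNIV. (cmod ((x + axis j0 (c * x $ i0)) $ f a))\<^sup>2) =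
      (\<Sum>a\<in>UNIV. (cmod (x $ f a))\<^sup>2) + (if j0 \<in> range f then (cmod (c * x $ i0))\<^sup>2 else 0)"
    if x: "x $ j0 = 0" and f: "inj f" for x c and f :: "'r::finite \<Rightarrow> 'p + 'q"
  proof (cases "j0 \<in> range f")
    case False
    then have "(x + axis j0 (c * x $ i0)) $ f a = x $ f a" for a by (auto simp: axis_def)
    then show ?thesis using False by simp
  next
    case True
    then obtain b where b: "j0 = f b" by blast
    have "(cmod ((x + axis j0 (c * x $ i0)) $ f a))\<^sup>2 = (cmod (x $ f a))\<^sup>2 + (if a = b then (cmod (c * x $ i0))\<^sup>2 else 0)" for a
      using x f by (auto simp: axis_def b inj_eq)
    then show ?thesis using True by (simp add: sum.distrib)
  qed
  have h: "Re (herm (?M c *v x) (?M c *v x)) = Re (herm x x) +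
      (if j0 \<in> range Inl then (cmod (c * x $ i0))\<^sup>2 else - (cmod (c * x $ i0))\<^sup>2)" if "x \<in> E0" for c x
  proof -
    have x0: "x $ j0 = 0" using that ij(2) by (simp add: coord_space_def)
    then show ?thesis
      unfolding Mv Re_herm_self sum_part[OF x0 inj_Inl] sum_part[OF x0 inj_Inr] by (simp add: in_range_Inr)
  qed
  have hl: "Re (herm x x) = (\<Sum>a\<in>UNIV. (cmod (x $ Inl a))\<^sup>2)" if "x \<in> coord_space (I0 \<inter> range Inl)" for x
  proof -
    have "x $ Inr b = 0" for b using that by (auto simp: coord_space_def)
    then show ?thesis by (simp add: Re_herm_self)
  qed
  have hr: "Re (herm x x) = - (\<Sum>a\<in>UNIV. (cmod (x $ Inr a))\<^sup>2)" if "x \<in> coord_space (I0 \<inter> range Inr)" for x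
  proof -
    have "x $ Inl b = 0" for b using that by (auto simp: coord_space_def)
    then show ?thesis by (simp add: Re_herm_self)
  qed
  have le_l: "(cmod (x $ i0))\<^sup>2 \<le> (\<Sum>a\<in>UNIV. (cmod (x $ Inl a))\<^sup>2)" if "i0 \<in> range Inl" for x :: "complex^('p + 'q)"
  proof -
    obtain b where "i0 = Inl b" using \<open>i0 \<in> range Inl\<close> by blast
    then show ?thesis using member_le_sum[of b UNIV "\<lambda>a. (cmod (x $ Inl a))\<^sup>2"] by simp
  qed
  have le_r: "(cmod (x $ i0))\<^sup>2 \<le> (\<Sum>a\<in>UNIV. (cmod (x $ Inr a))\<^sup>2)" if "i0 \<in> range Inr" for x :: "complex^('p + 'q)"
  proof -
    obtain b where "i0 = Inr b" using \<open>i0 \<in> range Inr\<close> by blast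
    then show ?thesis using member_le_sum[of b UNIV "\<lambda>a. (cmod (x $ Inr a))\<^sup>2"] by simp
  qed
  have subl: "coord_space (I0 \<inter> range Inl) \<subseteq> E0" and subr: "coord_space (I0 \<inter> range Inr) \<subseteq> E0"
    by (intro coord_space_mono; blast)+
  have zr: "x $ i0 = 0" if "x \<in> coord_space (I0 \<inter> range Inr)" "i0 \<in> range Inl" for x
    using that in_range_Inr by (auto simp: coord_space_def)
  have zl: "x $ i0 = 0" if "x \<in> coord_space (I0 \<inter> range Inl)" "i0 \<notin> range Inl" for x
    using that by (auto simp: coord_space_def)
  have posl: "pos_on (coord_space (I0 \<inter> range Inl))" and negr: "neg_on (coord_space (I0 \<inter> range Inr))"
    using pos_on_coord_Inl neg_on_coord_Inr coord_space_mono[of "I0 \<inter> range Inl" "range Inl"]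
      coord_space_mono[of "I0 \<inter> range Inr" "range Inr"] unfolding pos_on_def neg_on_def by blast+
  show "act (?M (of_real t)) E0 \<in> D" if t: "0 \<le> t" "t < 1"
  proof (rule flag_domainI)
    let ?A = "act (?M (of_real t)) (coord_space (I0 \<inter> range Inl))"
    let ?B = "act (?M (of_real t)) (coord_space (I0 \<inter> range Inr))"
    show "act (?M (of_real t)) E0 \<in> Gr (r + r')" by (rule act_Gr[OF iM E0_Gr])
    show "?A \<subseteq> act (?M (of_real t)) E0" "?B \<subseteq> act (?M (of_real t)) E0"
      using subl subr unfolding act_def by (simp_all add: image_mono)
    show "vec.dim ?A = r" "vec.dim ?B = r'" "vec.subspace ?A" "vec.subspace ?B"
      using I0 by (simp_all add: dim_act[OF iM] subspace_act)
    have t2: "t\<^sup>2 < 1" using t by (simp add: power_less_one_iff abs_square_less_1)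
    show "pos_on ?A" unfolding pos_on_def
    proof (intro ballI impI)
      fix w assume "w \<in> ?A" "w \<noteq> 0"
      then obtain x where x': "x \<in> coord_space (I0 \<inter> range Inl)" "w = ?M (of_real t) *v x"
        by (auto simp: act_def)
      moreover have "x \<noteq> 0" using \<open>w \<noteq> 0\<close> x' by auto
      ultimately have x: "x \<in> coord_space (I0 \<inter> range Inl)" "w = ?M (of_real t) *v x" "x \<noteq> 0" by auto
      have xp: "Re (herm x x) > 0" using posl x by (auto simp: pos_on_def)
      have hx: "Re (herm w w) = Re (herm x x) +
        (if j0 \<in> range Inl then t\<^sup>2 * (cmod (x $ i0))\<^sup>2 else - (t\<^sup>2 * (cmod (x $ i0))\<^sup>2))"
        using h[of x "of_real t"] x subl by (auto simp: norm_mult power_mult_distrib)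
      show "Re (herm w w) > 0"
      proof (cases "j0 \<in> range Inl")
        case True then show ?thesis using hx xp by (simp add: add_pos_nonneg)
      next
        case False
        then have "(cmod (x $ i0))\<^sup>2 \<le> Re (herm x x)" using le_l[of x] hl[OF x(1)] ij(3) by simp
        then have "t\<^sup>2 * (cmod (x $ i0))\<^sup>2 \<le> t\<^sup>2 * Re (herm x x)" by (intro mult_left_mono) auto
        also have "\<dots> < 1 * Re (herm x x)" using t2 xp by (intro mult_strict_right_mono)
        finally show ?thesis using hx False by simp
      qed
    qed
    show "neg_on ?B" unfolding neg_on_def
    proof (intro ballI impI)
      fix w assume "w \<in> ?B" "w \<noteq> 0"
      then obtain x where x': "x \<in> coord_space (I0 \<inter> range Inr)" "w = ?M (of_real t) *v x"
        by (auto simp: act_def)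
      moreover have "x \<noteq> 0" using \<open>w \<noteq> 0\<close> x' by auto
      ultimately have x: "x \<in> coord_space (I0 \<inter> range Inr)" "w = ?M (of_real t) *v x" "x \<noteq> 0" by auto
      have xp: "Re (herm x x) < 0" using negr x by (auto simp: neg_on_def)
      have hx: "Re (herm w w) = Re (herm x x) +
        (if j0 \<in> range Inl then t\<^sup>2 * (cmod (x $ i0))\<^sup>2 else - (t\<^sup>2 * (cmod (x $ i0))\<^sup>2))"
        using h[of x "of_real t"] x subr by (auto simp: norm_mult power_mult_distrib)
      show "Re (herm w w) < 0"
      proof (cases "j0 \<in> range Inl")
        case False
        then have "Re (herm w w) = Re (herm x x) - t\<^sup>2 * (cmod (x $ i0))\<^sup>2" using hx by simp
        moreover have "t\<^sup>2 * (cmod (x $ i0))\<^sup>2 \<ge> 0" by simp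
        ultimately show ?thesis using xp by linarith
      next
        case True
        then have "(cmod (x $ i0))\<^sup>2 \<le> - Re (herm x x)" using le_r[of x] hr[OF x(1)] ij(3) by (simp add: in_range_Inr)
        then have "t\<^sup>2 * (cmod (x $ i0))\<^sup>2 \<le> t\<^sup>2 * (- Re (herm x x))" by (intro mult_left_mono) auto
        also have "\<dots> < 1 * (- Re (herm x x))" using t2 xp by (intro mult_strict_right_mono) auto
        finally show ?thesis using hx True by simp
      qed
    qed
  qed
  show "act (?M 1) E0 \<notin> D"
  proof
    assume "act (?M 1) E0 \<in> D"
    then obtain A B where AB: "vec.subspace A" "vec.subspace B" "A \<subseteq> act (?M 1) E0" "B \<subseteq> act (?M 1) E0"
      "vec.dim A = r" "vec.dim B = r'" "pos_on A" "neg_on B" unfolding flag_domain_iff by (elim conjE exE) (rule that)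
    have dV: "vec.dim (act (?M 1) E0) = r + r'" by (simp add: dim_act[OF iM] card_I0)
    have sV: "vec.subspace (act (?M 1) E0)" by (simp add: subspace_act)
    show False
    proof (cases "i0 \<in> range Inl")
      case True
      \<comment> \<open>The form is nonpositive on the image of these coordinates, the null vector
        included. That image has dimension \<open>r' + 1\<close> and leaves no room for a positive
        subspace of dimension \<open>r\<close>; the other case is symmetric.\<close>
      let ?J = "insert i0 (I0 \<inter> range Inr)"
      let ?Q = "act (?M 1) (coord_space ?J)"
      have JE: "coord_space ?J \<subseteq> E0" using ij by (intro coord_space_mono) auto
      have "i0 \<notin> I0 \<inter> range Inr" using True in_range_Inr by blast
      then have dQ: "vec.dim ?Q = Suc r'" using I0 by (simp add: dim_act[OF iM])
      have "Re (herm w w) \<le> 0" if w: "w \<in> ?Q" for w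
      proof -
        obtain x where x: "x \<in> coord_space ?J" "w = ?M 1 *v x" using w by (auto simp: act_def)
        obtain b where b: "i0 = Inl b" using True by blast
        have "(cmod (x $ Inl a))\<^sup>2 = (if a = b then (cmod (x $ i0))\<^sup>2 else 0)" for a
          using x(1) b by (auto simp: coord_space_def)
        then have "(\<Sum>a\<in>UNIV. (cmod (x $ Inl a))\<^sup>2) = (cmod (x $ i0))\<^sup>2" by simp
        then have "Re (herm x x) \<le> (cmod (x $ i0))\<^sup>2" by (simp add: Re_herm_self sum_nonneg)
        then show ?thesis using h[of x 1] JE x True ij(3) by auto
      qed
      then have nQ: "\<forall>w\<in>?Q. Re (herm w w) \<le> 0" by blast
      have sQ: "vec.subspace ?Q" by (rule subspace_act[OF subspace_coord_space])
      have QE: "?Q \<subseteq> act (?M 1) E0" unfolding act_def by (rule image_mono[OF JE])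
      have "vec.dim A + vec.dim ?Q \<le> vec.dim (act (?M 1) E0)"
        using nQ by (intro pos_neg_dim_le[OF AB(1) sQ sV AB(3) QE AB(7)]) blast
      then have "r + Suc r' \<le> r + r'" by (simp only: AB(5) dQ dV)
      then show False by simp
    next
      case False
      let ?J = "insert i0 (I0 \<inter> range Inl)"
      let ?Q = "act (?M 1) (coord_space ?J)"
      have JE: "coord_space ?J \<subseteq> E0" using ij by (intro coord_space_mono) auto
      have "i0 \<notin> I0 \<inter> range Inl" using False by blast
      then have dQ: "vec.dim ?Q = Suc r" using I0 by (simp add: dim_act[OF iM])
      have "Re (herm w w) \<ge> 0" if w: "w \<in> ?Q" for w
      proof -
        obtain x where x: "x \<in> coord_space ?J" "w = ?M 1 *v x" using w by (auto simp: act_def)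
        obtain b where b: "i0 = Inr b" using False by (cases i0) auto
        have "(cmod (x $ Inr a))\<^sup>2 = (if a = b then (cmod (x $ i0))\<^sup>2 else 0)" for a
          using x(1) b by (auto simp: coord_space_def)
        then have "(\<Sum>a\<in>UNIV. (cmod (x $ Inr a))\<^sup>2) = (cmod (x $ i0))\<^sup>2" by simp
        then have "- (cmod (x $ i0))\<^sup>2 \<le> Re (herm x x)" by (simp add: Re_herm_self sum_nonneg)
        then show ?thesis using h[of x 1] JE x False ij(3) by auto
      qed
      then have nQ: "\<forall>w\<in>?Q. Re (herm w w) \<ge> 0" by blast
      have sQ: "vec.subspace ?Q" by (rule subspace_act[OF subspace_coord_space])
      have QE: "?Q \<subseteq> act (?M 1) E0" unfolding act_def by (rule image_mono[OF JE])
      have "vec.dim ?Q + vec.dim B \<le> vec.dim (act (?M 1) E0)"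
        using nQ by (intro neg_pos_dim_le[OF sQ AB(2) sV QE AB(4) AB(8)]) blast
      then have "Suc r + r' \<le> r + r'" by (simp only: AB(6) dQ dV)
      then show False by simp
    qed
  qed
qed

text \<open>Guards against a minimum over the empty set. Without frontier points, connectedness
  would keep the path from a point of \<open>C0\<close> inside \<open>\<Union>B\<close> for all
  \<open>t < 1\<close>. Its endpoint would then lie on a cycle in the closure of \<open>B\<close>,
  which is contained in \<open>D\<close>, although the endpoint is not in \<open>D\<close>.\<close>

lemma frontier_nonempty:
  assumes B: "openin (M_D_topology D C0) B" "C0 \<in> B"
    and cpt: "compactin (M_D_topology D C0) (M_D_topology D C0 closure_of B)"
  shows "subtopology (gr_topology (r + r')) D frontier_of (\<Union>B) \<noteq> {}"
proof
  let ?X = "subtopology (gr_topology (r + r')) D"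
  assume fr: "?X frontier_of (\<Union>B) = {}"
  have BM: "B \<subseteq> MD" using B openin_MD_topology by blast
  obtain i0 j0 where ij: "i0 \<in> I0" "j0 \<notin> I0" "(i0 \<in> range Inl) \<noteq> (j0 \<in> range Inl)" by (rule exists_opposite_pair)
  define G where "G t = T0 ** (mat 1 + mu j0 i0 (of_real t))" for t :: real
  define h where "h t = act (G t) E0" for t :: real
  have ne: "i0 \<noteq> j0" using ij by auto
  have iG: "invertible (G t)" for t unfolding G_def
    by (intro invertible_mult invertible_T0 square_zero_invertible)
      (use ne in \<open>simp add: matrix_eq matrix_vector_mul_assoc[symmetric] mu_mv axis_def vec_eq_iff\<close>)
  have hD: "h t \<in> D" if "0 \<le> t" "t < 1" for t
    unfolding h_def G_def act_mult by (intro act_flag_domain[OF T0] path_leaves_D(1)[OF ij] that)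
  have h1: "h 1 \<notin> D"
  proof
    assume "h 1 \<in> D"
    then have "act (matrix_inv T0) (h 1) \<in> D" by (intro act_flag_domain preserves_herm_inv T0)
    then have "act (mat 1 + mu j0 i0 1) E0 \<in> D" unfolding h_def G_def act_mult by (simp add: invertible_T0)
    then show False using path_leaves_D(2)[OF ij] by blast
  qed
  have hG: "h t \<in> Gr (r + r')" for t unfolding h_def by (rule act_Gr[OF iG E0_Gr])
  have cG: "(G \<longlongrightarrow> G t) (nhds t)" for t
  proof -
    have "((\<lambda>t. mu j0 i0 (of_real t)) \<longlongrightarrow> mu j0 i0 (of_real t)) (nhds t)"
    proof (rule vec_tendstoI, rule vec_tendstoI)
      fix a b
      have "((\<lambda>t. complex_of_real t) \<longlongrightarrow> of_real t) (nhds t)" by (intro tendsto_intros filterlim_ident)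
      then show "((\<lambda>t. mu j0 i0 (of_real t) $ a $ b) \<longlongrightarrow> mu j0 i0 (of_real t) $ a $ b) (nhds t)"
        by (cases "a = j0 \<and> b = i0") (auto simp: mu_def)
    qed
    then show ?thesis unfolding G_def by (intro tendsto_intros)
  qed
  have near: "\<forall>\<^sub>F s in nhds t. h s \<in> U" if U: "openin (gr_topology (r + r')) U" "h t \<in> U" for U t
  proof -
    have "((\<lambda>s. G s ** matrix_inv (G t)) \<longlongrightarrow> G t ** matrix_inv (G t)) (nhds t)" by (intro tendsto_intros cG)
    then have "((\<lambda>s. G s ** matrix_inv (G t)) \<longlongrightarrow> mat 1) (nhds t)" by (simp add: matrix_inv_right iG)
    from eventually_compose_filterlim[OF eventually_act_openin_gr[OF U] this]
    show ?thesis by (simp add: h_def act_mult[of _ "matrix_inv (G t)"] iG)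
  qed
  have opn: "open {t. h t \<in> U}" if U: "openin (gr_topology (r + r')) U" for U
  proof (subst open_subopen, intro ballI)
    fix t assume "t \<in> {t. h t \<in> U}"
    then show "\<exists>S. open S \<and> t \<in> S \<and> S \<subseteq> {t. h t \<in> U}" using near[OF U, of t] unfolding eventually_nhds by blast
  qed
  have "continuous_map (top_of_set {0..<1}) ?X h"
    unfolding continuous_map_def
  proof (intro conjI funcsetI allI impI)
    fix t :: real assume "t \<in> topspace (top_of_set {0..<1})"
    then show "h t \<in> topspace ?X" using hD hG by (simp add: topspace_gr_topology)
  next
    fix U assume "openin ?X U"
    then obtain U1 where U1: "openin (gr_topology (r + r')) U1" "U = U1 \<inter> D" unfolding openin_subtopology by blast
    have "{t \<in> topspace (top_of_set {0..<1}). h t \<in> U} = {0..<1} \<inter> {t. h t \<in> U1}" using hD by (auto simp: U1(2))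
    then show "openin (top_of_set {0..<1}) {t \<in> topspace (top_of_set {0..<1}). h t \<in> U}"
      using openin_open_Int[OF opn[OF U1(1)]] by simp
  qed
  moreover have "connectedin (top_of_set {0..<1::real}) {0..<1}"
    by (simp add: connectedin_subtopology convex_connected)
  ultimately have conn: "connectedin ?X (h ` {0..<1})" by (rule connectedin_continuous_map_image)
  have "h 0 \<in> C0"
  proof -
    have "mu j0 i0 0 = 0" by (simp add: mu_def vec_eq_iff)
    then have "h 0 = act T0 E0" by (simp add: h_def G_def)
    then show ?thesis using E0_Cstd unfolding C0 act_cycle_def by blast
  qed
  then have meet: "h ` {0..<1} \<inter> \<Union>B \<noteq> {}" using B(2) by force
  have nofr: "h ` {0..<1} \<inter> ?X frontier_of (\<Union>B) = {}" using fr by simp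
  have sub: "h ` {0..<1} - \<Union>B = {}"
  proof (rule ccontr)
    assume "h ` {0..<1} - \<Union>B \<noteq> {}"
    from connectedin_Int_frontier_of[OF conn meet this] nofr show False by (rule notE)
  qed
  have "\<exists>C\<in>M_D_topology D C0 closure_of B. h 1 \<in> C"
  proof -
    have "W \<inter> \<Union>B \<noteq> {}" if W: "openin (gr_topology (r + r')) W" "h 1 \<in> W" for W
    proof -
      obtain d where d: "d > 0" "\<And>s. dist s 1 < d \<Longrightarrow> h s \<in> W" using near[OF W] unfolding eventually_nhds_metric by blast
      define s where "s = max 0 (1 - d / 2)"
      have "s \<in> {0..<1}" "dist s 1 < d" using d(1) by (auto simp: s_def dist_real_def)
      then have "h s \<in> W" "h s \<in> \<Union>B" using d(2) sub by blast+
      then show ?thesis by blast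
    qed
    then obtain C where "C \<in> M_D_topology D C0 closure_of B" "h 1 \<in> C"
      by (rule closure_incidence[OF BM cpt hG])
    then show ?thesis by blast
  qed
  then obtain C where C: "C \<in> M_D_topology D C0 closure_of B" "h 1 \<in> C" by blast
  have "C \<in> MD" using closure_of_subset_topspace[of "M_D_topology D C0" B] C(1) by (simp only: topspace_MD) (rule subsetD)
  then have "C \<subseteq> D" using MD_subset by blast
  then show False using h1 C(2) by blast
qed

end

section \<open>The tangent functional at a boundary cycle\<close>

context framed_cycle
begin

text \<open>\<open>L\<close> is the differential at the identity of the boundary defining function
  applied to \<open>act_cycle y C\<close>. It is nonzero because the boundary is smooth, and if
  \<open>L X \<noteq> 0\<close> the function becomes negative along \<open>1 + t X\<close> for small
  \<open>t\<close> of one sign.\<close>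

lemma tangent_functional:
  assumes B: "openin (M_D_topology D C0) B" "smooth_boundary D C0 B"
    and C: "C \<in> M_D_topology D C0 frontier_of B"
  obtains L X0 where "linear L" "L X0 \<noteq> (0::real)"
    "\<forall>X e. L X \<noteq> 0 \<longrightarrow> e > 0 \<longrightarrow> (\<exists>t. \<bar>t\<bar> < e \<and> act_cycle (mat 1 + t *\<^sub>R X) C \<in> B)"
proof -
  let ?X = "M_D_topology D C0"
  have CB: "C \<notin> B" and Ccl: "C \<in> ?X closure_of B"
    using C B(1) by (simp_all add: frontier_of_def interior_of_openin)
  have CM: "C \<in> MD" using Ccl closure_of_subset_topspace[of ?X B] topspace_MD by blast
  have CZ: "C \<in> M_Z C0" using CM MD_subset by blast
  have subC: "\<forall>V\<in>C. vec.subspace V" using cycle_points_Gr[OF CZ] by (simp add: Gr_def)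
  obtain U \<rho> where U: "openin ?X U" "C \<in> U" "smooth_on_cycles C0 U \<rho>" "nonzero_differential C0 \<rho> C"
    "B \<inter> U = {C' \<in> U. \<rho> C' < 0}" using bspec[OF B(2)[unfolded smooth_boundary_def] C] by (elim exE conjE) (rule that)
  obtain \<gamma> l where \<gamma>: "\<And>t::real. \<gamma> t \<in> SL" "\<gamma> differentiable (at 0)" "act_cycle (\<gamma> 0) C0 = C"
    "((\<lambda>t. \<rho> (act_cycle (\<gamma> t) C0)) has_real_derivative l) (at 0)" "l \<noteq> 0"
    using U(4) unfolding nonzero_differential_def by (elim exE conjE) (rule that, simp_all)
  define g where "g = \<gamma> 0"
  have g: "g \<in> SL" "act_cycle g C0 = C" using \<gamma> by (simp_all add: g_def)
  have ig: "invertible g" by (rule SL_invertible[OF g(1)])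
  have "act_cycle g C0 \<in> U" using g(2) U(2) by simp
  with U(3) g(1) have "\<exists>W f. open W \<and> g \<in> W \<and> (\<forall>k. Ck_on k W f) \<and> (\<forall>h\<in>W \<inter> SL. f h = \<rho> (act_cycle h C0))"
    unfolding smooth_on_cycles_def by (elim ballE impE) auto
  then obtain W f where W: "open W" "g \<in> W" "\<forall>k. Ck_on k W f" "\<forall>h\<in>W \<inter> SL. f h = \<rho> (act_cycle h C0)"
    by (elim exE conjE) (rule that)
  have fd: "f differentiable (at g)" using W(2) W(3)[THEN spec, of "Suc 0"] by simp
  \<comment> \<open>Arbitrary matrices are rescaled into \<open>SL\<close> first, since
    \<open>f\<close> represents the defining function only on \<open>SL\<close>.\<close>
  define \<phi> where "\<phi> y = sl_norm y ** g" for y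
  have \<phi>1: "\<phi> (mat 1) = g" by (simp add: \<phi>_def)
  have "\<phi> differentiable (at (mat 1))"
  proof -
    obtain A where "(sl_norm has_derivative A) (at (mat 1 :: complex^('p + 'q)^('p + 'q)))"
      using differentiable_sl_norm_1 unfolding differentiable_def by blast
    from bounded_linear.has_derivative[OF bounded_bilinear.bounded_linear_left[OF bounded_bilinear_matrix_mult] this]
    show ?thesis unfolding \<phi>_def[abs_def] differentiable_def by blast
  qed
  then have fd': "(f \<circ> \<phi>) differentiable (at (mat 1))"
    using fd by (intro differentiable_chain_at) (simp_all add: \<phi>1)
  then obtain L where L: "((f \<circ> \<phi>) has_derivative L) (at (mat 1))" unfolding differentiable_def by blast
  let ?F = "f \<circ> \<phi>"
  have linL: "linear L" by (rule has_derivative_linear[OF L])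
  have evU: "\<forall>\<^sub>F y in nhds (mat 1). act_cycle y C \<in> U" using U(1,2) openin_MD_topology by blast
  have "(\<phi> \<longlongrightarrow> mat 1 ** g) (nhds (mat 1))" unfolding \<phi>_def by (intro tendsto_intros tendsto_sl_norm)
  then have evW: "\<forall>\<^sub>F y in nhds (mat 1). \<phi> y \<in> W" using W(1,2) topological_tendstoD by fastforce
  have evf: "\<forall>\<^sub>F y in nhds (mat 1). ?F y = \<rho> (act_cycle y C)"
    using evW eventually_invertible_nhds[OF invertible_mat_1]
  proof eventually_elim
    case (elim y)
    have "\<phi> y \<in> SL" using sl_norm_SL[OF elim(2)] g(1) by (simp add: \<phi>_def SL_def det_mul)
    moreover have "act_cycle (\<phi> y) C0 = act_cycle y C"
      by (simp add: \<phi>_def act_cycle_mult g(2) act_cycle_sl_norm[OF subC])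
    ultimately show ?case using W(4) elim(1) by simp
  qed
  have evB: "\<forall>\<^sub>F y in nhds (mat 1). act_cycle y C \<in> B \<longleftrightarrow> ?F y < 0"
    using evU evf
  proof eventually_elim
    case (elim y)
    then have "act_cycle y C \<in> B \<longleftrightarrow> act_cycle y C \<in> B \<inter> U" by blast
    then show ?case using U(5) elim by simp
  qed
  \<comment> \<open>\<open>C\<close> is outside \<open>B\<close>, so the value is not negative; a
    positive value would persist near \<open>C\<close> and separate it from \<open>B\<close>,
    although \<open>C\<close> lies in the closure.\<close>
  have "?F (mat 1) \<ge> 0" using eventually_nhds_x_imp_x[OF evB] CB by simp
  moreover have "\<not> ?F (mat 1) > 0"
  proof
    assume "?F (mat 1) > 0"
    moreover have "isCont ?F (mat 1)" by (rule differentiable_imp_continuous_within[OF fd'])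
    then have "(?F \<longlongrightarrow> ?F (mat 1)) (nhds (mat 1))" unfolding isCont_def tendsto_at_iff_tendsto_nhds .
    ultimately have "\<forall>\<^sub>F y in nhds (mat 1). ?F y > 0" by (intro order_tendstoD)
    with evB have "\<forall>\<^sub>F y in nhds (mat 1). act_cycle y C \<notin> B" by eventually_elim simp
    with eventually_invertible_nhds[OF invertible_mat_1]
    have "\<forall>\<^sub>F y in nhds (mat 1). invertible y \<and> act_cycle y C \<notin> B" by (rule eventually_conj)
    then obtain S where S: "open S" "mat 1 \<in> S" "\<forall>y\<in>S. invertible y \<and> act_cycle y C \<notin> B"
      unfolding eventually_nhds by blast
    have "openin (cycle_topology C0) {act_cycle y C | y. y \<in> S}"
      using S by (intro open_orbit_cycle CZ) auto
    then have oN: "openin ?X ({act_cycle y C | y. y \<in> S} \<inter> MD)"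
      unfolding M_D_topology_def openin_subtopology by blast
    have CN: "C \<in> {act_cycle y C | y. y \<in> S} \<inter> MD"
    proof -
      have "act_cycle (mat 1) C \<in> {act_cycle y C | y. y \<in> S}" using S(2) by blast
      then show ?thesis using CM by simp
    qed
    have "\<forall>N. C \<in> N \<and> openin ?X N \<longrightarrow> (\<exists>y. y \<in> B \<and> y \<in> N)"
      using Ccl unfolding in_closure_of by (rule conjunct2)
    from this[THEN spec, THEN mp, OF conjI[OF CN oN]] show False using S(3) by auto
  qed
  ultimately have F0: "?F (mat 1) = 0" by simp
  have dir: "\<exists>t. \<bar>t\<bar> < e \<and> act_cycle (mat 1 + t *\<^sub>R X) C \<in> B" if X: "L X \<noteq> 0" and e: "e > 0" for X e
  proof -
    let ?p = "\<lambda>t::real. mat 1 + t *\<^sub>R X"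
    have "(?p \<longlongrightarrow> mat 1 + 0 *\<^sub>R X) (nhds 0)" by (intro tendsto_intros filterlim_ident)
    then have "(?p \<longlongrightarrow> mat 1) (nhds 0)" by simp
    from eventually_compose_filterlim[OF evB this]
    obtain e1 where e1: "e1 > 0" "\<And>t. \<bar>t\<bar> < e1 \<Longrightarrow> act_cycle (?p t) C \<in> B \<longleftrightarrow> ?F (?p t) < 0"
      unfolding eventually_nhds_metric by (auto simp: dist_real_def)
    have dp: "(?p has_derivative (\<lambda>t. t *\<^sub>R X)) (at 0)" by (auto intro!: derivative_eq_intros)
    have "(?F has_derivative L) (at (?p 0))" using L by (simp only: scaleR_zero_left add_0_right)
    from has_derivative_compose[OF dp this]
    have "((\<lambda>t. ?F (?p t)) has_derivative (\<lambda>t. L (t *\<^sub>R X))) (at 0)" .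
    then have der: "((\<lambda>t. ?F (?p t)) has_real_derivative L X) (at 0)"
      unfolding has_field_derivative_def
      by (rule has_derivative_eq_rhs) (simp add: fun_eq_iff linear_scale[OF linL])
    show ?thesis
    proof (cases "L X > 0")
      case True
      from DERIV_pos_inc_left[OF der this] obtain d where d: "d > 0" "\<forall>h>0. h < d \<longrightarrow> ?F (?p (0 - h)) < ?F (?p 0)" by blast
      define h where "h = min d (min e e1) / 2"
      have h: "0 < h" "h < d" "h < e" "h < e1" using d e e1 by (auto simp: h_def)
      then have "?F (?p (- h)) < 0" using d(2)[rule_format, of h] F0 by simp
      then show ?thesis using e1(2)[of "- h"] h by (intro exI[of _ "- h"]) simp
    next
      case False
      then have "L X < 0" using X by simp
      from DERIV_neg_dec_right[OF der this] obtain d where d: "d > 0" "\<forall>h>0. h < d \<longrightarrow> ?F (?p (0 + h)) < ?F (?p 0)" by blast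
      define h where "h = min d (min e e1) / 2"
      have h: "0 < h" "h < d" "h < e" "h < e1" using d e e1 by (auto simp: h_def)
      then have "?F (?p h) < 0" using d(2)[rule_format, of h] F0 by simp
      then show ?thesis using e1(2)[of h] h by (intro exI[of _ h]) simp
    qed
  qed
  obtain \<gamma>' where \<gamma>': "(\<gamma> has_derivative \<gamma>') (at 0)" using \<gamma>(2) unfolding differentiable_def by blast
  \<comment> \<open>The curve witnessing the nonzero differential is transported to the identity,
    where its velocity is a matrix on which \<open>L\<close> takes the value
    \<open>l\<close>.\<close>
  let ?\<psi> = "\<lambda>t. \<gamma> t ** matrix_inv g"
  have \<psi>0: "?\<psi> 0 = mat 1" using ig by (simp add: matrix_inv_right flip: g_def)
  have d\<psi>: "(?\<psi> has_derivative (\<lambda>t. \<gamma>' t ** matrix_inv g)) (at 0)"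
    by (rule bounded_linear.has_derivative[OF bounded_bilinear.bounded_linear_left[OF bounded_bilinear_matrix_mult] \<gamma>'])
  have dF: "((\<lambda>t. ?F (?\<psi> t)) has_derivative (\<lambda>t. L (\<gamma>' t ** matrix_inv g))) (at 0)"
    by (rule has_derivative_compose[OF d\<psi>]) (simp only: \<psi>0 L)
  have evF: "\<forall>\<^sub>F t in nhds 0. ?F (?\<psi> t) = \<rho> (act_cycle (\<gamma> t) C0)"
  proof -
    have "(?\<psi> \<longlongrightarrow> ?\<psi> 0) (nhds 0)"
      using has_derivative_continuous[OF d\<psi>] unfolding isCont_def tendsto_at_iff_tendsto_nhds[of ?\<psi> 0] .
    then have "(?\<psi> \<longlongrightarrow> mat 1) (nhds 0)" by (simp only: \<psi>0)
    from eventually_compose_filterlim[OF evf this]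
    show ?thesis
    proof eventually_elim
      case (elim t)
      have "act_cycle (?\<psi> t) C = act_cycle (\<gamma> t) C0"
        using ig by (simp add: act_cycle_mult flip: g(2))
      then show ?case using elim by simp
    qed
  qed
  have "((\<lambda>t. \<rho> (act_cycle (\<gamma> t) C0)) has_derivative (\<lambda>t. L (\<gamma>' t ** matrix_inv g))) (at 0)"
  proof (rule has_derivative_transform_eventually[OF dF])
    show "\<forall>\<^sub>F t in at 0. ?F (?\<psi> t) = \<rho> (act_cycle (\<gamma> t) C0)"
      unfolding eventually_at_filter using evF by (rule eventually_mono) (intro impI)
    show "?F (?\<psi> 0) = \<rho> (act_cycle (\<gamma> 0) C0)" by (rule eventually_nhds_x_imp_x[OF evF])
  qed (rule UNIV_I)
  from has_derivative_unique[OF this \<gamma>(4)[unfolded has_field_derivative_def]]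
  have "L (\<gamma>' 1 ** matrix_inv g) = l * 1" by (rule fun_cong)
  then have "L (\<gamma>' 1 ** matrix_inv g) \<noteq> 0" using \<gamma>(5) by simp
  then show ?thesis using dir by (intro that[OF linL]) auto
qed

lemma matrix_eq_sum_mu: "X = (\<Sum>j\<in>UNIV. \<Sum>i\<in>UNIV. mu j i (X $ j $ i))"
proof -
  have "(\<Sum>j\<in>UNIV. \<Sum>i\<in>UNIV. mu j i (X $ j $ i)) $ a $ b = X $ a $ b" for a b
  proof -
    have "(\<Sum>j\<in>UNIV. \<Sum>i\<in>UNIV. mu j i (X $ j $ i)) $ a $ b =
        (\<Sum>j\<in>UNIV. if j = a then (\<Sum>i\<in>UNIV. if i = b then X $ j $ i else 0) else 0)"
      unfolding sum_component mu_def vec_lambda_beta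
      by (intro sum.cong refl) (auto intro!: sum.cong sum.neutral)
    then show ?thesis by simp
  qed
  then show ?thesis by (simp add: vec_eq_iff)
qed

text \<open>Isolates one matrix entry along which the cycle crosses the boundary. The last
  conclusion is the mechanism for sweeping: a point of \<open>C\<close> lies in
  \<open>\<Union>B\<close> as soon as the corresponding subspace is preserved by some
  \<open>X\<close> with \<open>L X \<noteq> 0\<close>.\<close>

lemma normal_direction:
  assumes B: "openin (M_D_topology D C0) B" "smooth_boundary D C0 B"
    and C: "C \<in> M_D_topology D C0 frontier_of B"
    and T: "invertible T" "C = act_cycle T (Cstd I0)" and p0: "act T E0 \<notin> \<Union>B"
  obtains L j0 i0 c where "linear L" "j0 \<notin> I0" "i0 \<in> I0" "(i0 \<in> range Inl) \<noteq> (j0 \<in> range Inl)"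
    "L (mu j0 i0 c) \<noteq> (0::real)"
    "\<And>j i c. j \<in> I0 \<or> i \<notin> I0 \<Longrightarrow> L (mu j i c) = 0"
    "\<And>X W. L X \<noteq> 0 \<Longrightarrow> act X W \<subseteq> W \<Longrightarrow> W \<in> Cstd I0 \<Longrightarrow> act T W \<in> \<Union>B"
proof -
  have CB: "C \<notin> B" using C B(1) by (simp add: frontier_of_def interior_of_openin)
  obtain L1 X0 where L1: "linear L1" "L1 X0 \<noteq> (0::real)"
    "\<forall>X e. L1 X \<noteq> 0 \<longrightarrow> e > 0 \<longrightarrow> (\<exists>t. \<bar>t\<bar> < e \<and> act_cycle (mat 1 + t *\<^sub>R X) C \<in> B)"
    by (rule tangent_functional[OF B C])
  \<comment> \<open>Conjugation by \<open>T\<close> moves the functional to the standard cycle,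
    where stabilisers can be read off in coordinates.\<close>
  define L where "L X = L1 (T ** X ** matrix_inv T)" for X
  have "linear (\<lambda>X. T ** X ** matrix_inv T)"
    by (intro linearI) (simp_all add: matrix_add_ldistrib matrix_add_rdistrib 
       matrix_mult_scaleR)
  from linear_compose[OF this L1(1)] have linL: "linear L" by (simp add: L_def[abs_def] o_def)
  have move: "\<exists>t. invertible (mat 1 + t *\<^sub>R X) \<and> act_cycle T (act_cycle (mat 1 + t *\<^sub>R X) (Cstd I0)) \<in> B"
    if X: "L X \<noteq> 0" for X
  proof -
    have "((\<lambda>t::real. mat 1 + t *\<^sub>R X) \<longlongrightarrow> mat 1 + 0 *\<^sub>R X) (nhds 0)" by (intro tendsto_intros filterlim_ident)
    then have "((\<lambda>t::real. mat 1 + t *\<^sub>R X) \<longlongrightarrow> mat 1) (nhds 0)" by simp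
    from eventually_compose_filterlim[OF eventually_invertible_nhds[OF invertible_mat_1] this]
    obtain e where e: "e > 0" "\<And>t. \<bar>t\<bar> < e \<Longrightarrow> invertible (mat 1 + t *\<^sub>R X)"
      unfolding eventually_nhds_metric by (auto simp: dist_real_def)
    obtain t where t: "\<bar>t\<bar> < e" "act_cycle (mat 1 + t *\<^sub>R (T ** X ** matrix_inv T)) C \<in> B"
      using L1(3) X[unfolded L_def] e(1) by blast
    have "mat 1 + t *\<^sub>R (T ** X ** matrix_inv T) = T ** (mat 1 + t *\<^sub>R X) ** matrix_inv T"
      using T(1) by (simp add: matrix_add_ldistrib matrix_add_rdistrib matrix_inv_right
         matrix_mult_scaleR)
    then have "act_cycle (mat 1 + t *\<^sub>R (T ** X ** matrix_inv T)) C = act_cycle T (act_cycle (mat 1 + t *\<^sub>R X) (Cstd I0))"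
      using T by (simp add: act_cycle_mult)
    then show ?thesis using t e(2) by auto
  qed
  have zero: "L (mu j i c) = 0" if ji: "(j \<in> range Inl) = (i \<in> range Inl)" for j i c
  proof (rule ccontr)
    assume "L (mu j i c) \<noteq> 0"
    from move[OF this] obtain t where t: "invertible (mat 1 + t *\<^sub>R mu j i c)"
      "act_cycle T (act_cycle (mat 1 + t *\<^sub>R mu j i c) (Cstd I0)) \<in> B" by blast
    have "prp ** mu j i c = mu j i c ** prp"
      using ji by (auto simp: matrix_eq matrix_vector_mul_assoc[symmetric] mu_mv vec_eq_iff prp_mv axis_def)
    then have "prp ** (mat 1 + t *\<^sub>R mu j i c) = (mat 1 + t *\<^sub>R mu j i c) ** prp"
      by (simp add: matrix_add_ldistrib matrix_add_rdistrib
         matrix_mult_scaleR)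
    then have "act_cycle (mat 1 + t *\<^sub>R mu j i c) (Cstd I0) = Cstd I0" by (rule block_act_cycle_Cstd[OF t(1)])
    then show False using t(2) CB T(2) by simp
  qed
  \<comment> \<open>If \<open>X\<close> preserves \<open>W\<close>, the invertible matrix
    \<open>1 + t X\<close> maps \<open>W\<close> onto itself, so the cycle of \<open>B\<close>
    obtained by moving \<open>C\<close> along \<open>X\<close> still passes through
    \<open>act T W\<close>.\<close>
  have swept: "act T W \<in> \<Union>B" if W: "L X \<noteq> 0" "act X W \<subseteq> W" "W \<in> Cstd I0" for X W
  proof -
    obtain t where t: "invertible (mat 1 + t *\<^sub>R X)" "act_cycle T (act_cycle (mat 1 + t *\<^sub>R X) (Cstd I0)) \<in> B"
      using move[OF W(1)] by blast
    have sW: "vec.subspace W" using W(3) by (auto simp: Cstd_def subspace_act)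
    have "act (mat 1 + t *\<^sub>R X) W \<subseteq> W"
    proof
      fix y assume "y \<in> act (mat 1 + t *\<^sub>R X) W"
      then obtain x where x: "x \<in> W" "y = (mat 1 + t *\<^sub>R X) *v x" by (auto simp: act_def)
      have "X *v x \<in> W" using W(2) x(1) by (auto simp: act_def)
      moreover have "y = x + of_real t *s (X *v x)"
        by (simp add: x(2) matrix_vector_mult_add_rdistrib scaleR_eq_scale[symmetric]
            bounded_bilinear.scaleR_left[OF bounded_bilinear_matrix_vector_mult])
      ultimately show "y \<in> W" using x(1) sW by (simp add: vec.subspace_add vec.subspace_scale)
    qed
    then have "act (mat 1 + t *\<^sub>R X) W = W" using sW by (intro act_mono_eq t(1)) auto
    then have "W \<in> act_cycle (mat 1 + t *\<^sub>R X) (Cstd I0)" using W(3) unfolding act_cycle_def by force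
    then have "act T W \<in> act_cycle T (act_cycle (mat 1 + t *\<^sub>R X) (Cstd I0))" unfolding act_cycle_def[of T] by (rule imageI)
    then show ?thesis using t(2) by blast
  qed
  have "L (matrix_inv T ** X0 ** T) = L1 X0"
    using T(1) by (simp add: L_def matrix_mul_assoc matrix_inv_right) (simp add: matrix_inv_right flip: matrix_mul_assoc)
  then have "(\<Sum>j\<in>UNIV. \<Sum>i\<in>UNIV. L (mu j i ((matrix_inv T ** X0 ** T) $ j $ i))) \<noteq> 0"
    using L1(2) by (subst (asm) matrix_eq_sum_mu) (simp add: linear_sum[OF linL])
  then obtain j0 i0 where ji: "L (mu j0 i0 ((matrix_inv T ** X0 ** T) $ j0 $ i0)) \<noteq> 0"
    by (meson sum.neutral)
  have block: "(i0 \<in> range Inl) \<noteq> (j0 \<in> range Inl)" using zero ji by blast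
  have zero': "L (mu j i c) = 0" if "j \<in> I0 \<or> i \<notin> I0" for j i c
  proof (rule ccontr)
    have "act (mu j i c) E0 \<subseteq> E0" using that by (auto simp: act_def mu_mv) (auto simp: coord_space_def axis_def)
    moreover assume "L (mu j i c) \<noteq> 0"
    ultimately show False using swept[OF _ _ E0_Cstd] p0 by blast
  qed
  then have "j0 \<notin> I0" "i0 \<in> I0" using ji by blast+
  from that[OF linL this block ji zero' swept] show ?thesis .
qed

end

section \<open>Polydisks in a boundary cycle\<close>

lemma dim_independent_family:
  fixes D :: "nat \<Rightarrow> complex^'m::finite"
  assumes ind: "\<And>h k. (\<Sum>i<d. h i *s D i) = 0 \<Longrightarrow> k < d \<Longrightarrow> h k = 0"
  shows "vec.dim (D ` {..<d}) = d"
proof -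
  have inj: "inj_on D {..<d}"
  proof (rule inj_onI, rule ccontr)
    fix a b assume ab: "a \<in> {..<d}" "b \<in> {..<d}" "D a = D b" "a \<noteq> b"
    let ?h = "\<lambda>i. (if i = a then 1 else 0) - (if i = b then 1 else 0) :: complex"
    have "(\<Sum>i<d. ?h i *s D i) = (\<Sum>i<d. (if i = a then D i else 0) - (if i = b then D i else 0))"
      by (intro sum.cong refl) (auto simp: vec_eq_iff)
    also have "\<dots> = D a - D b" using ab by (simp add: sum_subtractf)
    finally have "(\<Sum>i<d. ?h i *s D i) = 0" using ab by simp
    from ind[OF this, of a] ab show False by simp
  qed
  have "vec.independent (D ` {..<d})"
  proof
    assume "vec.dependent (D ` {..<d})"
    then obtain u v where u: "v \<in> D ` {..<d}" "u v \<noteq> 0" "(\<Sum>v\<in>D ` {..<d}. u v *s v) = 0"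
      by (subst (asm) vec.dependent_finite) auto
    have "(\<Sum>i<d. u (D i) *s D i) = 0" using u(3) inj by (simp add: sum.reindex)
    then have "u (D k) = 0" if "k < d" for k using ind[of "\<lambda>i. u (D i)" k] that by simp
    then show False using u by auto
  qed
  then show ?thesis using inj by (simp add: vec.dim_eq_card_independent card_image)
qed

section \<open>Finiteness of the sets of polydisk dimensions\<close>

abbreviation polydisk_dims ::
  "nat \<Rightarrow> (complex^'n::finite) set set \<Rightarrow> (complex^'n) set set \<Rightarrow> (complex^'n) set \<Rightarrow> nat set" where
  "polydisk_dims k Y C p0 \<equiv> {d. \<exists>\<rho>>0. \<exists>F. gr_holomorphic_on k d F (closed_polydisk d \<rho>) \<and>
      F ` closed_polydisk d \<rho> \<subseteq> C \<and> F (\<lambda>_. 0) = p0 \<and>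
      (\<forall>z\<in>closed_polydisk d \<rho>. gr_differential_rank k d F z d) \<and>
      F ` (closed_polydisk d \<rho> - {\<lambda>_. 0}) \<subseteq> Y}"

text \<open>The rank condition at the centre produces a space of dimension \<open>d\<close> inside
  the flattened matrices, whose dimension is a crude bound.\<close>

lemma polydisk_dims_bounded:
  "polydisk_dims k Y C (p0 :: (complex^'n::finite) set) \<subseteq> {..CARD('n \<times> 'n)}"
proof
  fix d assume "d \<in> polydisk_dims k Y C p0"
  then obtain \<rho> and F :: "(nat \<Rightarrow> complex) \<Rightarrow> (complex^'n) set"
    where F: "\<rho> > 0" "\<forall>z\<in>closed_polydisk d \<rho>. gr_differential_rank k d F z d"
    by (elim CollectE exE conjE) (rule that)
  have "(\<lambda>_. 0) \<in> closed_polydisk d \<rho>" using F(1) by (simp add: closed_polydisk_def cspace_def)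
  with F(2) have "gr_differential_rank k d F (\<lambda>_. 0) d" by (rule bspec)
  then obtain D :: "nat \<Rightarrow> complex^('n \<times> 'n)" where "vec.dim (D ` {..<d}) = d"
    unfolding gr_differential_rank_def by (elim exE conjE) (rule that)
  then show "d \<in> {..CARD('n \<times> 'n)}" using dim_subset_UNIV_cart_gen[of "D ` {..<d}"] by simp
qed

lemma finite_polydisk_dims: "finite (polydisk_dims k Y C p0)"
  by (rule finite_subset[OF polydisk_dims_bounded]) simp

text \<open>There may be infinitely many supporting cycles, so finiteness is shown for the values
  instead. The default \<open>Max {}\<close> accounts for sets \<open>C\<close> without any
  admissible polydisk, such as those missing \<open>p0\<close>.\<close>

lemma c_cycle_values:
  "(\<lambda>C. c_cycle k Y C (p0 :: (complex^'n::finite) set)) ` \<C> \<subseteq> insert (Max {}) {..CARD('n \<times> 'n)}"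
proof (rule image_subsetI)
  fix C
  show "c_cycle k Y C p0 \<in> insert (Max {}) {..CARD('n \<times> 'n)}"
  proof (cases "polydisk_dims k Y C p0 = {}")
    case True then show ?thesis unfolding c_cycle_def by (simp only: insert_iff) simp
  next
    case False
    then have "c_cycle k Y C p0 \<in> polydisk_dims k Y C p0"
      unfolding c_cycle_def by (rule Max_in[OF finite_polydisk_dims])
    then show ?thesis using subsetD[OF polydisk_dims_bounded] by (intro insertI2)
  qed
qed

context framed_cycle
begin

text \<open>The family \<open>T (1 + N z) E0\<close> is defined on all of \<open>cspace d\<close>,
  so the radius one is a mere choice. Only entries that keep \<open>1 + N z\<close> block diagonal
  are varied, which keeps the family inside \<open>C\<close>.\<close>

lemma cycle_polydisk:
  assumes B: "openin (M_D_topology D C0) B" "smooth_boundary D C0 B"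
    and C: "C \<in> M_D_topology D C0 frontier_of B" and p0: "p0 \<in> C" "p0 \<notin> \<Union>B"
  obtains d F where "min (r + CARD('q) - r') (CARD('p) - r + r') \<le> d"
    "gr_holomorphic_on (r + r') d F (closed_polydisk d 1)" "F ` closed_polydisk d 1 \<subseteq> C" "F (\<lambda>_. 0) = p0"
    "\<forall>z\<in>closed_polydisk d 1. gr_differential_rank (r + r') d F z d"
    "F ` (closed_polydisk d 1 - {\<lambda>_. 0}) \<subseteq> \<Union>B"
proof -
  have CM: "C \<in> MD"
    using C closure_of_subset_topspace[of "M_D_topology D C0" B] topspace_MD by (auto simp: frontier_of_def)
  then have CZ: "C \<in> M_Z C0" using MD_subset by blast
  obtain T where T: "invertible T" "C = act_cycle T (Cstd I0)" "p0 = act T E0"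
    by (rule point_frame[OF CZ p0(1)])
  obtain L j0 i0 c where L: "linear L" "j0 \<notin> I0" "i0 \<in> I0" "(i0 \<in> range Inl) \<noteq> (j0 \<in> range Inl)"
    "L (mu j0 i0 c) \<noteq> (0::real)"
    "\<And>j i c. j \<in> I0 \<or> i \<notin> I0 \<Longrightarrow> L (mu j i c) = 0"
    "\<And>X W. L X \<noteq> 0 \<Longrightarrow> act X W \<subseteq> W \<Longrightarrow> W \<in> Cstd I0 \<Longrightarrow> act T W \<in> \<Union>B"
    using normal_direction[OF B C T(1,2) p0(2)[unfolded T(3)]] by (metis (no_types))
  \<comment> \<open>\<open>S1\<close> indexes the entries of column \<open>i0\<close> whose row lies
    in the block of \<open>i0\<close>, and \<open>S2\<close> those of row \<open>j0\<close> whose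
    column lies in the block of \<open>j0\<close>. As the two blocks differ, one index
    \<open>s\<close> determines the position \<open>(rw s, cl s)\<close>, and
    \<open>(j0, i0)\<close> itself does not occur.\<close>
  define S1 where "S1 = {s. s \<notin> I0 \<and> (s \<in> range Inl) = (i0 \<in> range Inl)}"
  define S2 where "S2 = {s \<in> I0. (s \<in> range Inl) = (j0 \<in> range Inl)}"
  define S where "S = S1 \<union> S2"
  define rw where "rw s = (if s \<in> I0 then j0 else s)" for s
  define cl where "cl s = (if s \<in> I0 then s else i0)" for s
  define d where "d = card S"
  have rw: "rw s \<notin> I0" and cl: "cl s \<in> I0" and rc: "(rw s \<in> range Inl) = (cl s \<in> range Inl)" if "s \<in> S" for s
    using that L(2,3) by (auto simp: S_def S1_def S2_def rw_def cl_def)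
  have uniq: "rw s = rw s' \<and> cl s = cl s' \<longleftrightarrow> s = s'" if "s \<in> S" "s' \<in> S" for s s'
    using that L(2-4) by (auto simp: S_def S1_def S2_def rw_def cl_def split: if_splits)
  have d_ge: "min (r + CARD('q) - r') (CARD('p) - r + r') \<le> d"
  proof -
    have dd: "d = card S1 + card S2"
      unfolding d_def S_def by (rule card_Un_disjoint) (auto simp: S1_def S2_def)
    show ?thesis
    proof (cases "i0 \<in> range Inl")
      case True
      have "S1 = range Inl - I0 \<inter> range Inl" "S2 = I0 \<inter> range Inr"
        using True L(4) in_range_Inr by (auto simp: S1_def S2_def)
      then have "d = CARD('p) - r + r'"
        using I0 by (simp add: dd card_Diff_subset card_range_Inl)
      then show ?thesis by simp
    next
      case False
      have "S1 = range Inr - I0 \<inter> range Inr" "S2 = I0 \<inter> range Inl"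
        using False L(4) in_range_Inr by (auto simp: S1_def S2_def)
      moreover have "card (range (Inr :: 'q \<Rightarrow> 'p + 'q)) = CARD('q)" by (simp add: card_image)
      ultimately have "d = CARD('q) - r' + r"
        using I0 by (simp add: dd card_Diff_subset)
      \<comment> \<open>Natural subtraction truncates, so regrouping
        \<open>CARD('q) - r' + r\<close> as \<open>r + CARD('q) - r'\<close> uses this
        bound.\<close>
      moreover have "r' \<le> CARD('q)"
        using card_mono[of "range (Inr :: 'q \<Rightarrow> 'p + 'q)" "I0 \<inter> range Inr"] I0 by (simp add: card_image)
      ultimately show ?thesis by simp
    qed
  qed
  obtain e where e: "bij_betw e {..<d} S"
    using ex_bij_betw_nat_finite[of S] by (auto simp: d_def atLeast0LessThan)
  then have eS: "e k \<in> S" if "k < d" for k using that by (auto simp: bij_betw_def)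
  have einj: "e k = e k' \<longleftrightarrow> k = k'" if "k < d" "k' < d" for k k'
    using e that by (auto simp: bij_betw_def inj_on_def)
  define Nk where "Nk k = mu (rw (e k)) (cl (e k)) 1" for k
  define N where "N z = (\<Sum>k<d. mat (z k) ** Nk k)" for z :: "nat \<Rightarrow> complex"
  have Nmv: "N z *v x = (\<Sum>k<d. axis (rw (e k)) (z k * x $ cl (e k)))" for z x
  proof -
    have "mat (z k) ** Nk k = mu (rw (e k)) (cl (e k)) (z k)" for k
      by (simp add: Nk_def vec_eq_iff mu_def)
    then have "(mat (z k) ** Nk k) *v x = axis (rw (e k)) (z k * x $ cl (e k))" for k
      by (simp only: mu_mv)
    moreover have "N z *v x = (\<Sum>k<d. (mat (z k) ** Nk k) *v x)"
      unfolding N_def by (rule bounded_bilinear.sum_left[OF bounded_bilinear_matrix_vector_mult])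
    ultimately show ?thesis by simp
  qed
  have Nmv_I0: "(N z *v x) $ i = 0" if "i \<in> I0" for z x i
    using that rw[OF eS] by (auto simp: Nmv axis_def sum_component intro!: sum.neutral)
  have N_kill: "N z *v x = 0" if "\<And>i. i \<in> I0 \<Longrightarrow> x $ i = 0" for z x
    using that cl[OF eS] by (auto simp: Nmv intro!: sum.neutral)
  have N_entry: "(N z *v axis (cl (e k)) a) $ rw (e k) = z k * a" if k: "k < d" for z k a
  proof -
    have "(N z *v axis (cl (e k)) a) $ rw (e k) =
        (\<Sum>k'<d. if k' = k then z k * a else 0)"
      unfolding Nmv sum_component
    proof (intro sum.cong refl)
      fix k' assume k': "k' \<in> {..<d}"
      then show "axis (rw (e k')) (z k' * axis (cl (e k)) a $ cl (e k')) $ rw (e k) = (if k' = k then z k * a else 0)"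
        using uniq[OF eS eS, of k' k] einj[of k' k] k by (auto simp: axis_def)
    qed
    then show ?thesis using k by simp
  qed
  \<comment> \<open>Every \<open>N w\<close> maps into the vectors vanishing on \<open>I0\<close>,
    and every \<open>N z\<close> kills those; hence \<open>1 + N z\<close> is unipotent with inverse
    \<open>1 - N z\<close>.\<close>
  have NN: "N z ** N w = 0" for z w
    using N_kill[of "N w *v x" z for x, OF Nmv_I0] by (simp add: matrix_eq matrix_vector_mul_assoc[symmetric])
  have iN: "invertible (mat 1 + N z)" for z by (rule square_zero_invertible[OF NN])
  have prpN: "prp ** (mat 1 + N z) = (mat 1 + N z) ** prp" for z
  proof -
    have "prp *v (N z *v x) = N z *v (prp *v x)" for x
    proof -
      have "prp *v axis (rw (e k)) (z k * x $ cl (e k)) = axis (rw (e k)) (z k * (prp *v x) $ cl (e k))" if "k < d" for k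
        using rc[OF eS[OF that]] by (auto simp: vec_eq_iff prp_mv axis_def)
      then show ?thesis unfolding Nmv by (simp add: vec.sum)
    qed
    then show ?thesis by (simp add: matrix_add_ldistrib matrix_add_rdistrib matrix_eq matrix_vector_mult_add_rdistrib matrix_vector_mul_assoc[symmetric])
  qed
  define W where "W z = act (mat 1 + N z) E0" for z
  have WC: "W z \<in> Cstd I0" for z
    unfolding W_def by (rule block_act_Cstd[OF iN prpN E0_Cstd])
  have Wmem: "v \<in> W z \<longleftrightarrow> (\<exists>x\<in>E0. v = x + N z *v x)" for v z
    by (auto simp: W_def act_def matrix_vector_mult_add_rdistrib)
  define F where "F z = act (T ** (mat 1 + N z)) E0" for z
  have FW: "F z = act T (W z)" for z by (simp add: F_def W_def act_mult)
  have G: "T ** (mat 1 + N z) = T + (\<Sum>k<d. mat (z k) ** (T ** Nk k))" for z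
  proof -
    have "T ** N z = (\<Sum>k<d. T ** (mat (z k) ** Nk k))"
      unfolding N_def by (rule bounded_bilinear.sum_right[OF bounded_bilinear_matrix_mult])
    also have "\<dots> = (\<Sum>k<d. mat (z k) ** (T ** Nk k))"
      by (intro sum.cong refl) (simp add: matrix_mul_assoc mult_mat_commute)
    finally show ?thesis by (simp add: matrix_add_ldistrib)
  qed
  have iG: "invertible (T ** (mat 1 + N z))" for z by (intro invertible_mult T(1) iN)
  have sub: "closed_polydisk d 1 \<subseteq> cspace d" by (auto simp: closed_polydisk_def)
  have hol: "gr_holomorphic_on (r + r') d F (closed_polydisk d 1)"
    unfolding F_def by (rule gr_holomorphic_on_act[OF E0_Gr iG G sub])
  have FC: "F ` closed_polydisk d 1 \<subseteq> C"
    unfolding T(2) act_cycle_def FW using WC by blast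
  have N0: "N (\<lambda>_. 0) = 0" by (simp add: N_def matrix_eq Nk_def vec_eq_iff)
  have F0: "F (\<lambda>_. 0) = p0" by (simp add: F_def N0 T(3))
  have rank: "gr_differential_rank (r + r') d F z d" for z
  proof -
    obtain I A where I: "card I = r + r'" "F z = gr_graph I A"
      using Gr_chart_cover[OF act_Gr[OF iG E0_Gr]] unfolding F_def by blast
    let ?Gi = "matrix_inv (T ** (mat 1 + N z))"
    let ?D = "\<lambda>k. chart_deriv I A (T ** Nk k ** ?Gi)"
    have "has_complex_derivative d (gr_coord I \<circ> F) ?D z"
      using has_complex_derivative_act[where G = "\<lambda>w. T ** (mat 1 + N w)" and V = E0, OF _ iG G, of z I A] I(2)
      unfolding F_def by simp
    moreover have "vec.dim (?D ` {..<d}) = d"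
    proof (rule dim_independent_family)
      fix h k assume h: "(\<Sum>k<d. h k *s ?D k) = 0" and k: "k < d"
      have "(\<Sum>k<d. h k *s ?D k) = chart_deriv I A (\<Sum>k<d. mat (h k) ** (T ** Nk k ** ?Gi))"
        by (simp add: chart_deriv_sum chart_deriv_scale)
      also have "(\<Sum>k<d. mat (h k) ** (T ** Nk k ** ?Gi)) = (\<Sum>k<d. mat (h k) ** (T ** Nk k)) ** ?Gi"
        by (simp add: matrix_mul_assoc bounded_bilinear.sum_left[OF bounded_bilinear_matrix_mult])
      also have "(\<Sum>k<d. mat (h k) ** (T ** Nk k)) = T ** N h"
        using G[of h] by (simp add: matrix_add_ldistrib)
      finally have "chart_deriv I A (T ** N h ** ?Gi) = 0" using h by simp
      from chart_deriv_eq_0[OF this] have sb: "act (T ** N h ** ?Gi) (F z) \<subseteq> F z" unfolding I(2) .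
      \<comment> \<open>A direction in the kernel of the differential preserves \<open>F z\<close>,
        so \<open>N h *v x\<close> lies in \<open>W z\<close>. A vector of \<open>W z\<close> is
        determined by its coordinates in \<open>I0\<close>, and these vanish here.\<close>
      have "N h *v x = 0" if x: "x \<in> E0" for x
      proof -
        have "(T ** (mat 1 + N z)) *v x \<in> F z" using x by (auto simp: F_def act_def)
        then have "(T ** N h ** ?Gi) *v ((T ** (mat 1 + N z)) *v x) \<in> F z" using sb by (auto simp: act_def)
        moreover have "(T ** N h ** ?Gi) *v ((T ** (mat 1 + N z)) *v x) = T *v (N h *v x)"
          using iG[of z] by (simp add: matrix_vector_mul_assoc[symmetric, of "T ** N h"] matrix_vector_mul_assoc[symmetric, of T "N h"])
        ultimately have "N h *v x \<in> W z"
          using T(1) unfolding FW by (metis act_inv(1) matrix_inv_cancel(1) act_def imageI)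
        then obtain y where y: "y \<in> E0" "N h *v x = y + N z *v y" unfolding Wmem by blast
        have "y $ i = 0" for i
        proof (cases "i \<in> I0")
          case True
          then show ?thesis using arg_cong[OF y(2), of "\<lambda>v. v $ i"] by (simp add: Nmv_I0)
        next
          case False then show ?thesis using y(1) by (simp add: coord_space_def)
        qed
        then have "y = 0" by (simp add: vec_eq_iff)
        then show ?thesis using y(2) by simp
      qed
      then have "N h *v axis (cl (e k)) 1 = 0" using cl[OF eS[OF k]] by simp
      then show "h k = 0" using N_entry[OF k, of h 1] by simp
    qed
    ultimately show ?thesis
      unfolding gr_differential_rank_def gr_chart_dom_def using I by blast
  qed
  have swept: "F z \<in> \<Union>B" if z: "z \<in> cspace d" "z \<noteq> (\<lambda>_. 0)" for z
  proof -
    obtain k where k: "k < d" "z k \<noteq> 0"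
      using z by (auto simp: cspace_def fun_eq_iff) (metis linorder_not_le)
    define s where "s = e k"
    have s: "s \<in> S" unfolding s_def by (rule eS[OF k(1)])
    have "\<exists>X. L X \<noteq> 0 \<and> act X (W z) \<subseteq> W z"
    proof (cases "s \<in> I0")
      case False
      then have s1: "s \<notin> I0" "(s \<in> range Inl) = (i0 \<in> range Inl)" "rw s = s" "cl s = i0"
        using s by (auto simp: S_def S1_def S2_def rw_def cl_def)
      \<comment> \<open>On \<open>W z\<close> the coordinates satisfy
        \<open>v $ s = z k * v $ i0\<close>, so the second summand cancels the first and
        \<open>?X\<close> annihilates \<open>W z\<close>. The correction lies in a column outside
        \<open>I0\<close>, where \<open>L\<close> vanishes.\<close>
      let ?X = "mu j0 i0 c + mu j0 s (- c / z k)"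
      have "L ?X = L (mu j0 i0 c)" using L(6)[of j0 s] s1(1) by (simp add: linear_add[OF L(1)])
      have "?X *v v = 0" if v: "v \<in> W z" for v
      proof -
        obtain x where x: "x \<in> E0" "v = x + N z *v x" using v unfolding Wmem by blast
        have "(N z *v x) $ s = (\<Sum>k'<d. if k' = k then z k * x $ i0 else 0)"
          unfolding Nmv sum_component
        proof (intro sum.cong refl)
          fix k' assume k': "k' \<in> {..<d}"
          have "rw (e k') = s \<longleftrightarrow> k' = k"
            using s1 L(4) k' k(1) einj[of k' k] by (auto simp: rw_def simp flip: s_def)
          then show "axis (rw (e k')) (z k' * x $ cl (e k')) $ s = (if k' = k then z k * x $ i0 else 0)"
            using s1 by (auto simp: axis_def simp flip: s_def)
        qed
        then have "v $ s = z k * x $ i0" using k(1) x s1(1) by (simp add: coord_space_def)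
        moreover have "v $ i0 = x $ i0" using x(2) Nmv_I0[OF L(3)] by simp
        ultimately show ?thesis
          using k(2) by (simp add: matrix_vector_mult_add_rdistrib mu_mv vec_eq_iff axis_def)
      qed
      moreover have "0 \<in> W z" unfolding Wmem by (rule bexI[of _ 0]) (simp_all add: coord_space_def)
      ultimately have "act ?X (W z) \<subseteq> W z" by (auto simp: act_def)
      with \<open>L ?X = L (mu j0 i0 c)\<close> show ?thesis using L(5) by (intro exI[of _ ?X]) simp
    next
      case True
      then have s2: "s \<in> I0" "(s \<in> range Inl) = (j0 \<in> range Inl)" "rw s = j0" "cl s = s"
        using s L(2) by (auto simp: S_def S1_def S2_def rw_def cl_def)
      \<comment> \<open>The added summand completes the vector in direction \<open>j0\<close> to an
        element \<open>y + N z *v y\<close> of \<open>W z\<close>, with \<open>y\<close> a multiple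
        of the basis vector \<open>s\<close>. It lies in a row of \<open>I0\<close>, where
        \<open>L\<close> vanishes.\<close>
      let ?X = "mu j0 i0 c + mu s i0 (c / z k)"
      have "L ?X = L (mu j0 i0 c)" using L(6)[of s i0] s2(1) by (simp add: linear_add[OF L(1)])
      moreover have "?X *v v \<in> W z" for v
      proof -
        let ?y = "axis s (c / z k * v $ i0)"
        have "N z *v ?y = (\<Sum>k'<d. if k' = k then axis j0 (c * v $ i0) else 0)"
          unfolding Nmv
        proof (intro sum.cong refl)
          fix k' assume k': "k' \<in> {..<d}"
          have "cl (e k') = s \<longleftrightarrow> k' = k"
            using s2 L(4) k' k(1) einj[of k' k] by (auto simp: cl_def simp flip: s_def)
          then show "axis (rw (e k')) (z k' * ?y $ cl (e k')) = (if k' = k then axis j0 (c * v $ i0) else 0)"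
            using s2 k(2) by (auto simp: axis_def vec_eq_iff simp flip: s_def)
        qed
        then have "?X *v v = ?y + N z *v ?y"
          using k(1) by (simp add: matrix_vector_mult_add_rdistrib mu_mv)
        moreover have "?y \<in> E0" using s2(1) by simp
        ultimately show ?thesis unfolding Wmem by blast
      qed
      then have "act ?X (W z) \<subseteq> W z" by (auto simp: act_def)
      ultimately show ?thesis using L(5) by (intro exI[of _ ?X]) simp
    qed
    then obtain X where X: "L X \<noteq> 0" "act X (W z) \<subseteq> W z" by blast
    show ?thesis unfolding FW by (rule L(7)[OF X WC])
  qed
  show ?thesis
  proof (rule that[OF d_ge hol FC F0])
    show "\<forall>z\<in>closed_polydisk d 1. gr_differential_rank (r + r') d F z d" using rank by blast
    show "F ` (closed_polydisk d 1 - {\<lambda>_. 0}) \<subseteq> \<Union>B" using swept sub by blast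
  qed
qed

lemma boundary_point_supporting_cycle:
  assumes B: "openin (M_D_topology D C0) B"
    and cpt: "compactin (M_D_topology D C0) (M_D_topology D C0 closure_of B)"
    and p0: "p0 \<in> subtopology (gr_topology (r + r')) D frontier_of (\<Union>B)"
  obtains C where "C \<in> M_D_topology D C0 frontier_of B" "p0 \<in> C" "p0 \<notin> \<Union>B"
proof -
  let ?X = "subtopology (gr_topology (r + r')) D"
  have BM: "B \<subseteq> MD" using B openin_MD_topology by blast
  have "\<Union>B \<subseteq> D" using BM MD_subset by blast
  then have "\<Union>B = \<Union>B \<inter> D" by blast
  then have "openin ?X (\<Union>B)" using openin_Union_cycles[OF B] unfolding openin_subtopology by blast
  then have p0': "p0 \<notin> \<Union>B" "p0 \<in> ?X closure_of (\<Union>B)"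
    using p0 by (simp_all add: frontier_of_def interior_of_openin)
  have top: "p0 \<in> topspace ?X" and meet: "\<forall>N. p0 \<in> N \<and> openin ?X N \<longrightarrow> (\<exists>y. y \<in> \<Union>B \<and> y \<in> N)"
    using p0'(2) unfolding in_closure_of by (rule conjunct1, rule conjunct2)
  have pG: "p0 \<in> Gr (r + r')" and pD: "p0 \<in> D" using top by (simp_all add: topspace_gr_topology)
  have "W \<inter> \<Union>B \<noteq> {}" if W: "openin (gr_topology (r + r')) W" "p0 \<in> W" for W
  proof -
    have "openin ?X (W \<inter> D)" using W(1) unfolding openin_subtopology by blast
    then show ?thesis using meet[THEN spec, of "W \<inter> D"] W(2) pD by blast
  qed
  then obtain C where C: "C \<in> M_D_topology D C0 closure_of B" "p0 \<in> C"
    by (rule closure_incidence[OF BM cpt pG])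
  have "C \<notin> B" using C(2) p0'(1) by blast
  then have "C \<in> M_D_topology D C0 frontier_of B" using C(1) B by (simp add: frontier_of_def interior_of_openin)
  from that[OF this C(2) p0'(1)] show ?thesis .
qed

lemma c_inv_lower_bound:
  assumes B: "relatively_compact_smooth_domain D C0 B" "C0 \<in> B"
  shows "c_inv (r + r') D C0 B \<ge> min (r + CARD('q) - r') (CARD('p) - r + r')"
proof -
  let ?X = "subtopology (gr_topology (r + r')) D"
  let ?m = "min (r + CARD('q) - r') (CARD('p) - r + r')"
  have oB: "openin (M_D_topology D C0) B" and cpt: "compactin (M_D_topology D C0) (M_D_topology D C0 closure_of B)"
    and sm: "smooth_boundary D C0 B"
    using B(1) by (simp_all add: relatively_compact_smooth_domain_def)
  have Y: "swept_domain D C0 B = \<Union>B" using oB openin_MD_topology by (intro swept_domain_eq) blast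
  have "?m \<le> c_point (r + r') D C0 B p0" if p0: "p0 \<in> ?X frontier_of (\<Union>B)" for p0
  proof -
    obtain C where C: "C \<in> M_D_topology D C0 frontier_of B" "p0 \<in> C" "p0 \<notin> \<Union>B"
      by (rule boundary_point_supporting_cycle[OF oB cpt p0])
    obtain d F where F: "?m \<le> d"
      "gr_holomorphic_on (r + r') d F (closed_polydisk d 1)" "F ` closed_polydisk d 1 \<subseteq> C" "F (\<lambda>_. 0) = p0"
      "\<forall>z\<in>closed_polydisk d 1. gr_differential_rank (r + r') d F z d"
      "F ` (closed_polydisk d 1 - {\<lambda>_. 0}) \<subseteq> \<Union>B"
      by (rule cycle_polydisk[OF oB sm C])
    note F(1)
    also have "d \<le> c_cycle (r + r') (\<Union>B) C p0"
      unfolding c_cycle_def by (rule Max_ge[OF finite_polydisk_dims]) (use F(2-6) in \<open>auto intro!: exI[of _ "1::real"] exI[of _ F]\<close>)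
    also have "\<dots> \<le> c_point (r + r') D C0 B p0"
      unfolding c_point_def Y supporting_cycles_def
      using C(1,2) by (intro Max_ge finite_subset[OF c_cycle_values] imageI) simp_all
    finally show ?thesis .
  qed
  \<comment> \<open>The frontier may be infinite, but each value is a maximum over a subset of one
    fixed finite set.\<close>
  moreover have "finite (c_point (r + r') D C0 B ` (?X frontier_of (\<Union>B)))"
  proof (rule finite_subset)
    let ?V = "insert (Max {}) {..CARD(('p + 'q) \<times> ('p + 'q))} :: nat set"
    show "c_point (r + r') D C0 B ` (?X frontier_of (\<Union>B)) \<subseteq> Max ` Pow ?V"
      unfolding c_point_def by (intro image_subsetI imageI PowI c_cycle_values)
  qed simp
  moreover have "c_point (r + r') D C0 B ` (?X frontier_of (\<Union>B)) \<noteq> {}"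
    using frontier_nonempty[OF oB B(2) cpt] by blast
  ultimately show ?thesis unfolding c_inv_def Y by (simp add: Min_ge_iff)
qed

end

theorem corollary6p2:
  fixes r r' :: nat
    and K0 :: "(complex ^ ('p::finite + 'q::finite) ^ ('p + 'q)) set"
    and C0 :: "(complex ^ ('p + 'q)) set set"
    and B :: "(complex ^ ('p + 'q)) set set set"
  assumes "r \<le> CARD('p)" and "r' \<le> CARD('q)"
    and "1 \<le> r + r'" and "r + r' \<le> CARD('p) + CARD('q) - 1"
    and "maximal_compact_subgroup K0 SU"
    and "base_cycle K0 r r' C0"
    and "relatively_compact_smooth_domain (flag_domain r r') C0 B"
    and "C0 \<in> B"
  shows "c_inv (r + r') (flag_domain r r') C0 B
    \<ge> min (r + CARD('q) - r') (CARD('p) - r + r')"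
proof -
  obtain V where V: "V \<in> flag_domain r r'" "C0 = {act g V | g. g \<in> K0}"
    and sub: "gr_complex_submanifold (r + r') C0"
    using assms(6) unfolding base_cycle_def by blast
  obtain T where T: "cadj T ** E_mat ** T = E_mat" "K0 = (\<lambda>u. T ** u ** matrix_inv T) ` UU"
    by (rule maximal_compact_subgroup_SU[OF assms(5)])
  have iT: "invertible T" by (rule invertible_preserves_herm[OF T(1)])
  have split: "split_space (act (matrix_inv T) V)"
    by (rule complex_orbit_split[OF T(1) V(1) V(2)[unfolded T(2)] sub])
  have VT: "act (matrix_inv T) V \<in> flag_domain r r'"
    by (rule act_flag_domain[OF preserves_herm_inv[OF T(1)] V(1)])
  obtain Ia :: "'p set" where Ia: "card Ia = r" using obtain_subset_with_card_n[OF assms(1)] by blast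
  obtain Ib :: "'q set" where Ib: "card Ib = r'" using obtain_subset_with_card_n[OF assms(2)] by blast
  \<comment> \<open>A coordinate subspace of signature \<open>(r, r')\<close>; the bounds on
    \<open>r\<close> and \<open>r'\<close> by the block sizes make the choice possible.\<close>
  define I where "I = Inl ` Ia \<union> Inr ` Ib"
  have "I \<inter> range Inl = Inl ` Ia" "I \<inter> range Inr = Inr ` Ib" by (auto simp: I_def)
  then have I: "card (I \<inter> range Inl) = r" "card (I \<inter> range Inr) = r'"
    using Ia Ib by (simp_all add: card_image)
  obtain u where u: "u \<in> UU" "act u (coord_space I) = act (matrix_inv T) V"
    by (rule split_space_unitary_frame[OF split VT I])
  have "C0 = act_cycle T ((\<lambda>w. act w (act (matrix_inv T) V)) ` UU)"
    by (simp add: V(2) T(2) act_cycle_def setcompr_eq_image image_image act_mult)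
  also have "(\<lambda>w. act w (act (matrix_inv T) V)) ` UU = Cstd I"
  proof (intro equalityI subsetI)
    fix X assume "X \<in> (\<lambda>w. act w (act (matrix_inv T) V)) ` UU"
    then obtain w where "w \<in> UU" "X = act (w ** u) (coord_space I)" by (auto simp: act_mult u(2))
    then show "X \<in> Cstd I" using UU_mult[OF _ u(1)] by (auto simp: Cstd_def)
  next
    fix X assume "X \<in> Cstd I"
    then obtain w where w: "w \<in> UU" "X = act w (coord_space I)" by (auto simp: Cstd_def)
    have "X = act (w ** cadj u) (act u (coord_space I))"
      by (simp add: w(2) flip: act_mult matrix_mul_assoc) (simp add: UU_D(1)[OF u(1)])
    then show "X \<in> (\<lambda>w. act w (act (matrix_inv T) V)) ` UU"
      using UU_mult[OF w(1) UU_cadj[OF u(1)]] by (auto simp: u(2))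
  qed
  finally have C0: "C0 = act_cycle T (Cstd I)" .
  have "r + r' < CARD('p) + CARD('q)" using assms(3,4) by simp
  then interpret framed_cycle r r' T I C0
    using T(1) I C0 assms(3) by unfold_locales
  show ?thesis by (rule c_inv_lower_bound[OF assms(7,8)])
qed

end
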